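(* Let $\Omega\subset\mathbb{R}^{N}$ be a bounded domain containing the origin, let $f,g,h,R$ satisfy the standing assumptions on the data listed in the context, and let $v^*$ be the optimal value function. Suppose there are constants $\alpha^*,\beta^*>0$ with $\alpha^*\|x\|^2\le v^*(x)\le\beta^*\|x\|^2$ for all $x\in\Omega$, and fix numbers $0<\alpha\le\alpha^*$ and $\beta\ge\beta^*$. Let $(X_n)_{n\in\mathbb{N}}$ be a nested (increasing) family of finite subsets of $\Omega\setminus\{0\}$ whose union is dense in $\Omega$. Let $k\in C^2(\Omega\times\Omega,\mathbb{R})$ be a positive definite kernel with reproducing kernel Hilbert space $\mathcal{H}_k(\Omega)$ and suppose $v^*\in\mathcal{H}_k(\Omega)$. For each $n$, let $\mathcal{M}_{X_n,\alpha,\beta}\subset\mathcal{H}_k(\Omega)$ be the set of minimizers of $$\min_{v\in\mathcal{H}_k(\Omega)}\|v\|_{\mathcal{H}_k(\Omega)}\quad\text{s.t.}\quad\begin{cases}\langle f(x),\nabla v(x)\rangle-\frac14\|g(x)^\top\nabla v(x)\|_{R^{-1}}^2+h(x)=0,& x\in X_n,\\ \beta\|x\|^2\ge v(x)\ge\alpha\|x\|^2,& x\in X_n,\\ v(0)=0.\end{cases}$$ Then there exists a subdomain $\tilde\Omega\subset\Omega$ containing the origin such that, for any sequence $(v_n)_{n\in\mathbb{N}}$ with $v_n\in\mathcal{M}_{X_n,\alpha,\beta}$ for all $n$, $$\lim_{n\to\infty}\|v_n-v^*\|_{\mathcal{H}_k(\tilde\Omega)}=0.$$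
   Context: Let $N,M\in\mathbb{N}$. $\langle\cdot,\cdot\rangle$ is the Euclidean inner product, $\|\cdot\|$ the Euclidean norm, and $\|y\|_A:=\sqrt{\langle y,Ay\rangle}$ for symmetric positive definite $A$. A domain is a nonempty, open, connected subset of $\mathbb{R}^N$; a subdomain of $\Omega$ is a domain contained in $\Omega$. Standing assumptions on the data: $f\in C^1(\mathbb{R}^N,\mathbb{R}^N)$, $g\in C^1(\mathbb{R}^N,\mathbb{R}^{N\times M})$, $h\in C^1(\mathbb{R}^N,\mathbb{R})$, $R\in\mathbb{R}^{M\times M}$ is symmetric positive definite, $f(0)=0$, $h(0)=0$ and $h(x)>0$ for all $x\ne0$. Optimal control problem: let $\mathcal{U}_\infty:=L^\infty([0,\infty);\mathbb{R}^M)$. For $x\in\mathbb{R}^N$ and $\mathbf{u}\in\mathcal{U}_\infty$ let $\mathbf{x}_{\mathbf{u}}(\cdot;x)$ be the unique maximal Carathéodory solution of $\dot{\mathbf{x}}_{\mathbf{u}}(t;x)=f(\mathbf{x}_{\mathbf{u}}(t;x))+g(\mathbf{x}_{\mathbf{u}}(t;x))\mathbf{u}(t)$, $\mathbf{x}_{\mathbf{u}}(0;x)=x$. Put $$J_\infty(x,\mathbf{u}):=\int_0^\infty h(\mathbf{x}_{\mathbf{u}}(t;x))+\langle\mathbf{u}(t),R\mathbf{u}(t)\rangle\,dt,$$ with $J_\infty(x,\mathbf{u}):=+\infty$ if the trajectory blows up in finite time. The optimal value function is $v^*(x):=\inf_{\mathbf{u}\in\mathcal{U}_\infty}J_\infty(x,\mathbf{u})$.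 "$v^*\in\mathcal{H}_k(\Omega)$" means that $v^*$ is finite on $\Omega$ and its restriction to $\Omega$ belongs to $\mathcal{H}_k(\Omega)$. A kernel is a symmetric function $k:\Omega\times\Omega\to\mathbb{R}$; it is positive definite if for every finite set of pairwise distinct points $x_1,\dots,x_n\in\Omega$ the matrix $(k(x_i,x_j))_{i,j}$ is positive semidefinite. $\mathcal{H}_k(\Omega)$ is the unique Hilbert space of real-valued functions on $\Omega$ with reproducing kernel $k$. $\mathcal{H}_k(\tilde\Omega)$ denotes the reproducing kernel Hilbert space on $\tilde\Omega$ of the restriction of $k$ to $\tilde\Omega\times\tilde\Omega$, and $\|v_n-v^*\|_{\mathcal{H}_k(\tilde\Omega)}$ is the norm of the restriction of $v_n-v^*$ to $\tilde\Omega$. *)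

theory Defs
  imports "HOL-Analysis.Analysis"
begin

section \<open>Differentiability classes, domains, matrices\<close>

text \<open>Both notions are meant for open \<open>S\<close>; continuity of the lower-order derivatives is automatic.\<close>

definition C1_on :: "'a::real_normed_vector set \<Rightarrow> ('a \<Rightarrow> 'b::real_normed_vector) \<Rightarrow> bool" where
  "C1_on S F \<longleftrightarrow> (\<exists>F' :: 'a \<Rightarrow> 'a \<Rightarrow>\<^sub>L 'b.
     (\<forall>x\<in>S. (F has_derivative blinfun_apply (F' x)) (at x)) \<and> continuous_on S F')"

definition C2_on :: "'a::real_normed_vector set \<Rightarrow> ('a \<Rightarrow> 'b::real_normed_vector) \<Rightarrow> bool" where
  "C2_on S F \<longleftrightarrow> (\<exists>(F' :: 'a \<Rightarrow> 'a \<Rightarrow>\<^sub>L 'b) (F'' :: 'a \<Rightarrow> 'a \<Rightarrow>\<^sub>L ('a \<Rightarrow>\<^sub>L 'b)).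
     (\<forall>x\<in>S. (F has_derivative blinfun_apply (F' x)) (at x)) \<and>
     (\<forall>x\<in>S. (F' has_derivative blinfun_apply (F'' x)) (at x)) \<and> continuous_on S F'')"

definition gradient :: "('a::real_inner \<Rightarrow> real) \<Rightarrow> 'a \<Rightarrow> 'a" where
  "gradient v x = (THE D. GDERIV v x :> D)"

definition is_domain :: "'a::topological_space set \<Rightarrow> bool" where
  "is_domain S \<longleftrightarrow> S \<noteq> {} \<and> open S \<and> connected S"

definition sym_pos_def :: "real^'m^'m \<Rightarrow> bool" where
  "sym_pos_def A \<longleftrightarrow> transpose A = A \<and> (\<forall>y. y \<noteq> 0 \<longrightarrow> 0 < y \<bullet> (A *v y))"

definition weighted_norm :: "real^'m^'m \<Rightarrow> real^'m \<Rightarrow> real" where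
  "weighted_norm A y = sqrt (y \<bullet> (A *v y))"

definition standing_data ::
  "(real^'n \<Rightarrow> real^'n) \<Rightarrow> (real^'n \<Rightarrow> real^'m^'n) \<Rightarrow> (real^'n \<Rightarrow> real) \<Rightarrow> real^'m^'m \<Rightarrow> bool" where
  "standing_data f g h R \<longleftrightarrow> C1_on UNIV f \<and> C1_on UNIV g \<and> C1_on UNIV h \<and> sym_pos_def R \<and>
     f 0 = 0 \<and> h 0 = 0 \<and> (\<forall>x. x \<noteq> 0 \<longrightarrow> 0 < h x)"


section \<open>The optimal control problem\<close>

text \<open>Absolute continuity on \<open>{a..b}\<close>: the finite families of non-overlapping compact subintervals
  are the sets \<open>d\<close> that are a division of their own union.\<close>

definition abs_continuous_on_Icc :: "real \<Rightarrow> real \<Rightarrow> (real \<Rightarrow> 'b::real_normed_vector) \<Rightarrow> bool" where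
  "abs_continuous_on_Icc a b y \<longleftrightarrow> (\<forall>\<epsilon>>0. \<exists>\<delta>>0. \<forall>d.
     d division_of (\<Union>d) \<and> \<Union>d \<subseteq> {a..b} \<and> (\<Sum>I\<in>d. Sup I - Inf I) < \<delta> \<longrightarrow>
     (\<Sum>I\<in>d. norm (y (Sup I) - y (Inf I))) < \<epsilon>)"

text \<open>Controls are represented by functions on \<open>real\<close> (not by equivalence classes); values at
  negative times are irrelevant.\<close>

definition Linf_controls :: "(real \<Rightarrow> real^'m) set" where
  "Linf_controls = {u. u \<in> borel_measurable (lebesgue_on {0..}) \<and>
     (\<exists>B. AE t in lebesgue_on {0..}. norm (u t) \<le> B)}"

definition caratheodory_solution ::
  "(real^'n \<Rightarrow> real^'n) \<Rightarrow> (real^'n \<Rightarrow> real^'m^'n) \<Rightarrow> (real \<Rightarrow> real^'m) \<Rightarrow> real^'n \<Rightarrow>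
   ereal \<Rightarrow> (real \<Rightarrow> real^'n) \<Rightarrow> bool" where
  "caratheodory_solution f g u x T y \<longleftrightarrow> 0 < T \<and> y 0 = x \<and>
     (\<forall>t\<ge>0. ereal t < T \<longrightarrow> abs_continuous_on_Icc 0 t y) \<and>
     (AE t in lebesgue. 0 < t \<and> ereal t < T \<longrightarrow>
        (y has_vector_derivative (f (y t) + g (y t) *v u t)) (at t))"

text \<open>Solutions on \<open>[0,T)\<close> are unique for every \<open>T\<close>, so the maximal solution is defined on
  \<open>[0, existence_time)\<close> and takes there the common value of all solutions.\<close>

definition existence_time ::
  "(real^'n \<Rightarrow> real^'n) \<Rightarrow> (real^'n \<Rightarrow> real^'m^'n) \<Rightarrow> (real \<Rightarrow> real^'m) \<Rightarrow> real^'n \<Rightarrow> ereal" where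
  "existence_time f g u x = Sup {T. \<exists>y. caratheodory_solution f g u x T y}"

definition trajectory ::
  "(real^'n \<Rightarrow> real^'n) \<Rightarrow> (real^'n \<Rightarrow> real^'m^'n) \<Rightarrow> (real \<Rightarrow> real^'m) \<Rightarrow> real^'n \<Rightarrow> real \<Rightarrow> real^'n" where
  "trajectory f g u x t =
     (THE p. \<exists>T y. caratheodory_solution f g u x T y \<and> 0 \<le> t \<and> ereal t < T \<and> y t = p)"

definition cost ::
  "(real^'n \<Rightarrow> real^'n) \<Rightarrow> (real^'n \<Rightarrow> real^'m^'n) \<Rightarrow> (real^'n \<Rightarrow> real) \<Rightarrow> real^'m^'m \<Rightarrow>
   real^'n \<Rightarrow> (real \<Rightarrow> real^'m) \<Rightarrow> ennreal" where
  "cost f g h R x u =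
     (if existence_time f g u x = \<infinity>
      then \<integral>\<^sup>+t. ennreal (h (trajectory f g u x t) + u t \<bullet> (R *v u t)) \<partial>lebesgue_on {0..}
      else \<infinity>)"

definition opt_value ::
  "(real^'n \<Rightarrow> real^'n) \<Rightarrow> (real^'n \<Rightarrow> real^'m^'n) \<Rightarrow> (real^'n \<Rightarrow> real) \<Rightarrow> real^'m^'m \<Rightarrow>
   real^'n \<Rightarrow> ennreal" where
  "opt_value f g h R x = (INF u\<in>Linf_controls. cost f g h R x u)"


section \<open>Kernels and reproducing kernel Hilbert spaces\<close>

definition pos_def_kernel :: "'a set \<Rightarrow> ('a \<Rightarrow> 'a \<Rightarrow> real) \<Rightarrow> bool" where
  "pos_def_kernel D k \<longleftrightarrow> (\<forall>x\<in>D. \<forall>y\<in>D. k x y = k y x) \<and>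
     (\<forall>X c. finite X \<and> X \<subseteq> D \<longrightarrow> 0 \<le> (\<Sum>x\<in>X. \<Sum>y\<in>X. c x * c y * k x y))"

text \<open>A function on \<open>D\<close> is represented by its extension by \<open>0\<close> to the whole type.\<close>

definition restr :: "'a set \<Rightarrow> ('a \<Rightarrow> real) \<Rightarrow> 'a \<Rightarrow> real" where
  "restr D v = (\<lambda>x. if x \<in> D then v x else 0)"

definition hilbert_function_space ::
  "'a set \<Rightarrow> ('a \<Rightarrow> real) set \<Rightarrow> (('a \<Rightarrow> real) \<Rightarrow> ('a \<Rightarrow> real) \<Rightarrow> real) \<Rightarrow> bool" where
  "hilbert_function_space D H ip \<longleftrightarrow>
     (\<forall>v\<in>H. \<forall>x. x \<notin> D \<longrightarrow> v x = 0) \<and>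
     (\<lambda>x. 0) \<in> H \<and>
     (\<forall>v\<in>H. \<forall>w\<in>H. (\<lambda>x. v x + w x) \<in> H) \<and>
     (\<forall>c. \<forall>v\<in>H. (\<lambda>x. c * v x) \<in> H) \<and>
     (\<forall>v\<in>H. \<forall>w\<in>H. ip v w = ip w v) \<and>
     (\<forall>v\<in>H. \<forall>v'\<in>H. \<forall>w\<in>H. ip (\<lambda>x. v x + v' x) w = ip v w + ip v' w) \<and>
     (\<forall>c. \<forall>v\<in>H. \<forall>w\<in>H. ip (\<lambda>x. c * v x) w = c * ip v w) \<and>
     (\<forall>v\<in>H. v \<noteq> (\<lambda>x. 0) \<longrightarrow> 0 < ip v v) \<and>
     (let dst = (\<lambda>v w. sqrt (ip (\<lambda>x. v x - w x) (\<lambda>x. v x - w x))) in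
       \<forall>s :: nat \<Rightarrow> 'a \<Rightarrow> real.
         (\<forall>i. s i \<in> H) \<and> (\<forall>\<epsilon>>0. \<exists>i0. \<forall>i\<ge>i0. \<forall>j\<ge>i0. dst (s i) (s j) < \<epsilon>) \<longrightarrow>
         (\<exists>v\<in>H. (\<lambda>i. dst (s i) v) \<longlonglongrightarrow> 0))"

definition is_rkhs ::
  "'a set \<Rightarrow> ('a \<Rightarrow> 'a \<Rightarrow> real) \<Rightarrow> ('a \<Rightarrow> real) set \<Rightarrow> (('a \<Rightarrow> real) \<Rightarrow> ('a \<Rightarrow> real) \<Rightarrow> real) \<Rightarrow> bool" where
  "is_rkhs D k H ip \<longleftrightarrow> hilbert_function_space D H ip \<and>
     (\<forall>y\<in>D. restr D (\<lambda>x. k x y) \<in> H \<and> (\<forall>v\<in>H. ip v (restr D (\<lambda>x. k x y)) = v y))"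

text \<open>For a positive definite kernel \<open>k\<close> the pair \<open>(H, ip)\<close> in \<^const>\<open>is_rkhs\<close> exists and is unique
  (\<open>ip\<close> up to its values outside \<open>H \<times> H\<close>), so the following are its carrier and its norm.\<close>

definition rkhs :: "'a set \<Rightarrow> ('a \<Rightarrow> 'a \<Rightarrow> real) \<Rightarrow> ('a \<Rightarrow> real) set" where
  "rkhs D k = {v. \<exists>H ip. is_rkhs D k H ip \<and> v \<in> H}"

definition rkhs_norm :: "'a set \<Rightarrow> ('a \<Rightarrow> 'a \<Rightarrow> real) \<Rightarrow> ('a \<Rightarrow> real) \<Rightarrow> real" where
  "rkhs_norm D k v = (THE r. \<exists>H ip. is_rkhs D k H ip \<and> v \<in> H \<and> r = sqrt (ip v v))"


section \<open>The collocation problem\<close>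

definition feasible ::
  "(real^'n \<Rightarrow> real^'n) \<Rightarrow> (real^'n \<Rightarrow> real^'m^'n) \<Rightarrow> (real^'n \<Rightarrow> real) \<Rightarrow> real^'m^'m \<Rightarrow>
   (real^'n) set \<Rightarrow> (real^'n \<Rightarrow> real^'n \<Rightarrow> real) \<Rightarrow> (real^'n) set \<Rightarrow> real \<Rightarrow> real \<Rightarrow>
   (real^'n \<Rightarrow> real) set" where
  "feasible f g h R D k X \<alpha> \<beta> = {v \<in> rkhs D k.
     (\<forall>x\<in>X. f x \<bullet> gradient v x
        - 1/4 * (weighted_norm (matrix_inv R) (transpose (g x) *v gradient v x))\<^sup>2 + h x = 0) \<and>
     (\<forall>x\<in>X. \<beta> * (norm x)\<^sup>2 \<ge> v x \<and> v x \<ge> \<alpha> * (norm x)\<^sup>2) \<and>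
     v 0 = 0}"

definition minimizers ::
  "(real^'n \<Rightarrow> real^'n) \<Rightarrow> (real^'n \<Rightarrow> real^'m^'n) \<Rightarrow> (real^'n \<Rightarrow> real) \<Rightarrow> real^'m^'m \<Rightarrow>
   (real^'n) set \<Rightarrow> (real^'n \<Rightarrow> real^'n \<Rightarrow> real) \<Rightarrow> (real^'n) set \<Rightarrow> real \<Rightarrow> real \<Rightarrow>
   (real^'n \<Rightarrow> real) set" where
  "minimizers f g h R D k X \<alpha> \<beta> = {v \<in> feasible f g h R D k X \<alpha> \<beta>.
     \<forall>w\<in>feasible f g h R D k X \<alpha> \<beta>. rkhs_norm D k v \<le> rkhs_norm D k w}"

end

theory Submission
  imports Defs "HOL-Complex_Analysis.Great_Picard"
begin

text \<open>
  Let \<open>H\<close> be the reproducing kernel Hilbert space on \<open>\<Omega>\<close>. Since \<open>k\<close> is \<open>C\<^sup>2\<close>, the functions in \<open>H\<close> are \<open>C\<^sup>1\<close>, and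
  point values and gradients depend continuously on the element of \<open>H\<close>. By dynamic programming the optimal
  value function \<open>V\<close> solves the Hamilton-Jacobi-Bellman equation, so it is feasible for every collocation
  problem and bounds the norms of the minimizers. After passing to a subsequence, values and gradients of the
  minimizers converge at all collocation points; some function in \<open>H\<close> of at most the limiting norm has
  these limits, hence is feasible for all \<open>n\<close>, and the parallelogram law turns this into norm convergence to some
  \<open>u\<close>. By density \<open>u\<close> solves the equation on all of \<open>\<Omega>\<close> and satisfies the quadratic bounds there. Finally, a
  comparison principle on sublevel sets shows that such solutions coincide on a ball around the origin whose
  radius does not depend on the sequence; as every subsequence has a further subsequence with this limit on the
  ball, the whole sequence converges there.
\<close>

section \<open>Hilbert spaces of functions and reproducing kernels\<close>

text \<open>The collocation equations are quadratic in the gradient, so the feasible sets need not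
  be convex: minimizers are not known to be unique, and no projection argument ties consecutive
  minimizers together. Compactness is used only for the countably many values and gradients at
  collocation points; once these limits are prescribed the constraints become linear, and convexity
  is available again. The limit \<open>u\<close> may depend on the subsequence. Equation and
  quadratic bounds are shown to determine it only where sublevel sets stay inside a ball
  \<open>cball 0 r\<close> contained in \<Omega>. If a solution \<open>v\<close> has
  \<open>v x < \<alpha> * r\<^sup>2\<close>, the lower bound keeps its sublevel set through
  \<open>x\<close> away from the sphere of radius \<open>r\<close>; the upper bound ensures this for
  all competing solutions at once when \<open>norm x < \<rho>\<close> and
  \<open>\<beta> * \<rho>\<^sup>2 < \<alpha> * r\<^sup>2\<close>. This is the origin of the
  subdomain. Trajectories and controls serve only to derive the equation for \<open>V\<close>. As an
  element of \<open>H\<close>, \<open>V\<close> is continuously differentiable, so the equation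
  holds classically; the comparison itself differentiates along straight lines only.\<close>

locale hilbert_functions =
  fixes D :: "'a set" and H :: "('a \<Rightarrow> real) set" and ip :: "('a \<Rightarrow> real) \<Rightarrow> ('a \<Rightarrow> real) \<Rightarrow> real"
  assumes space: "hilbert_function_space D H ip"
begin

lemma outside: "v \<in> H \<Longrightarrow> x \<notin> D \<Longrightarrow> v x = 0"
  and zero_in: "(\<lambda>x. 0) \<in> H"
  and add_in: "v \<in> H \<Longrightarrow> w \<in> H \<Longrightarrow> (\<lambda>x. v x + w x) \<in> H"
  and scale_in: "v \<in> H \<Longrightarrow> (\<lambda>x. c * v x) \<in> H"
  and ip_sym: "v \<in> H \<Longrightarrow> w \<in> H \<Longrightarrow> ip v w = ip w v"
  and ip_add_left: "v \<in> H \<Longrightarrow> v' \<in> H \<Longrightarrow> w \<in> H \<Longrightarrow> ip (\<lambda>x. v x + v' x) w = ip v w + ip v' w"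
  and ip_scale_left: "v \<in> H \<Longrightarrow> w \<in> H \<Longrightarrow> ip (\<lambda>x. c * v x) w = c * ip v w"
  and ip_pos: "v \<in> H \<Longrightarrow> v \<noteq> (\<lambda>x. 0) \<Longrightarrow> 0 < ip v v"
  using space unfolding hilbert_function_space_def by blast+

lemma complete:
  assumes "\<And>i. s i \<in> H"
    and "\<And>\<epsilon>. \<epsilon> > 0 \<Longrightarrow> \<exists>i0::nat. \<forall>i\<ge>i0. \<forall>j\<ge>i0. sqrt (ip (\<lambda>x. s i x - s j x) (\<lambda>x. s i x - s j x)) < \<epsilon>"
  obtains v where "v \<in> H" "(\<lambda>i. sqrt (ip (\<lambda>x. s i x - v x) (\<lambda>x. s i x - v x))) \<longlonglongrightarrow> 0"
proof -
  have "\<forall>s :: nat \<Rightarrow> 'a \<Rightarrow> real.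
         (\<forall>i. s i \<in> H) \<and> (\<forall>\<epsilon>>0. \<exists>i0. \<forall>i\<ge>i0. \<forall>j\<ge>i0. sqrt (ip (\<lambda>x. s i x - s j x) (\<lambda>x. s i x - s j x)) < \<epsilon>) \<longrightarrow>
         (\<exists>v\<in>H. (\<lambda>i. sqrt (ip (\<lambda>x. s i x - v x) (\<lambda>x. s i x - v x))) \<longlonglongrightarrow> 0)"
    using space unfolding hilbert_function_space_def Let_def by (elim conjE) assumption
  then show ?thesis using assms that by blast
qed

lemma diff_in: "v \<in> H \<Longrightarrow> w \<in> H \<Longrightarrow> (\<lambda>x. v x - w x) \<in> H"
  using add_in[of v "\<lambda>x. (-1) * w x"] scale_in[of w "-1"] by simp

lemma ip_add_right: "v \<in> H \<Longrightarrow> v' \<in> H \<Longrightarrow> w \<in> H \<Longrightarrow> ip w (\<lambda>x. v x + v' x) = ip w v + ip w v'"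
  by (simp add: ip_sym[of w] add_in ip_add_left)

lemma ip_scale_right: "v \<in> H \<Longrightarrow> w \<in> H \<Longrightarrow> ip w (\<lambda>x. c * v x) = c * ip w v"
  by (simp add: ip_sym[of w] scale_in ip_scale_left)

lemma ip_diff_left: "v \<in> H \<Longrightarrow> v' \<in> H \<Longrightarrow> w \<in> H \<Longrightarrow> ip (\<lambda>x. v x - v' x) w = ip v w - ip v' w"
  using ip_add_left[of v "\<lambda>x. (-1) * v' x" w] scale_in[of v' "-1"] ip_scale_left[of v' w "-1"] by simp

lemma ip_diff_right: "v \<in> H \<Longrightarrow> v' \<in> H \<Longrightarrow> w \<in> H \<Longrightarrow> ip w (\<lambda>x. v x - v' x) = ip w v - ip w v'"
  by (simp add: ip_sym[of w] diff_in ip_diff_left)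

lemma ip_zero_left: "w \<in> H \<Longrightarrow> ip (\<lambda>x. 0) w = 0"
  using ip_scale_left[of "\<lambda>x. 0" w 0] zero_in by simp

lemma ip_nonneg: "v \<in> H \<Longrightarrow> 0 \<le> ip v v"
  using ip_pos[of v] ip_zero_left[of v] by (cases "v = (\<lambda>x. 0)") auto

definition sqn :: "('a \<Rightarrow> real) \<Rightarrow> real" where "sqn v = ip v v"

text \<open>Squared distances keep all identities polynomial in \<open>ip\<close> and free of square
  roots; the price is the factor 2 in \<open>sqdist_tri\<close>.\<close>

definition sqdist :: "('a \<Rightarrow> real) \<Rightarrow> ('a \<Rightarrow> real) \<Rightarrow> real" where
  "sqdist v w = sqn (\<lambda>x. v x - w x)"

abbreviation tends_to :: "(nat \<Rightarrow> 'a \<Rightarrow> real) \<Rightarrow> ('a \<Rightarrow> real) \<Rightarrow> bool" where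
  "tends_to s v \<equiv> (\<lambda>i. sqdist (s i) v) \<longlonglongrightarrow> 0"

lemma sqn_nonneg: "v \<in> H \<Longrightarrow> 0 \<le> sqn v"
  by (simp add: sqn_def ip_nonneg)

lemma sqdist_nonneg: "v \<in> H \<Longrightarrow> w \<in> H \<Longrightarrow> 0 \<le> sqdist v w"
  by (simp add: sqdist_def sqn_nonneg diff_in)

lemma sqn_zero_iff: "v \<in> H \<Longrightarrow> sqn v \<le> 0 \<longleftrightarrow> v = (\<lambda>x. 0)"
  using ip_pos[of v] ip_zero_left[of v] by (cases "v = (\<lambda>x. 0)") (auto simp: sqn_def not_le)

lemma sqn_add: "v \<in> H \<Longrightarrow> w \<in> H \<Longrightarrow> sqn (\<lambda>x. v x + w x) = sqn v + 2 * ip v w + sqn w"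
  by (simp add: sqn_def ip_add_left ip_add_right add_in ip_sym[of w v])

lemma sqn_scale: "v \<in> H \<Longrightarrow> sqn (\<lambda>x. c * v x) = c\<^sup>2 * sqn v"
  by (simp add: sqn_def ip_scale_left ip_scale_right scale_in power2_eq_square)

lemma sqdist_eq: "v \<in> H \<Longrightarrow> w \<in> H \<Longrightarrow> sqdist v w = sqn v - 2 * ip v w + sqn w"
  by (simp add: sqdist_def sqn_def ip_diff_left ip_diff_right diff_in ip_sym[of w v])

lemma sqdist_sym: "v \<in> H \<Longrightarrow> w \<in> H \<Longrightarrow> sqdist v w = sqdist w v"
  by (simp add: sqdist_eq ip_sym[of v w])

text \<open>The parallelogram law, solved for the distance: two elements of nearly minimal norm are
  close as soon as their midpoint obeys nearly the same lower bound.\<close>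

lemma sqdist_midpoint:
  assumes "v \<in> H" "w \<in> H"
  shows "sqdist v w = 2 * sqn v + 2 * sqn w - 4 * sqn (\<lambda>x. (1/2) * v x + (1/2) * w x)"
  using assms sqn_add[of "\<lambda>x. (1/2) * v x" "\<lambda>x. (1/2) * w x"] sqn_scale[of v "1/2"] sqn_scale[of w "1/2"]
    ip_scale_left[of v "\<lambda>x. (1/2) * w x" "1/2"] ip_scale_right[of w v "1/2"] scale_in[of v "1/2"] scale_in[of w "1/2"]
    sqdist_eq[of v w]
  by (simp add: power2_eq_square)

lemma Cauchy_Schwarz:
  assumes "v \<in> H" "w \<in> H"
  shows "(ip v w)\<^sup>2 \<le> sqn v * sqn w"
proof (cases "w = (\<lambda>x. 0)")
  case True
  then show ?thesis using assms ip_zero_left[of v] ip_sym[of v w] ip_zero_left[of w] by (simp add: sqn_def)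
next
  case False
  then have pos: "0 < sqn w" using ip_pos assms by (simp add: sqn_def)
  define c where "c = ip v w / sqn w"
  have "0 \<le> sqdist v (\<lambda>x. c * w x)" using assms by (intro sqdist_nonneg scale_in)
  also have "\<dots> = sqn v - 2 * c * ip v w + c\<^sup>2 * sqn w"
    using assms by (simp add: sqdist_eq sqn_scale scale_in ip_scale_right)
  also have "\<dots> = sqn v - (ip v w)\<^sup>2 / sqn w"
    using pos by (simp add: c_def power2_eq_square)
  finally show ?thesis using pos by (simp add: field_simps)
qed

lemma abs_ip_le: "v \<in> H \<Longrightarrow> w \<in> H \<Longrightarrow> \<bar>ip v w\<bar> \<le> sqrt (sqn v) * sqrt (sqn w)"
  using Cauchy_Schwarz[of v w] real_sqrt_le_mono by (fastforce simp: real_sqrt_mult)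

text \<open>Nonnegativity of the squared norm of \<open>(u - v) - (v - w)\<close> bounds the cross
  term in the expansion of \<open>(u - v) + (v - w)\<close>.\<close>

lemma sqdist_tri:
  assumes "u \<in> H" "v \<in> H" "w \<in> H"
  shows "sqdist u w \<le> 2 * sqdist u v + 2 * sqdist v w"
proof -
  have "0 \<le> sqn (\<lambda>x. (u x - v x) + (-1) * (v x - w x))"
    using assms by (intro sqn_nonneg add_in scale_in diff_in)
  also have "\<dots> = sqdist u v - 2 * ip (\<lambda>x. u x - v x) (\<lambda>x. v x - w x) + sqdist v w"
    using assms sqn_add[of "\<lambda>x. u x - v x" "\<lambda>x. (-1) * (v x - w x)"]
      scale_in[of "\<lambda>x. v x - w x" "-1"]  sqn_scale[of "\<lambda>x. v x - w x" "-1"]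
      ip_scale_right[of "\<lambda>x. v x - w x" "\<lambda>x. u x - v x" "-1"]
    by (simp add: diff_in sqdist_def)
  finally have "2 * ip (\<lambda>x. u x - v x) (\<lambda>x. v x - w x) \<le> sqdist u v + sqdist v w" by simp
  moreover have "sqdist u w = sqdist u v + 2 * ip (\<lambda>x. u x - v x) (\<lambda>x. v x - w x) + sqdist v w"
    using assms sqn_add[of "\<lambda>x. u x - v x" "\<lambda>x. v x - w x"] by (simp add: sqdist_def diff_in)
  ultimately show ?thesis by simp
qed

lemma tendsto_ip:
  assumes "\<And>i. s i \<in> H" "v \<in> H" "w \<in> H" "tends_to s v"
  shows "(\<lambda>i::nat. ip (s i) w) \<longlonglongrightarrow> ip v w"
proof -
  have "(\<lambda>i. sqrt (sqdist (s i) v) * sqrt (sqn w)) \<longlonglongrightarrow> sqrt 0 * sqrt (sqn w)"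
    using assms(4) by (intro tendsto_intros)
  then have lim: "(\<lambda>i. sqrt (sqdist (s i) v) * sqrt (sqn w)) \<longlonglongrightarrow> 0" by simp
  have "\<bar>ip (s i) w - ip v w\<bar> \<le> sqrt (sqdist (s i) v) * sqrt (sqn w)" for i
    using abs_ip_le[of "\<lambda>x. s i x - v x" w] assms by (simp add: ip_diff_left diff_in sqdist_def)
  then have "(\<lambda>i. ip (s i) w - ip v w) \<longlonglongrightarrow> 0"
    by (intro Lim_null_comparison[OF _ lim]) simp
  then show ?thesis by (simp add: LIM_zero_iff)
qed

lemma tendsto_sqn:
  assumes "\<And>i. s i \<in> H" "v \<in> H" "tends_to s v"
  shows "(\<lambda>i::nat. sqn (s i)) \<longlonglongrightarrow> sqn v"
proof -
  have "sqn (s i) = sqdist (s i) v + 2 * ip (s i) v - sqn v" for i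
    using assms by (simp add: sqdist_eq)
  moreover have "(\<lambda>i. sqdist (s i) v + 2 * ip (s i) v - sqn v) \<longlonglongrightarrow> 0 + 2 * ip v v - sqn v"
    using assms by (intro tendsto_intros tendsto_ip)
  ultimately show ?thesis by (simp add: sqn_def)
qed

lemma limit_exists:
  assumes "\<And>i. s i \<in> H" "\<And>\<epsilon>. \<epsilon> > 0 \<Longrightarrow> \<exists>i0::nat. \<forall>i\<ge>i0. \<forall>j\<ge>i0. sqdist (s i) (s j) < \<epsilon>"
  obtains v where "v \<in> H" "tends_to s v"
proof -
  have "\<exists>i0::nat. \<forall>i\<ge>i0. \<forall>j\<ge>i0. sqrt (ip (\<lambda>x. s i x - s j x) (\<lambda>x. s i x - s j x)) < \<epsilon>"
    if e: "\<epsilon> > 0" for \<epsilon>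
  proof -
    obtain i0 where "\<forall>i\<ge>i0. \<forall>j\<ge>i0. sqdist (s i) (s j) < \<epsilon>\<^sup>2"
      using assms(2)[of "\<epsilon>\<^sup>2"] zero_less_power[OF e, of 2] by blast
    then have "\<forall>i\<ge>i0. \<forall>j\<ge>i0. sqrt (ip (\<lambda>x. s i x - s j x) (\<lambda>x. s i x - s j x)) < \<epsilon>"
      using e by (simp add: sqdist_def sqn_def real_less_lsqrt)
    then show ?thesis by blast
  qed
  then obtain v where v: "v \<in> H" "(\<lambda>i. sqrt (ip (\<lambda>x. s i x - v x) (\<lambda>x. s i x - v x))) \<longlonglongrightarrow> 0"
    using complete[of s, OF assms(1)] by blast
  have "(\<lambda>i. (sqrt (sqdist (s i) v))\<^sup>2) \<longlonglongrightarrow> 0\<^sup>2"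
    using v(2) by (intro tendsto_intros) (simp add: sqdist_def sqn_def)
  then show ?thesis using that v assms(1) by (simp add: sqdist_nonneg)
qed

lemma Cauchy_sqdist:
  assumes "\<And>i. s i \<in> H" "v \<in> H" "tends_to s v" "\<epsilon> > 0"
  shows "\<exists>i0::nat. \<forall>i\<ge>i0. \<forall>j\<ge>i0. sqdist (s i) (s j) < \<epsilon>"
proof -
  have "\<forall>\<^sub>F i in sequentially. sqdist (s i) v < \<epsilon> / 4"
    using assms(3,4) by (intro order_tendstoD) auto
  then obtain i0 where i0: "\<forall>i\<ge>i0. sqdist (s i) v < \<epsilon> / 4"
    by (auto simp: eventually_sequentially)
  have "sqdist (s i) (s j) < \<epsilon>" if "i \<ge> i0" "j \<ge> i0" for i j
    using i0[rule_format, OF that(1)] i0[rule_format, OF that(2)]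
      sqdist_tri[of "s i" v "s j"] assms(1)[of i] assms(1)[of j] assms(2) sqdist_sym[of v "s j"]
    by linarith
  then show ?thesis by blast
qed

text \<open>By the parallelogram law, almost minimal elements of convex sets form a Cauchy sequence.\<close>

lemma almost_minimal_convergent:
  assumes C: "\<And>m. C m \<subseteq> H" "decseq C"
    and mid: "\<And>m v w. v \<in> C m \<Longrightarrow> w \<in> C m \<Longrightarrow> (\<lambda>x. (1/2) * v x + (1/2) * w x) \<in> C m"
    and d: "\<And>m v. v \<in> C m \<Longrightarrow> d m \<le> sqn v" "d \<longlonglongrightarrow> e"
    and w: "\<And>m::nat. w m \<in> C m" "(\<lambda>m. sqn (w m)) \<longlonglongrightarrow> e"
  obtains u where "u \<in> H" "tends_to w u" "sqn u = e"
proof -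
  have wH: "w m \<in> H" for m using w(1) C(1) by blast
  have "\<exists>i0. \<forall>i\<ge>i0. \<forall>j\<ge>i0. sqdist (w i) (w j) < \<epsilon>" if "\<epsilon> > 0" for \<epsilon>
  proof -
    have "\<forall>\<^sub>F m in sequentially. sqn (w m) < e + \<epsilon> / 8"
      using w(2) that by (intro order_tendstoD) auto
    moreover have "\<forall>\<^sub>F m in sequentially. d m > e - \<epsilon> / 8"
      using d(2) that by (intro order_tendstoD) auto
    ultimately have "\<forall>\<^sub>F m in sequentially. sqn (w m) < e + \<epsilon> / 8 \<and> d m > e - \<epsilon> / 8"
      by eventually_elim auto
    then obtain i0 where i0: "\<And>m. m \<ge> i0 \<Longrightarrow> sqn (w m) < e + \<epsilon> / 8 \<and> d m > e - \<epsilon> / 8"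
      by (auto simp: eventually_sequentially)
    have "sqdist (w i) (w j) < \<epsilon>" if ij: "i \<ge> i0" "j \<ge> i0" for i j
    proof -
      have "w i \<in> C i0" "w j \<in> C i0" using w(1) ij C(2) by (auto simp: decseq_def)
      from d(1)[OF mid[OF this]] i0[of i] i0[of j] i0[of i0] ij sqdist_midpoint[OF wH wH, of i j]
      show ?thesis by simp
    qed
    then show ?thesis by blast
  qed
  then obtain u where u: "u \<in> H" "tends_to w u"
    using limit_exists[of w] wH by blast
  moreover have "sqn u = e"
    using tendsto_sqn[OF wH u] w(2) LIMSEQ_unique by blast
  ultimately show ?thesis using that by blast
qed

text \<open>Plays the role of the projection theorem. \<open>C\<close> is not assumed closed, so the
  minimal element \<open>u\<close> comes as a norm limit of members of \<open>C\<close>, and each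
  application draws what it needs from the approximating sequence \<open>w\<close>.\<close>

lemma minimal_sequence:
  assumes C: "C \<subseteq> H" "C \<noteq> {}"
    and mid: "\<And>v w. v \<in> C \<Longrightarrow> w \<in> C \<Longrightarrow> (\<lambda>x. (1/2) * v x + (1/2) * w x) \<in> C"
  obtains w u where "\<And>m::nat. w m \<in> C" "u \<in> H" "tends_to w u" "\<And>v. v \<in> C \<Longrightarrow> sqn u \<le> sqn v"
proof -
  define e where "e = Inf (sqn ` C)"
  have bdd: "bdd_below (sqn ` C)" using C(1) sqn_nonneg by (intro bdd_belowI2[of _ 0]) blast
  have le: "e \<le> sqn v" if "v \<in> C" for v
    unfolding e_def using bdd that by (intro cInf_lower) auto
  have "\<exists>v\<in>C. sqn v < e + 1 / real (Suc m)" for m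
    using cInf_lessD[of "sqn ` C" "e + 1 / real (Suc m)"] C(2) by (auto simp: e_def)
  then obtain w where w: "\<And>m. w m \<in> C" "\<And>m. sqn (w m) < e + 1 / real (Suc m)" by metis
  have "(\<lambda>m. sqn (w m)) \<longlonglongrightarrow> e"
  proof (rule tendsto_sandwich[OF _ _ tendsto_const])
    show "(\<lambda>m. e + 1 / real (Suc m)) \<longlonglongrightarrow> e"
      using tendsto_add[OF tendsto_const[of e] LIMSEQ_inverse_real_of_nat] by (simp add: inverse_eq_divide)
  qed (use w le in \<open>auto intro!: less_imp_le always_eventually\<close>)
  then obtain u where "u \<in> H" "tends_to w u" "sqn u = e"
    using almost_minimal_convergent[of "\<lambda>_. C" "\<lambda>_. e" e w] C(1) mid le w(1) by (auto simp: decseq_def)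
  then show ?thesis using that w(1) le by metis
qed

lemma orthogonal_of_minimal:
  assumes "u \<in> H" "z \<in> H" "\<And>t. sqn u \<le> sqn (\<lambda>x. u x + t * z x)"
  shows "ip u z = 0"
proof -
  have q: "0 \<le> 2 * t * ip u z + t\<^sup>2 * sqn z" for t
    using assms(3)[of t] assms(1,2) by (simp add: sqn_add sqn_scale scale_in ip_scale_right)
  show ?thesis
  proof (cases "sqn z \<le> 0")
    case True
    then show ?thesis using assms(1,2) sqn_zero_iff[of z] ip_zero_left[of u] ip_sym[of u z] by simp
  next
    case False
    \<comment> \<open>This \<open>t\<close> minimises the quadratic in \<open>q\<close>, whose
      minimum is \<open>- (ip u z)\<^sup>2 / sqn z\<close>.\<close>
    have "0 \<le> 2 * (- ip u z / sqn z) * ip u z + (- ip u z / sqn z)\<^sup>2 * sqn z" by (rule q)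
    also have "\<dots> = - (ip u z)\<^sup>2 / sqn z"
      using False by (simp add: field_simps power2_eq_square)
    finally have "(ip u z)\<^sup>2 \<le> 0" using False by (simp add: field_simps)
    then show ?thesis by simp
  qed
qed

end

section \<open>Density of kernel sections and uniqueness of the reproducing kernel Hilbert
  space\<close>

lemma hilbert_functions_of_rkhs: "is_rkhs D k H ip \<Longrightarrow> hilbert_functions D H ip"
  by (simp add: is_rkhs_def hilbert_functions_def)

text \<open>Finite linear combinations of kernel sections, built one term at a time so that
  statements about them go by rule induction instead of by sums over index sets.\<close>

inductive_set kernel_span :: "'a set \<Rightarrow> ('a \<Rightarrow> 'a \<Rightarrow> real) \<Rightarrow> ('a \<Rightarrow> real) set" for D k where
  zero: "(\<lambda>x. 0) \<in> kernel_span D k"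
| add: "v \<in> kernel_span D k \<Longrightarrow> y \<in> D \<Longrightarrow> (\<lambda>x. v x + c * restr D (\<lambda>x. k x y) x) \<in> kernel_span D k"

lemma kernel_span_add:
  assumes "w \<in> kernel_span D k" "v \<in> kernel_span D k"
  shows "(\<lambda>x. v x + w x) \<in> kernel_span D k"
  using assms(1)
proof induction
  case zero
  then show ?case using assms(2) by simp
next
  case (add w y c)
  then show ?case using kernel_span.add[OF add.IH add.hyps(2), of c] by (simp add: algebra_simps)
qed

lemma kernel_span_scale:
  assumes "w \<in> kernel_span D k"
  shows "(\<lambda>x. a * w x) \<in> kernel_span D k"
  using assms
proof induction
  case zero
  then show ?case using kernel_span.zero by simp
next
  case (add w y c)
  then show ?case using kernel_span.add[OF add.IH add.hyps(2), of "a * c"] by (simp add: algebra_simps)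
qed

locale rkhs_functions =
  fixes D :: "'a set" and k :: "'a \<Rightarrow> 'a \<Rightarrow> real" and H ip
  assumes rkhs: "is_rkhs D k H ip"

sublocale rkhs_functions \<subseteq> hilbert_functions
  by (rule hilbert_functions_of_rkhs[OF rkhs])

context rkhs_functions
begin

lemma section_in: "y \<in> D \<Longrightarrow> restr D (\<lambda>x. k x y) \<in> H"
  and reproducing: "y \<in> D \<Longrightarrow> v \<in> H \<Longrightarrow> ip v (restr D (\<lambda>x. k x y)) = v y"
  using rkhs by (auto simp: is_rkhs_def)

lemma ip_sections: "x \<in> D \<Longrightarrow> y \<in> D \<Longrightarrow> ip (restr D (\<lambda>z. k z x)) (restr D (\<lambda>z. k z y)) = k y x"
  using reproducing section_in by (simp add: restr_def)

lemma abs_eval_le: "v \<in> H \<Longrightarrow> y \<in> D \<Longrightarrow> \<bar>v y\<bar> \<le> sqrt (sqn v) * sqrt (k y y)"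
  using abs_ip_le[of v "restr D (\<lambda>x. k x y)"] section_in reproducing ip_sections[of y y] by (simp add: sqn_def)

lemma tendsto_eval:
  assumes "\<And>i. s i \<in> H" "v \<in> H" "tends_to s v"
  shows "(\<lambda>i::nat. s i x) \<longlonglongrightarrow> v x"
proof (cases "x \<in> D")
  case True
  then show ?thesis using tendsto_ip[OF assms(1,2) section_in[OF True] assms(3)] reproducing[OF True] assms(1,2) by simp
next
  case False
  then show ?thesis using outside[OF assms(1)] outside[OF assms(2)] by simp
qed

lemma kernel_span_in: "v \<in> kernel_span D k \<Longrightarrow> v \<in> H"
  by (induction rule: kernel_span.induct) (intro zero_in add_in scale_in section_in)+

text \<open>The residual of smallest norm, over all approximations of \<open>v\<close> from the
  span, is orthogonal to every kernel section. By the reproducing property it vanishes at every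
  point, hence it is the zero function.\<close>

lemma kernel_span_dense:
  assumes v: "v \<in> H"
  obtains s where "\<And>i::nat. s i \<in> kernel_span D k" "tends_to s v"
proof -
  define C where "C = {w. \<exists>s\<in>kernel_span D k. w = (\<lambda>x. v x - s x)}"
  have CH: "C \<subseteq> H" using v kernel_span_in diff_in by (auto simp: C_def)
  have ne: "C \<noteq> {}" using kernel_span.zero by (auto simp: C_def)
  have mid: "(\<lambda>x. (1/2) * a x + (1/2) * b x) \<in> C" if ab: "a \<in> C" "b \<in> C" for a b
  proof -
    obtain s t where st: "s \<in> kernel_span D k" "t \<in> kernel_span D k" "a = (\<lambda>x. v x - s x)" "b = (\<lambda>x. v x - t x)"
      using ab unfolding C_def by blast
    have "(\<lambda>x. (1/2) * s x + (1/2) * t x) \<in> kernel_span D k"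
      by (intro kernel_span_add kernel_span_scale st)
    moreover have "(\<lambda>x. (1/2) * a x + (1/2) * b x) = (\<lambda>x. v x - ((1/2) * s x + (1/2) * t x))"
      using st by (auto simp: field_simps)
    ultimately show ?thesis unfolding C_def mem_Collect_eq by (intro bexI[of _ "\<lambda>x. (1/2) * s x + (1/2) * t x"])
  qed
  obtain w u where w: "\<And>m::nat. w m \<in> C" and u: "u \<in> H" "tends_to w u" "\<And>v. v \<in> C \<Longrightarrow> sqn u \<le> sqn v"
    using minimal_sequence[OF CH ne mid] by blast
  have "\<forall>m. \<exists>s. s \<in> kernel_span D k \<and> w m = (\<lambda>x. v x - s x)"
    using w unfolding C_def by blast
  then obtain s where s: "\<And>m. s m \<in> kernel_span D k" "\<And>m. w m = (\<lambda>x. v x - s m x)" by metis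
  have wH: "w m \<in> H" for m using w CH by blast
  have "u y = 0" if y: "y \<in> D" for y
  proof -
    let ?k = "restr D (\<lambda>x. k x y)"
    have "sqn u \<le> sqn (\<lambda>x. u x + t * ?k x)" for t
    proof -
      \<comment> \<open>The limit residual \<open>u\<close> may lie outside \<open>C\<close>, so the
        variation by a kernel section is made at the members \<open>w m\<close> and then passed to
        the limit.\<close>
      have in_C: "(\<lambda>x. w m x + t * ?k x) \<in> C" for m
        using kernel_span.add[OF s(1)[of m] y, of "-t"] unfolding C_def s(2)
        by (auto intro!: bexI[of _ "\<lambda>x. s m x - t * ?k x"] simp: algebra_simps)
      have le: "sqn u \<le> sqn (\<lambda>x. w m x + t * ?k x)" for m
        by (rule u(3)[OF in_C])
      have "sqdist (\<lambda>x. w m x + t * ?k x) (\<lambda>x. u x + t * ?k x) = sqdist (w m) u" for m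
        by (simp add: sqdist_def)
      then have "(\<lambda>m. sqn (\<lambda>x. w m x + t * ?k x)) \<longlonglongrightarrow> sqn (\<lambda>x. u x + t * ?k x)"
        using u wH y by (intro tendsto_sqn) (auto intro!: add_in scale_in section_in)
      then show ?thesis using le by (intro LIMSEQ_le_const) auto
    qed
    then show ?thesis
      using orthogonal_of_minimal[OF u(1) section_in[OF y]] reproducing[OF y u(1)] by simp
  qed
  then have "u = (\<lambda>x. 0)" using outside[OF u(1)] by auto
  moreover have "sqdist (w m) (\<lambda>x. 0) = sqdist (s m) v" for m
    using sqdist_sym[of v "s m"] v s(1) kernel_span_in by (simp add: s(2) sqdist_def)
  ultimately show ?thesis using that s(1) u(2) by auto
qed

lemma ip_kernel_span_eq:
  assumes "rkhs_functions D k H' ip'" "w \<in> kernel_span D k" "v \<in> H" "v \<in> H'"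
  shows "ip v w = ip' v w"
proof -
  interpret o: rkhs_functions D k H' ip' by fact
  show ?thesis using assms(2)
  proof induction
    case zero
    then show ?case using assms ip_zero_left[of v] o.ip_zero_left[of v] ip_sym[of _ v] o.ip_sym[of _ v]
        zero_in o.zero_in by metis
  next
    case (add w y c)
    then show ?case using assms(3,4) section_in[of y] o.section_in[of y] kernel_span_in o.kernel_span_in
      by (simp add: ip_add_right ip_scale_right o.ip_add_right o.ip_scale_right scale_in o.scale_in
          reproducing o.reproducing)
  qed
qed

text \<open>Both inner products are fixed on the kernel span by the reproducing property. A sequence
  from the span that approximates \<open>v\<close> in one space is therefore Cauchy in the other,
  and since evaluation is continuous in both, the two limits are the same function. Exchanging the
  roles of the spaces gives the converse inclusion.\<close>

lemma rkhs_unique: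
  assumes "rkhs_functions D k H' ip'" "v \<in> H"
  shows "v \<in> H' \<and> ip' v v = ip v v"
proof -
  interpret o: rkhs_functions D k H' ip' by fact
  obtain s where s: "\<And>i::nat. s i \<in> kernel_span D k" "tends_to s v"
    using kernel_span_dense[OF assms(2)] by blast
  have sH: "s i \<in> H" and sH': "s i \<in> H'" for i
    using s(1) kernel_span_in o.kernel_span_in by auto
  have eq: "o.sqn w = sqn w" if "w \<in> kernel_span D k" for w
    using ip_kernel_span_eq[OF assms(1) that] that kernel_span_in o.kernel_span_in
    by (simp add: sqn_def o.sqn_def)
  have "(\<lambda>x. s i x - s j x) \<in> kernel_span D k" for i j
    using kernel_span_add[OF kernel_span_scale[OF s(1)[of j], of "-1"] s(1)[of i]] by simp
  then have "o.sqdist (s i) (s j) = sqdist (s i) (s j)" for i j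
    by (simp add: sqdist_def o.sqdist_def eq)
  then obtain v' where v': "v' \<in> H'" "o.tends_to s v'"
    using o.limit_exists[of s] Cauchy_sqdist[OF sH assms(2) s(2)] sH' by metis
  have "v x = v' x" for x
    using tendsto_eval[OF sH assms(2) s(2)] o.tendsto_eval[OF sH' v'] LIMSEQ_unique by blast
  then have "v = v'" by auto
  moreover have "o.sqn v' = sqn v"
    using o.tendsto_sqn[OF sH' v'] tendsto_sqn[OF sH assms(2) s(2)] eq[OF s(1)] LIMSEQ_unique by auto
  ultimately show ?thesis using v'(1) by (simp add: sqn_def o.sqn_def)
qed

lemma rkhs_eq: "rkhs D k = H"
  using rkhs rkhs_unique rkhs_functions.rkhs_unique[OF _ rkhs_functions_axioms]
  unfolding rkhs_def rkhs_functions_def by blast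

lemma rkhs_norm_eq:
  assumes "v \<in> H"
  shows "rkhs_norm D k v = sqrt (sqn v)"
  unfolding rkhs_norm_def
proof (rule the_equality)
  show "\<exists>H ip. is_rkhs D k H ip \<and> v \<in> H \<and> sqrt (sqn v) = sqrt (ip v v)"
    using rkhs assms by (auto simp: sqn_def)
next
  fix r assume "\<exists>H ip. is_rkhs D k H ip \<and> v \<in> H \<and> r = sqrt (ip v v)"
  then show "r = sqrt (sqn v)"
    using rkhs_unique[OF _ assms] by (auto simp: rkhs_functions_def sqn_def)
qed


text \<open>Restriction to \<open>D'\<close> is an isometry from these functions onto the reproducing kernel Hilbert space
  on \<open>D'\<close>.\<close>

definition determined_by :: "'a set \<Rightarrow> ('a \<Rightarrow> real) set" where
  "determined_by D' = {u \<in> H. \<forall>z\<in>H. (\<forall>x\<in>D'. z x = 0) \<longrightarrow> ip u z = 0}"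

definition extension :: "'a set \<Rightarrow> ('a \<Rightarrow> real) \<Rightarrow> 'a \<Rightarrow> real" where
  "extension D' a = (SOME u. u \<in> determined_by D' \<and> restr D' u = a)"

lemma determined_by_in: "u \<in> determined_by D' \<Longrightarrow> u \<in> H"
  by (simp add: determined_by_def)

lemma determined_by_add: "u \<in> determined_by D' \<Longrightarrow> v \<in> determined_by D' \<Longrightarrow> (\<lambda>x. u x + v x) \<in> determined_by D'"
  by (simp add: determined_by_def add_in ip_add_left)

lemma determined_by_scale: "u \<in> determined_by D' \<Longrightarrow> (\<lambda>x. c * u x) \<in> determined_by D'"
  by (simp add: determined_by_def scale_in ip_scale_left)

lemma determined_by_diff: "u \<in> determined_by D' \<Longrightarrow> v \<in> determined_by D' \<Longrightarrow> (\<lambda>x. u x - v x) \<in> determined_by D'"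
  by (simp add: determined_by_def diff_in ip_diff_left)

lemma determined_by_eqI:
  assumes "u \<in> determined_by D'" "v \<in> determined_by D'" "restr D' u = restr D' v"
  shows "u = v"
proof -
  let ?z = "\<lambda>x. u x - v x"
  have z: "?z \<in> determined_by D'" using assms determined_by_diff by blast
  have "?z x = 0" if "x \<in> D'" for x
    using fun_cong[OF assms(3), of x] that by (simp add: restr_def)
  then have "sqn ?z = 0" using z by (simp add: determined_by_def sqn_def)
  then have "?z = (\<lambda>x. 0)" using sqn_zero_iff[OF determined_by_in[OF z]] by simp
  then show ?thesis by (auto simp: fun_eq_iff)
qed

text \<open>Among all functions with the same restriction to \<open>D'\<close>, the one of least
  norm cannot be improved by adding a multiple of a function vanishing on \<open>D'\<close>; the
  first variation is exactly the orthogonality in \<open>determined_by\<close>.\<close>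

lemma minimal_extension:
  assumes v: "v \<in> H"
  obtains u where "u \<in> determined_by D'" "restr D' u = restr D' v" "sqn u \<le> sqn v"
proof -
  define C where "C = {w \<in> H. restr D' w = restr D' v}"
  have restr_iff: "restr D' w = restr D' w' \<longleftrightarrow> (\<forall>x\<in>D'. w x = w' x)" for w w' :: "'a \<Rightarrow> real"
    by (auto simp: restr_def fun_eq_iff)
  have CH: "C \<subseteq> H" and vC: "v \<in> C" using v by (auto simp: C_def)
  then have ne: "C \<noteq> {}" by blast
  have mid: "(\<lambda>x. (1/2) * a x + (1/2) * b x) \<in> C" if "a \<in> C" "b \<in> C" for a b
    using that unfolding C_def restr_iff by (auto intro!: add_in scale_in[of _ "1/2", simplified])
  obtain w u where w: "\<And>m::nat. w m \<in> C" and u: "u \<in> H" "tends_to w u" "\<And>v. v \<in> C \<Longrightarrow> sqn u \<le> sqn v"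
    using minimal_sequence[OF CH ne mid] by blast
  have wH: "w m \<in> H" for m using w CH by blast
  have "u x = v x" if "x \<in> D'" for x
  proof -
    have "w m x = v x" for m using w[of m] that unfolding C_def restr_iff by simp
    then show ?thesis using tendsto_eval[OF wH u(1,2), of x] by (simp add: LIMSEQ_const_iff)
  qed
  then have uC: "u \<in> C" using u(1) unfolding C_def restr_iff by simp
  have "ip u z = 0" if z: "z \<in> H" "\<forall>x\<in>D'. z x = 0" for z
  proof (rule orthogonal_of_minimal[OF u(1) z(1)])
    fix t
    have "(\<lambda>x. u x + t * z x) \<in> C"
      using uC z add_in[OF u(1) scale_in[OF z(1), of t]] unfolding C_def restr_iff by simp
    then show "sqn u \<le> sqn (\<lambda>x. u x + t * z x)" by (rule u(3))
  qed
  then have "u \<in> determined_by D'" using u(1) by (simp add: determined_by_def)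
  then show ?thesis using that uC u(3)[OF vC] by (simp add: C_def)
qed

lemma extension_eq: "u \<in> determined_by D' \<Longrightarrow> extension D' (restr D' u) = u"
  unfolding extension_def by (rule some_equality) (auto intro: determined_by_eqI)

text \<open>A kernel section at \<open>y\<close> in \<open>D'\<close> pairs with any
  \<open>z\<close> vanishing on \<open>D'\<close> to \<open>z y = 0\<close>, so it lies in
  \<open>determined_by D'\<close>, and the reproducing property is inherited. Completeness is
  inherited because orthogonality survives norm limits.\<close>

lemma is_rkhs_restriction:
  assumes "D' \<subseteq> D"
  shows "is_rkhs D' k (restr D' ` determined_by D') (\<lambda>a b. ip (extension D' a) (extension D' b))"
proof -
  let ?N = "determined_by D'" and ?r = "restr D'" and ?e = "extension D'"
  note [simp] = extension_eq
  have r_add: "(\<lambda>x. ?r u x + ?r v x) = ?r (\<lambda>x. u x + v x)"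
    and r_scale: "(\<lambda>x. c * ?r u x) = ?r (\<lambda>x. c * u x)"
    and r_diff: "(\<lambda>x. ?r u x - ?r v x) = ?r (\<lambda>x. u x - v x)" for u v :: "'a \<Rightarrow> real" and c
    by (auto simp: restr_def)
  have zero: "(\<lambda>x. 0) \<in> ?N" using zero_in ip_zero_left by (simp add: determined_by_def)
  have r_zero: "?r (\<lambda>x. 0) = (\<lambda>x. 0)" by (auto simp: restr_def)
  have sec: "restr D (\<lambda>x. k x y) \<in> ?N \<and> ?r (\<lambda>x. k x y) = ?r (restr D (\<lambda>x. k x y))" if "y \<in> D'" for y
  proof -
    have "y \<in> D" using that assms by blast
    then show ?thesis
      using that assms section_in reproducing ip_sym[OF section_in]
      by (auto simp: determined_by_def restr_def fun_eq_iff)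
  qed
  have complete': "\<exists>v\<in>?r ` ?N. (\<lambda>i. sqrt (ip (?e (\<lambda>x. s i x - v x)) (?e (\<lambda>x. s i x - v x)))) \<longlonglongrightarrow> 0"
    if s: "\<forall>i. s i \<in> ?r ` ?N"
      and C: "\<forall>\<epsilon>>0. \<exists>i0. \<forall>i\<ge>i0. \<forall>j\<ge>i0. sqrt (ip (?e (\<lambda>x. s i x - s j x)) (?e (\<lambda>x. s i x - s j x))) < \<epsilon>"
    for s :: "nat \<Rightarrow> 'a \<Rightarrow> real"
  proof -
    obtain t where t: "\<And>i. t i \<in> ?N" "\<And>i. s i = ?r (t i)" using s unfolding image_def by simp metis
    have tH: "t i \<in> H" for i using t(1) determined_by_in by blast
    have "ip (?e (\<lambda>x. s i x - s j x)) (?e (\<lambda>x. s i x - s j x)) = ip (\<lambda>x. t i x - t j x) (\<lambda>x. t i x - t j x)" for i j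
      using t(1) by (simp add: t(2) r_diff determined_by_diff)
    then have "\<forall>\<epsilon>>0. \<exists>i0. \<forall>i\<ge>i0. \<forall>j\<ge>i0. sqrt (ip (\<lambda>x. t i x - t j x) (\<lambda>x. t i x - t j x)) < \<epsilon>"
      using C by simp
    then obtain v where v: "v \<in> H" "(\<lambda>i. sqrt (ip (\<lambda>x. t i x - v x) (\<lambda>x. t i x - v x))) \<longlonglongrightarrow> 0"
      using complete[of t, OF tH] by blast
    have "(\<lambda>i. (sqrt (sqdist (t i) v))\<^sup>2) \<longlonglongrightarrow> 0\<^sup>2"
      using v(2) by (intro tendsto_intros) (simp add: sqdist_def sqn_def)
    then have lim: "tends_to t v" using tH v(1) by (simp add: sqdist_nonneg)
    have "ip v z = 0" if z: "z \<in> H" "\<forall>x\<in>D'. z x = 0" for z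
    proof -
      have "ip (t i) z = 0" for i using t(1)[of i] z by (simp add: determined_by_def)
      then show ?thesis using tendsto_ip[of t, OF tH v(1) z(1) lim] by (simp add: LIMSEQ_const_iff)
    qed
    then have vN: "v \<in> ?N" using v(1) by (simp add: determined_by_def)
    have "ip (?e (\<lambda>x. s i x - ?r v x)) (?e (\<lambda>x. s i x - ?r v x)) = ip (\<lambda>x. t i x - v x) (\<lambda>x. t i x - v x)" for i
      using t(1) vN by (simp add: t(2) r_diff determined_by_diff)
    then show ?thesis using v(2) vN by (intro bexI[of _ "?r v"]) auto
  qed
  have "hilbert_function_space D' (?r ` ?N) (\<lambda>a b. ip (?e a) (?e b))"
    unfolding hilbert_function_space_def Let_def
  proof (intro conjI)
    show "(\<lambda>x. 0) \<in> ?r ` ?N" using zero r_zero by (metis image_eqI)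
    show "\<forall>v\<in>?r ` ?N. v \<noteq> (\<lambda>x. 0) \<longrightarrow> 0 < ip (?e v) (?e v)"
    proof (intro ballI impI)
      fix v assume "v \<in> ?r ` ?N" "v \<noteq> (\<lambda>x. 0)"
      then obtain u where "u \<in> ?N" "v = ?r u" "u \<noteq> (\<lambda>x. 0)" using r_zero by auto
      then show "0 < ip (?e v) (?e v)" using ip_pos determined_by_in by simp
    qed
  next
    show "\<forall>s. (\<forall>i::nat. s i \<in> ?r ` ?N) \<and>
        (\<forall>\<epsilon>>0. \<exists>i0. \<forall>i\<ge>i0. \<forall>j\<ge>i0. sqrt (ip (?e (\<lambda>x. s i x - s j x)) (?e (\<lambda>x. s i x - s j x))) < \<epsilon>) \<longrightarrow>
        (\<exists>v\<in>?r ` ?N. (\<lambda>i. sqrt (ip (?e (\<lambda>x. s i x - v x)) (?e (\<lambda>x. s i x - v x)))) \<longlonglongrightarrow> 0)"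
      using complete' by blast
  qed (auto simp: r_add r_scale determined_by_add determined_by_scale ip_add_left ip_scale_left
      determined_by_in ip_sym intro!: imageI, auto simp: restr_def)
  moreover have "\<forall>y\<in>D'. ?r (\<lambda>x. k x y) \<in> ?r ` ?N \<and> (\<forall>v\<in>?r ` ?N. ip (?e v) (?e (?r (\<lambda>x. k x y))) = v y)"
  proof (intro ballI conjI)
    fix y assume y: "y \<in> D'"
    show "?r (\<lambda>x. k x y) \<in> ?r ` ?N" using sec[OF y] by blast
    fix v assume "v \<in> ?r ` ?N"
    then obtain u where u: "u \<in> ?N" "v = ?r u" by blast
    then have "ip (?e v) (?e (?r (\<lambda>x. k x y))) = u y"
      using sec[OF y] reproducing[of y u] y assms determined_by_in by auto
    then show "ip (?e v) (?e (?r (\<lambda>x. k x y))) = v y" using u y by (simp add: restr_def)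
  qed
  ultimately show ?thesis by (simp add: is_rkhs_def)
qed

text \<open>The norm of a restriction is the norm of its minimal extension, which \<open>v\<close>
  itself can only exceed. This carries norm convergence on the whole domain over to the
  subdomain.\<close>

lemma restriction_contraction:
  assumes "D' \<subseteq> D" "v \<in> H"
  shows "restr D' v \<in> rkhs D' k" "0 \<le> rkhs_norm D' k (restr D' v)" "rkhs_norm D' k (restr D' v) \<le> sqrt (sqn v)"
proof -
  interpret r: rkhs_functions D' k "restr D' ` determined_by D'" "\<lambda>a b. ip (extension D' a) (extension D' b)"
    by unfold_locales (rule is_rkhs_restriction[OF assms(1)])
  obtain u where u: "u \<in> determined_by D'" "restr D' u = restr D' v" "sqn u \<le> sqn v"
    using minimal_extension[OF assms(2)] by blast
  have mem: "restr D' v \<in> restr D' ` determined_by D'" using u by (metis imageI)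
  then show "restr D' v \<in> rkhs D' k" by (simp add: r.rkhs_eq)
  have "r.sqn (restr D' v) = sqn u"
    by (simp add: r.sqn_def sqn_def extension_eq u(1) flip: u(2))
  then show "0 \<le> rkhs_norm D' k (restr D' v)" "rkhs_norm D' k (restr D' v) \<le> sqrt (sqn v)"
    using r.rkhs_norm_eq[OF mem] u(3) sqn_nonneg[OF determined_by_in[OF u(1)]] by auto
qed

end

section \<open>Differentiability of functions in the reproducing kernel Hilbert space\<close>

lemma gradient_eqI:
  assumes "GDERIV v x :> D"
  shows "gradient v x = D"
  unfolding gradient_def
proof (rule the_equality[where P = "\<lambda>D. GDERIV v x :> D", OF assms])
  fix D' assume "GDERIV v x :> D'"
  then have "(\<lambda>h. h \<bullet> D') = (\<lambda>h. h \<bullet> D)"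
    using assms has_derivative_unique unfolding gderiv_def by blast
  then have "(D' - D) \<bullet> (D' - D) = 0" by (metis inner_diff_right right_minus_eq)
  then show "D' = D" by simp
qed

lemma GDERIV_continuous_on: "(\<And>x. x \<in> S \<Longrightarrow> GDERIV v x :> D x) \<Longrightarrow> continuous_on S v"
  unfolding gderiv_def by (meson continuous_at_imp_continuous_on has_derivative_continuous)

lemma has_derivative_imp_GDERIV:
  fixes v :: "'a::euclidean_space \<Rightarrow> real"
  assumes "(v has_derivative F) (at x)"
  shows "GDERIV v x :> (\<Sum>b\<in>Basis. F b *\<^sub>R b)"
proof -
  have "F = (\<lambda>h. h \<bullet> (\<Sum>b\<in>Basis. F b *\<^sub>R b))"
  proof
    fix h
    interpret F: bounded_linear F using assms by (rule has_derivative_bounded_linear)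
    have "F h = F (\<Sum>b\<in>Basis. (h \<bullet> b) *\<^sub>R b)" by (simp add: euclidean_representation)
    then show "F h = h \<bullet> (\<Sum>b\<in>Basis. F b *\<^sub>R b)"
      by (simp add: F.sum F.scaleR inner_sum_right mult.commute)
  qed
  then show ?thesis using assms by (simp add: gderiv_def)
qed

lemma C1_on_gradient:
  fixes v :: "'a::euclidean_space \<Rightarrow> real"
  assumes "C1_on S v"
  shows "x \<in> S \<Longrightarrow> GDERIV v x :> gradient v x" "continuous_on S (gradient v)"
proof -
  obtain F where F: "\<And>x. x \<in> S \<Longrightarrow> (v has_derivative blinfun_apply (F x)) (at x)" "continuous_on S F"
    using assms unfolding C1_on_def by blast
  have G: "GDERIV v x :> (\<Sum>b\<in>Basis. F x b *\<^sub>R b)" if "x \<in> S" for x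
    using has_derivative_imp_GDERIV F(1) that by blast
  then show "x \<in> S \<Longrightarrow> GDERIV v x :> gradient v x" using gradient_eqI by metis
  have "continuous_on S (\<lambda>x. \<Sum>b\<in>Basis. F x b *\<^sub>R b)"
    using F(2) by (intro continuous_intros)
  then show "continuous_on S (gradient v)"
    using continuous_on_cong[of S S "gradient v" "\<lambda>x. \<Sum>b\<in>Basis. F x b *\<^sub>R b"] gradient_eqI[OF G] by simp
qed

text \<open>Along the direction \<open>D\<close> itself the derivative is
  \<open>D \<bullet> D\<close>, while the difference quotients are at most
  \<open>L * norm D\<close>; dividing by \<open>norm D\<close> gives the bound.\<close>

lemma norm_gradient_le:
  fixes v :: "'a::euclidean_space \<Rightarrow> real"
  assumes "GDERIV v x :> D" "0 < \<delta>" "0 \<le> L" "\<And>y. y \<in> ball x \<delta> \<Longrightarrow> \<bar>v y - v x\<bar> \<le> L * norm (y - x)"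
  shows "norm D \<le> L"
proof (cases "D = 0")
  case False
  have line: "((\<lambda>t. x + t *\<^sub>R D) has_derivative (\<lambda>t. t *\<^sub>R D)) (at 0)"
    by (auto intro!: derivative_eq_intros)
  have "((\<lambda>t. v (x + t *\<^sub>R D)) has_derivative (\<lambda>t. (t *\<^sub>R D) \<bullet> D)) (at 0)"
    using has_derivative_compose[OF line, of v "\<lambda>h. h \<bullet> D"] assms(1) by (simp add: gderiv_def)
  then have "((\<lambda>t. v (x + t *\<^sub>R D)) has_field_derivative D \<bullet> D) (at 0)"
    by (simp add: has_field_derivative_def mult_commute_abs)
  then have lim: "((\<lambda>t. \<bar>(v (x + t *\<^sub>R D) - v x) / t\<bar>) \<longlongrightarrow> \<bar>D \<bullet> D\<bar>) (at 0)"
    by (intro tendsto_rabs) (simp add: has_field_derivative_iff)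
  have "\<forall>\<^sub>F t in at 0. \<bar>(v (x + t *\<^sub>R D) - v x) / t\<bar> \<le> L * norm D"
    unfolding eventually_at
  proof (intro exI[of _ "\<delta> / norm D"] conjI ballI impI)
    show "0 < \<delta> / norm D" using False assms(2) by simp
    fix t :: real assume t: "t \<noteq> 0 \<and> dist t 0 < \<delta> / norm D"
    then have "x + t *\<^sub>R D \<in> ball x \<delta>" using False by (simp add: dist_norm field_simps)
    from assms(4)[OF this] show "\<bar>(v (x + t *\<^sub>R D) - v x) / t\<bar> \<le> L * norm D"
      using t by (simp add: field_simps)
  qed
  then have "\<bar>D \<bullet> D\<bar> \<le> L * norm D"
    using lim by (intro tendsto_upperbound) auto
  then have "norm D * norm D \<le> L * norm D" by (simp add: power2_eq_square flip: power2_norm_eq_inner)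
  then show ?thesis using False by simp
qed (use assms(3) in simp)

lemma C1_on_add:
  assumes "C1_on S v" "C1_on S w"
  shows "C1_on S (\<lambda>x. v x + w x)"
proof -
  obtain F G where F: "\<forall>x\<in>S. (v has_derivative blinfun_apply (F x)) (at x)" "continuous_on S F"
    and G: "\<forall>x\<in>S. (w has_derivative blinfun_apply (G x)) (at x)" "continuous_on S G"
    using assms unfolding C1_on_def by blast
  show ?thesis unfolding C1_on_def
    using F G by (intro exI[of _ "\<lambda>x. F x + G x"]) (auto intro!: continuous_intros derivative_eq_intros simp: blinfun.add_left)
qed

lemma C1_on_scale:
  fixes v :: "'a::real_normed_vector \<Rightarrow> real"
  assumes "C1_on S v"
  shows "C1_on S (\<lambda>x. c * v x)"
proof -
  obtain F where F: "\<forall>x\<in>S. (v has_derivative blinfun_apply (F x)) (at x)" "continuous_on S F"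
    using assms unfolding C1_on_def by blast
  show ?thesis unfolding C1_on_def
    using F by (intro exI[of _ "\<lambda>x. c *\<^sub>R F x"]) (auto intro!: continuous_intros derivative_eq_intros simp: blinfun.scaleR_left)
qed

section \<open>Kernels of class C2 and the gradients of functions in their space\<close>

lemma ball_Times_subset: "ball x (\<delta>/2) \<times> ball y (\<delta>/2) \<subseteq> ball (x, y) \<delta>"
proof clarify
  fix a b assume "a \<in> ball x (\<delta>/2)" "b \<in> ball y (\<delta>/2)"
  then show "(a, b) \<in> ball (x, y) \<delta>"
    using sqrt_sum_squares_le_sum_abs[of "dist x a" "dist y b"] by (simp add: dist_Pair_Pair)
qed

text \<open>The left side is the squared distance of the kernel sections at \<open>x\<close> and
  \<open>y\<close>. It is a mixed second difference of the kernel, hence quadratically small once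
  the second derivative is bounded; here the C2 regularity enters.\<close>

lemma kernel_second_difference:
  fixes k :: "'a::euclidean_space \<Rightarrow> 'a \<Rightarrow> real"
  assumes "open D" "C2_on (D \<times> D) (\<lambda>(x, y). k x y)" "x0 \<in> D"
  obtains C \<delta> where "0 \<le> C" "0 < \<delta>" "ball x0 \<delta> \<subseteq> D"
    "\<And>x y. x \<in> ball x0 \<delta> \<Longrightarrow> y \<in> ball x0 \<delta> \<Longrightarrow> k x x - k x y - k y x + k y y \<le> C * (norm (x - y))\<^sup>2"
proof -
  let ?K = "\<lambda>(x, y). k x y"
  obtain F F' where F: "\<And>z. z \<in> D \<times> D \<Longrightarrow> (?K has_derivative blinfun_apply (F z)) (at z)"
    and F': "\<And>z. z \<in> D \<times> D \<Longrightarrow> (F has_derivative blinfun_apply (F' z)) (at z)" "continuous_on (D \<times> D) F'"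
    using assms(2) unfolding C2_on_def by blast
  define C where "C = norm (F' (x0, x0)) + 1"
  have "open (D \<times> D)" "(x0, x0) \<in> D \<times> D" using assms by (auto intro: open_Times)
  then have "isCont F' (x0, x0)" using F'(2) by (simp add: continuous_on_eq_continuous_at)
  then obtain d1 where d1: "d1 > 0" "\<And>z. dist z (x0, x0) < d1 \<Longrightarrow> dist (F' z) (F' (x0, x0)) < 1"
    unfolding continuous_at_eps_delta by (meson zero_less_one)
  obtain d2 where d2: "d2 > 0" "ball (x0, x0) d2 \<subseteq> D \<times> D"
    using \<open>open (D \<times> D)\<close> \<open>(x0, x0) \<in> D \<times> D\<close> openE by blast
  \<comment> \<open>Halving makes the product of two balls of radius \<delta> fit into a ball of the
    product metric.\<close>
  define \<delta> where "\<delta> = min d1 d2 / 2"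
  define S where "S = ball x0 \<delta> \<times> ball x0 \<delta>"
  have S: "S \<subseteq> ball (x0, x0) (min d1 d2)" unfolding S_def \<delta>_def by (rule ball_Times_subset)
  moreover have "ball (x0, x0) (min d1 d2) \<subseteq> ball (x0, x0) d2" by (rule subset_ball) simp
  ultimately have SD: "S \<subseteq> D \<times> D" using d2(2) by (meson subset_trans)
  have \<delta>: "0 < \<delta>" using d1 d2 by (simp add: \<delta>_def)
  have BD: "ball x0 \<delta> \<subseteq> D" using SD \<delta> unfolding S_def by auto
  have "convex S" unfolding S_def by (intro convex_Times convex_ball)
  have norm_F': "norm (F' z) \<le> C" if "z \<in> S" for z
  proof -
    have "dist z (x0, x0) < d1" using S that by (auto simp: dist_commute)
    then show ?thesis using d1(2)[of z] norm_triangle_ineq2[of "F' z" "F' (x0, x0)"] by (simp add: C_def dist_norm)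
  qed
  have lip: "norm (F z - F w) \<le> C * norm (z - w)" if "z \<in> S" "w \<in> S" for z w
  proof (rule differentiable_bound[OF \<open>convex S\<close> _ _ that])
    show "(F has_derivative blinfun_apply (F' u)) (at u within S)" if "u \<in> S" for u
      using F'(1) SD that has_derivative_at_withinI by blast
    show "onorm (blinfun_apply (F' u)) \<le> C" if "u \<in> S" for u
      using norm_F'[OF that] by (simp add: norm_blinfun.rep_eq)
  qed
  have "k x x - k x y - k y x + k y y \<le> C * (norm (x - y))\<^sup>2" if xy: "x \<in> ball x0 \<delta>" "y \<in> ball x0 \<delta>" for x y
  proof -
    \<comment> \<open>The mean value inequality is used twice: \<psi> is differenced in the second
      argument, and its derivative is small because the derivative of the kernel is Lipschitz in the
      first.\<close>
    let ?\<psi> = "\<lambda>z. k x z - k y z"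
    let ?\<psi>' = "\<lambda>z b. F (x, z) (0, b) - F (y, z) (0, b)"
    have "norm (?\<psi> x - ?\<psi> y) \<le> (C * norm (x - y)) * norm (x - y)"
    proof (rule differentiable_bound[OF convex_ball _ _ xy])
      fix z assume z: "z \<in> ball x0 \<delta>"
      have der: "((\<lambda>z. k a z) has_derivative (\<lambda>b. F (a, z) (0, b))) (at z)" if "a \<in> ball x0 \<delta>" for a
      proof -
        have "(?K has_derivative blinfun_apply (F (a, z))) (at (a, z))"
          by (intro F) (use BD that z in auto)
        from has_derivative_compose[OF has_derivative_Pair[OF has_derivative_const has_derivative_ident] this]
        show ?thesis by simp
      qed
      show "(?\<psi> has_derivative ?\<psi>' z) (at z within ball x0 \<delta>)"
        by (rule has_derivative_at_withinI[OF has_derivative_diff[OF der[OF xy(1)] der[OF xy(2)]]])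
      show "onorm (?\<psi>' z) \<le> C * norm (x - y)"
      proof (rule onorm_le)
        fix b
        have "norm (?\<psi>' z b) = norm ((F (x, z) - F (y, z)) (0, b))" by (simp add: blinfun.diff_left)
        also have "\<dots> \<le> norm (F (x, z) - F (y, z)) * norm ((0::'a), b)" by (rule norm_blinfun)
        also have "\<dots> \<le> (C * norm ((x, z) - (y, z))) * norm ((0::'a), b)"
          by (intro mult_right_mono lip) (use xy z in \<open>auto simp: S_def\<close>)
        finally show "norm (?\<psi>' z b) \<le> C * norm (x - y) * norm b" by simp
      qed
    qed
    then show ?thesis by (simp add: power2_eq_square abs_le_iff)
  qed
  moreover have "0 \<le> C" by (simp add: C_def)
  ultimately show ?thesis using that \<delta> BD by blast
qed

locale rkhs_C2 = rkhs_functions D k H ip for D :: "'a::euclidean_space set" and k H ip +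
  assumes open_D: "open D" and kernel_C2: "C2_on (D \<times> D) (\<lambda>(x, y). k x y)"
begin

text \<open>\<open>v y - v x\<close> is the inner product of \<open>v\<close> with a difference of
  kernel sections, so Cauchy-Schwarz and the second difference estimate apply. \<open>L\<close> and
  \<delta> do not depend on \<open>v\<close>; this uniformity is what lets gradients pass to norm
  limits.\<close>

lemma locally_Lipschitz:
  assumes "x0 \<in> D"
  obtains L \<delta> where "0 \<le> L" "0 < \<delta>" "ball x0 \<delta> \<subseteq> D"
    "\<And>v x y. v \<in> H \<Longrightarrow> x \<in> ball x0 \<delta> \<Longrightarrow> y \<in> ball x0 \<delta> \<Longrightarrow> \<bar>v y - v x\<bar> \<le> sqrt (sqn v) * L * norm (y - x)"
proof -
  obtain C \<delta> where C: "0 \<le> C" "0 < \<delta>" and B: "ball x0 \<delta> \<subseteq> D"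
    and le: "\<And>x y. x \<in> ball x0 \<delta> \<Longrightarrow> y \<in> ball x0 \<delta> \<Longrightarrow> k x x - k x y - k y x + k y y \<le> C * (norm (x - y))\<^sup>2"
    by (rule kernel_second_difference[OF open_D kernel_C2 assms]) (rule that; assumption)
  have "\<bar>v y - v x\<bar> \<le> sqrt (sqn v) * sqrt C * norm (y - x)"
    if v: "v \<in> H" and xy: "x \<in> ball x0 \<delta>" "y \<in> ball x0 \<delta>" for v x y
  proof -
    have D: "x \<in> D" "y \<in> D" using xy B by auto
    let ?kx = "restr D (\<lambda>z. k z x)" and ?ky = "restr D (\<lambda>z. k z y)"
    note in_H = section_in[OF D(1)] section_in[OF D(2)]
    have "sqn (\<lambda>z. ?ky z - ?kx z) = k y y - k y x - k x y + k x x"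
      using sqdist_eq[OF in_H(2,1)] ip_sections D ip_sym[OF in_H] by (simp add: sqdist_def sqn_def)
    also have "\<dots> \<le> C * (norm (y - x))\<^sup>2" using le[OF xy(2,1)] by simp
    finally have "sqrt (sqn (\<lambda>z. ?ky z - ?kx z)) \<le> sqrt (C * (norm (y - x))\<^sup>2)"
      by (rule real_sqrt_le_mono)
    also have "\<dots> = sqrt C * norm (y - x)" by (simp add: real_sqrt_mult)
    finally have le: "sqrt (sqn (\<lambda>z. ?ky z - ?kx z)) \<le> sqrt C * norm (y - x)" .
    have "\<bar>v y - v x\<bar> = \<bar>ip v (\<lambda>z. ?ky z - ?kx z)\<bar>"
      using v in_H reproducing D by (simp add: ip_diff_right)
    also have "\<dots> \<le> sqrt (sqn v) * sqrt (sqn (\<lambda>z. ?ky z - ?kx z))"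
      by (intro abs_ip_le v diff_in in_H)
    also have "\<dots> \<le> sqrt (sqn v) * (sqrt C * norm (y - x))"
      using le sqn_nonneg[OF v] by (intro mult_left_mono) auto
    finally show ?thesis by (simp add: mult.assoc)
  qed
  moreover have "0 \<le> sqrt C" using C(1) by simp
  ultimately show ?thesis using that C(2) B by blast
qed

lemma C1_on_kernel_span:
  assumes "v \<in> kernel_span D k"
  shows "C1_on D v"
  using assms
proof induction
  case zero
  have "blinfun_apply (0 :: 'a \<Rightarrow>\<^sub>L real) = (\<lambda>_. 0)" by auto
  then show ?case unfolding C1_on_def by (intro exI[of _ "\<lambda>_. 0"]) auto
next
  case (add v y c)
  let ?K = "\<lambda>(x, y). k x y"
  obtain F F' where F: "\<And>z. z \<in> D \<times> D \<Longrightarrow> (?K has_derivative blinfun_apply (F z)) (at z)"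
    and F': "\<And>z. z \<in> D \<times> D \<Longrightarrow> (F has_derivative blinfun_apply (F' z)) (at z)"
    using kernel_C2 unfolding C2_on_def by blast
  define J :: "'a \<Rightarrow>\<^sub>L ('a \<times> 'a)" where "J = Blinfun (\<lambda>b. (b, 0))"
  have "bounded_linear (\<lambda>b::'a. (b, 0::'a))" by (intro bounded_linear_Pair bounded_linear_ident bounded_linear_zero)
  then have J: "blinfun_apply J = (\<lambda>b. (b, 0))" by (simp add: J_def bounded_linear_Blinfun_apply)
  have "C1_on D (restr D (\<lambda>x. k x y))" unfolding C1_on_def
  proof (intro exI[of _ "\<lambda>x. F (x, y) o\<^sub>L J"] conjI ballI)
    fix x assume x: "x \<in> D"
    have "((\<lambda>x. ?K (x, y)) has_derivative (\<lambda>b. F (x, y) (b, 0))) (at x)"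
      using F[of "(x, y)"] x add.hyps(2)
      by (intro has_derivative_compose[of "\<lambda>x. (x, y)" "\<lambda>b. (b, 0)" x UNIV ?K]) (auto intro!: derivative_eq_intros)
    moreover have "blinfun_apply (F (x, y) o\<^sub>L J) = (\<lambda>b. F (x, y) (b, 0))" by (auto simp: J)
    ultimately have "((\<lambda>x. k x y) has_derivative blinfun_apply (F (x, y) o\<^sub>L J)) (at x)"
      by simp
    then show "(restr D (\<lambda>x. k x y) has_derivative blinfun_apply (F (x, y) o\<^sub>L J)) (at x)"
      by (rule has_derivative_transform_within_open[OF _ open_D x]) (simp add: restr_def)
  next
    have "continuous_on (D \<times> D) F"
      using F' by (meson has_derivative_continuous continuous_at_imp_continuous_on)
    then have "continuous_on D (\<lambda>x. F (x, y))"
      using add.hyps(2) by (intro continuous_on_compose2[of "D \<times> D" F D "\<lambda>x. (x, y)"]) (auto intro!: continuous_intros)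
    then show "continuous_on D (\<lambda>x. F (x, y) o\<^sub>L J)"
      by (intro continuous_intros)
  qed
  then show ?case using add.IH by (intro C1_on_add C1_on_scale)
qed

text \<open>Elements of the kernel span are C1, and the uniform Lipschitz bound for differences
  turns convergence in \<open>H\<close> into uniform convergence of gradients on the ball. The limit
  is therefore differentiable with continuous gradient.\<close>

lemma GDERIV_and_bound:
  assumes "x0 \<in> D"
  obtains L \<delta> where "0 \<le> L" "0 < \<delta>" "ball x0 \<delta> \<subseteq> D"
    "\<And>v. v \<in> H \<Longrightarrow> continuous_on (ball x0 \<delta>) (gradient v)"
    "\<And>v x. v \<in> H \<Longrightarrow> x \<in> ball x0 \<delta> \<Longrightarrow> GDERIV v x :> gradient v x"
    "\<And>v x. v \<in> H \<Longrightarrow> x \<in> ball x0 \<delta> \<Longrightarrow> norm (gradient v x) \<le> sqrt (sqn v) * L"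
proof -
  obtain L \<delta> where L: "0 \<le> L" and \<delta>: "0 < \<delta>" and B: "ball x0 \<delta> \<subseteq> D"
    and lip: "\<And>v x y. v \<in> H \<Longrightarrow> x \<in> ball x0 \<delta> \<Longrightarrow> y \<in> ball x0 \<delta> \<Longrightarrow> \<bar>v y - v x\<bar> \<le> sqrt (sqn v) * L * norm (y - x)"
    by (rule locally_Lipschitz[OF assms]) (rule that; assumption)
  let ?B = "ball x0 \<delta>"
  have bound: "norm G \<le> sqrt (sqn v) * L" if "v \<in> H" "x \<in> ?B" "GDERIV v x :> G" for v x G
  proof -
    obtain e where "e > 0" "ball x e \<subseteq> ?B" using \<open>x \<in> ?B\<close> open_ball openE by blast
    moreover have "0 \<le> sqrt (sqn v) * L" using L sqn_nonneg[OF that(1)] by simp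
    ultimately show ?thesis using that lip by (intro norm_gradient_le[OF that(3)]) auto
  qed
  have main: "(\<forall>x\<in>?B. GDERIV v x :> gradient v x) \<and> continuous_on ?B (gradient v)" if v: "v \<in> H" for v
  proof -
    obtain s where s: "\<And>i::nat. s i \<in> kernel_span D k" "tends_to s v"
      using kernel_span_dense[OF v] by blast
    have sH: "s i \<in> H" for i using s(1) kernel_span_in by blast
    define G where "G i = gradient (s i)" for i
    have G: "GDERIV (s i) x :> G i x" if "x \<in> ?B" for i x
      using C1_on_gradient(1)[OF C1_on_kernel_span[OF s(1)]] that B by (auto simp: G_def)
    have G_cont: "continuous_on ?B (G i)" for i
      using C1_on_gradient(2)[OF C1_on_kernel_span[OF s(1)]] continuous_on_subset B by (auto simp: G_def)
    have "uniformly_Cauchy_on ?B G"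
    proof (rule uniformly_Cauchy_onI)
      fix e :: real assume e: "e > 0"
      define c where "c = e / (L + 1)"
      have c: "c > 0" using e L by (simp add: c_def)
      then obtain i0 where i0: "\<And>i j. i \<ge> i0 \<Longrightarrow> j \<ge> i0 \<Longrightarrow> sqdist (s i) (s j) < c\<^sup>2"
        using Cauchy_sqdist[OF sH v s(2), of "c\<^sup>2"] by (metis zero_less_power)
      have "dist (G i x) (G j x) < e" if "x \<in> ?B" "i \<ge> i0" "j \<ge> i0" for i j x
      proof -
        have "norm (G i x - G j x) \<le> sqrt (sqdist (s i) (s j)) * L"
          using bound[OF diff_in[OF sH sH] that(1) GDERIV_diff[OF G[OF that(1)] G[OF that(1)]], of i j]
          by (simp add: sqdist_def)
        also have "\<dots> \<le> sqrt (sqdist (s i) (s j)) * (L + 1)"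
          using sqdist_nonneg[OF sH sH] by (intro mult_left_mono) auto
        also have "\<dots> < c * (L + 1)"
          using i0[OF that(2,3)] c L sqdist_nonneg[OF sH sH] by (intro mult_strict_right_mono real_less_lsqrt) auto
        also have "\<dots> = e" using L by (simp add: c_def)
        finally show ?thesis by (simp add: dist_norm)
      qed
      then show "\<exists>M. \<forall>x\<in>?B. \<forall>m\<ge>M. \<forall>n\<ge>M. dist (G m x) (G n x) < e" by blast
    qed
    then obtain g where g: "uniform_limit ?B G g sequentially"
      using Cauchy_uniformly_convergent uniformly_convergent_on_def by blast
    have ev: "\<forall>\<^sub>F n in sequentially. \<forall>x\<in>?B. \<forall>h. norm (h \<bullet> G n x - h \<bullet> g x) \<le> e * norm h" if "e > 0" for e
      using uniform_limitD[OF g that]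
    proof eventually_elim
      case (elim n)
      show ?case
      proof (intro ballI allI)
        fix x h assume "x \<in> ?B"
        have "norm (h \<bullet> G n x - h \<bullet> g x) \<le> norm h * norm (G n x - g x)"
          using Cauchy_Schwarz_ineq2[of h "G n x - g x"] by (simp add: inner_diff_right)
        also have "\<dots> \<le> norm h * e"
          using elim \<open>x \<in> ?B\<close> by (intro mult_left_mono) (auto simp: dist_norm less_imp_le)
        finally show "norm (h \<bullet> G n x - h \<bullet> g x) \<le> e * norm h" by (simp add: mult.commute)
      qed
    qed
    have "\<exists>v'. \<forall>x\<in>?B. (\<lambda>n. s n x) \<longlonglongrightarrow> v' x \<and> (v' has_derivative (\<lambda>h. h \<bullet> g x)) (at x within ?B)"
    proof (rule has_derivative_sequence[OF convex_ball _ ev])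
      show "x0 \<in> ?B" using \<delta> by simp
      show "(\<lambda>n. s n x0) \<longlonglongrightarrow> v x0" by (rule tendsto_eval[OF sH v s(2)])
      show "(s n has_derivative (\<lambda>h. h \<bullet> G n x)) (at x within ?B)" if "x \<in> ?B" for n x
        using G[OF that] by (simp add: gderiv_def has_derivative_at_withinI)
    qed auto
    then obtain v' where v': "\<And>x. x \<in> ?B \<Longrightarrow> (\<lambda>n. s n x) \<longlonglongrightarrow> v' x"
      "\<And>x. x \<in> ?B \<Longrightarrow> (v' has_derivative (\<lambda>h. h \<bullet> g x)) (at x within ?B)" by blast
    have "v' x = v x" if "x \<in> ?B" for x
      using v'(1)[OF that] tendsto_eval[OF sH v s(2)] LIMSEQ_unique by blast
    then have "GDERIV v x :> g x" if "x \<in> ?B" for x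
      using has_derivative_transform_within_open[OF v'(2)[OF that] open_ball that] that
      by (simp add: gderiv_def at_within_open[of _ ?B])
    then have grad: "gradient v x = g x" "GDERIV v x :> gradient v x" if "x \<in> ?B" for x
      using gradient_eqI[of v x "g x"] that by simp_all
    moreover have "continuous_on ?B g"
      using g G_cont by (intro uniform_limit_theorem) auto
    then have "continuous_on ?B (gradient v)"
      using continuous_on_cong[of ?B ?B "gradient v" g] grad(1) by simp
    then show ?thesis using grad(2) by blast
  qed
  show ?thesis
  proof (rule that[OF L \<delta> B])
    show "continuous_on ?B (gradient v)" if "v \<in> H" for v using main[OF that] by simp
    show "GDERIV v x :> gradient v x" if "v \<in> H" "x \<in> ?B" for v x using main[OF that(1)] that(2) by simp
    then show "norm (gradient v x) \<le> sqrt (sqn v) * L" if "v \<in> H" "x \<in> ?B" for v x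
      using bound that by blast
  qed
qed

lemma GDERIV_gradient:
  assumes "v \<in> H" "x \<in> D"
  shows "GDERIV v x :> gradient v x"
proof (rule GDERIV_and_bound[OF assms(2)])
  fix \<delta> :: real
  assume "0 < \<delta>" and G: "\<And>v y. v \<in> H \<Longrightarrow> y \<in> ball x \<delta> \<Longrightarrow> GDERIV v y :> gradient v y"
  then show ?thesis using G[OF assms(1), of x] by simp
qed

lemma norm_gradient_bound:
  assumes "x \<in> D"
  shows "\<exists>L\<ge>0. \<forall>v\<in>H. norm (gradient v x) \<le> sqrt (sqn v) * L"
proof (rule GDERIV_and_bound[OF assms])
  fix L \<delta> :: real
  assume "0 \<le> L" "0 < \<delta>"
    and "\<And>v y. v \<in> H \<Longrightarrow> y \<in> ball x \<delta> \<Longrightarrow> norm (gradient v y) \<le> sqrt (sqn v) * L"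
  then show ?thesis by (intro exI[of _ L]) simp
qed

lemma continuous_on_gradient:
  assumes "v \<in> H"
  shows "continuous_on D (gradient v)"
proof (rule continuous_at_imp_continuous_on, rule ballI)
  fix x assume x: "x \<in> D"
  show "isCont (gradient v) x"
  proof (rule GDERIV_and_bound[OF x])
    fix \<delta> :: real
    assume "0 < \<delta>" and cont: "\<And>v. v \<in> H \<Longrightarrow> continuous_on (ball x \<delta>) (gradient v)"
    then show ?thesis
      using cont[OF assms] continuous_on_eq_continuous_at[OF open_ball, of x \<delta> "gradient v"] by simp
  qed
qed

lemma tendsto_gradient:
  assumes "\<And>i. s i \<in> H" "v \<in> H" "tends_to s v" "x \<in> D"
  shows "(\<lambda>i::nat. gradient (s i) x) \<longlonglongrightarrow> gradient v x"
proof -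
  obtain L where L: "\<And>v. v \<in> H \<Longrightarrow> norm (gradient v x) \<le> sqrt (sqn v) * L"
    using norm_gradient_bound[OF assms(4)] by blast
  have le: "norm (gradient (s i) x - gradient v x) \<le> sqrt (sqdist (s i) v) * L" for i
  proof -
    have "gradient (\<lambda>x. s i x - v x) x = gradient (s i) x - gradient v x"
      by (intro gradient_eqI GDERIV_diff GDERIV_gradient assms)
    then show ?thesis using L[OF diff_in[OF assms(1,2)], of i] by (simp add: sqdist_def)
  qed
  have "(\<lambda>i. sqrt (sqdist (s i) v) * L) \<longlonglongrightarrow> sqrt 0 * L"
    using assms(3) by (intro tendsto_intros)
  then have lim: "(\<lambda>i. sqrt (sqdist (s i) v) * L) \<longlonglongrightarrow> 0" by simp
  have "(\<lambda>i. gradient (s i) x - gradient v x) \<longlonglongrightarrow> 0"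
    by (rule Lim_null_comparison[OF _ lim]) (simp add: le)
  then show ?thesis by (simp add: LIM_zero_iff)
qed

end

section \<open>Absolutely continuous functions\<close>

abbreviation total_length :: "real set set \<Rightarrow> real" where
  "total_length d \<equiv> \<Sum>I\<in>d. Sup I - Inf I"

abbreviation variation :: "(real \<Rightarrow> 'b::real_normed_vector) \<Rightarrow> real set set \<Rightarrow> real" where
  "variation y d \<equiv> \<Sum>I\<in>d. norm (y (Sup I) - y (Inf I))"

lemma abs_continuous_on_IccE:
  assumes "abs_continuous_on_Icc a b y" "0 < e"
  obtains \<delta> where "0 < \<delta>" "\<And>d. d division_of (\<Union>d) \<Longrightarrow> \<Union>d \<subseteq> {a..b} \<Longrightarrow>
        total_length d < \<delta> \<Longrightarrow> variation y d < e"
proof -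
  from assms(1)[unfolded abs_continuous_on_Icc_def, rule_format, OF assms(2)]
  obtain \<delta> where "0 < \<delta>" and *: "\<forall>d. d division_of \<Union> d \<and> \<Union> d \<subseteq> {a..b} \<and> total_length d < \<delta> \<longrightarrow>
      variation y d < e" by (elim exE conjE)
  show ?thesis
  proof (rule that[OF \<open>0 < \<delta>\<close>])
    fix d :: "real set set"
    assume "d division_of (\<Union>d)" "\<Union>d \<subseteq> {a..b}" "total_length d < \<delta>"
    then show "variation y d < e" by (intro *[rule_format] conjI)
  qed
qed

text \<open>A gauge that is small on the exceptional null set \<open>N\<close> makes the intervals tagged in \<open>N\<close> have small
  total length, so absolute continuity bounds their contribution.\<close>

lemma fundamental_theorem_absolutely_continuous:
  fixes y :: "real \<Rightarrow> 'b::banach"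
  assumes ab: "a \<le> b" and AC: "abs_continuous_on_Icc a b y" and N: "negligible N"
    and der: "\<And>t. t \<in> {a..b} - N \<Longrightarrow> (y has_vector_derivative \<phi> t) (at t within {a..b})"
  shows "(\<phi> has_integral (y b - y a)) {a..b}"
proof -
  \<comment> \<open>With the integrand set to zero on \<open>N\<close>, an interval tagged in
    \<open>N\<close> contributes only an increment of \<open>y\<close>, which absolute continuity
    can control.\<close>
  define \<psi> where "\<psi> t = (if t \<in> N then 0 else \<phi> t)" for t
  have "(\<psi> has_integral (y b - y a)) {a..b}"
    unfolding has_integral_real
  proof (intro allI impI)
    fix e :: real assume e: "e > 0"
    obtain \<delta> where \<delta>: "\<delta> > 0" and AC': "\<And>d. d division_of (\<Union>d) \<Longrightarrow> \<Union>d \<subseteq> {a..b} \<Longrightarrow>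
        total_length d < \<delta> \<Longrightarrow> variation y d < e / 2"
      by (rule abs_continuous_on_IccE[OF AC half_gt_zero[OF e]]) (rule that; assumption)
    have N_null: "N \<in> null_sets lebesgue" using N by (simp add: negligible_iff_null_sets)
    then obtain G where G: "open G" "N \<subseteq> G" "G - N \<in> lmeasurable" "emeasure lebesgue (G - N) < ennreal \<delta>"
      using sets_lebesgue_outer_open[of N \<delta>] \<delta> by blast
    have "emeasure lebesgue G = emeasure lebesgue (G - N)"
      using N_null G(1) by (simp add: emeasure_Diff_null_set)
    then have G_meas: "G \<in> lmeasurable" "measure lebesgue G < \<delta>"
      using G \<delta> by (auto simp: fmeasurable_def measure_def enn2real_less_iff borel_open top.not_eq_extremum intro: less_trans)
    \<comment> \<open>The summand 1 keeps the denominator positive when \<open>a = b\<close> and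
      makes \<open>c * (b - a) < e / 2\<close> strict.\<close>
    define c where "c = e / (2 * (b - a + 1))"
    have c: "c > 0" "c * (b - a) < e / 2"
      using e ab by (auto simp: c_def field_simps add_pos_nonneg)
    have "\<exists>d>0. t \<in> {a..b} - N \<longrightarrow> (\<forall>s\<in>{a..b}. norm (s - t) < d \<longrightarrow>
        norm (y s - y t - (s - t) *\<^sub>R \<phi> t) \<le> c * norm (s - t))" for t
    proof (cases "t \<in> {a..b} - N")
      case True
      from der[OF True] c(1) show ?thesis
        unfolding has_vector_derivative_def has_derivative_within_alt by blast
    qed (auto intro: zero_less_one)
    then obtain d where d: "\<And>t. d t > 0" "\<And>t s. t \<in> {a..b} - N \<Longrightarrow> s \<in> {a..b} \<Longrightarrow> norm (s - t) < d t \<Longrightarrow>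
        norm (y s - y t - (s - t) *\<^sub>R \<phi> t) \<le> c * norm (s - t)"
      by metis
    define \<gamma> where "\<gamma> t = (if t \<in> N then G else ball t (d t))" for t
    have gauge: "gauge \<gamma>" using G d(1) by (auto simp: gauge_def \<gamma>_def)
    have main: "norm ((\<Sum>(x, K)\<in>p. measure lborel K *\<^sub>R \<psi> x) - (y b - y a)) < e"
      if p: "p tagged_division_of {a..b}" and fine: "\<gamma> fine p" for p
    proof -
      define E where "E = (\<lambda>(x::real, K). measure lborel K *\<^sub>R \<psi> x - (y (Sup K) - y (Inf K)))"
      define q where "q = {z \<in> p. fst z \<in> N}"
      have fin: "finite p" using p by blast
      have p': "p tagged_division_of cbox a b" using p by simp
      have K: "\<exists>u v. K = {u..v} \<and> u \<le> v \<and> x \<in> K \<and> K \<subseteq> {a..b}" if "(x, K) \<in> p" for x K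
      proof -
        have "x \<in> K" "K \<subseteq> {a..b}" "\<exists>u v. K = cbox u v" using that p by blast+
        then show ?thesis by auto
      qed
      have "(\<Sum>(x, K)\<in>p. measure lborel K *\<^sub>R \<psi> x) - (y b - y a) = sum E p"
        unfolding E_def additive_tagged_division_1[OF ab p, of y, symmetric]
        by (simp add: split_def sum_subtractf)
      also have "\<dots> = sum E (p - q) + sum E q"
        using fin by (subst sum.subset_diff[of q p]) (auto simp: q_def)
      finally have eq: "(\<Sum>(x, K)\<in>p. measure lborel K *\<^sub>R \<psi> x) - (y b - y a) = sum E (p - q) + sum E q" .
      have "norm (sum E (p - q)) \<le> (\<Sum>(x, K)\<in>p - q. c * (Sup K - Inf K))"
      proof (rule sum_norm_le, clarify)
        fix x K assume xK: "(x, K) \<in> p" "(x, K) \<notin> q"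
        then obtain u v where uv: "K = {u..v}" "u \<le> v" "x \<in> {u..v}" "{u..v} \<subseteq> {a..b}" using K by blast
        have x: "x \<notin> N" using xK by (simp add: q_def)
        then have KB: "K \<subseteq> ball x (d x)" using fineD[OF fine xK(1)] by (simp add: \<gamma>_def)
        have "u \<in> K" "v \<in> K" using uv by auto
        then have near: "norm (u - x) < d x" "norm (v - x) < d x"
          using subsetD[OF KB, of u] subsetD[OF KB, of v] by (auto simp: dist_real_def)
        have in_ab: "x \<in> {a..b} - N" "u \<in> {a..b}" "v \<in> {a..b}" using x uv by auto
        \<comment> \<open>Straddling: the increment over \<open>K\<close> is split at the tag, so
          that the differentiability estimate at \<open>x\<close> applies to both endpoints, and the
          two lengths add up to that of \<open>K\<close>.\<close>
        have "E (x, K) = (y u - y x - (u - x) *\<^sub>R \<phi> x) - (y v - y x - (v - x) *\<^sub>R \<phi> x)"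
          using uv(2) x by (simp add: E_def uv(1) \<psi>_def algebra_simps)
        then have "norm (E (x, K)) \<le> norm (y u - y x - (u - x) *\<^sub>R \<phi> x) + norm (y v - y x - (v - x) *\<^sub>R \<phi> x)"
          using norm_triangle_ineq4 by metis
        also have "\<dots> \<le> c * norm (u - x) + c * norm (v - x)"
          using d(2)[OF in_ab(1,2) near(1)] d(2)[OF in_ab(1,3) near(2)] by (rule add_mono)
        also have "\<dots> = c * (v - u)" using uv by (simp add: algebra_simps)
        finally show "norm (E (x, K)) \<le> c * (Sup K - Inf K)" using uv(2) by (simp add: uv(1))
      qed
      also have "\<dots> \<le> (\<Sum>(x, K)\<in>p. c * (Sup K - Inf K))"
        using fin K c(1) by (intro sum_mono2) fastforce+
      also have "\<dots> = c * (b - a)"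
        unfolding additive_tagged_division_1[OF ab p, of "\<lambda>x. x", symmetric]
        by (simp add: split_def sum_distrib_left)
      finally have A: "norm (sum E (p - q)) < e / 2" using c(2) by simp
      have q_part: "q tagged_partial_division_of cbox a b"
        by (rule tagged_partial_division_subset[of p]) (use p' in \<open>auto simp: tagged_division_of_def q_def\<close>)
      let ?D = "snd ` q"
      have D: "?D division_of \<Union>?D" by (rule partial_division_of_tagged_division[OF q_part])
      have K': "\<exists>u v. I = {u..v} \<and> u \<le> v \<and> I \<subseteq> {a..b} \<and> I \<subseteq> G" if I: "I \<in> ?D" for I
      proof -
        obtain x where xI: "(x, I) \<in> p" "x \<in> N" using I by (auto simp: q_def)
        moreover have "I \<subseteq> G" using fineD[OF fine xI(1)] xI(2) by (simp add: \<gamma>_def)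
        ultimately show ?thesis using K[OF xI(1)] by blast
      qed
      have "total_length ?D = (\<Sum>I\<in>?D. measure lebesgue I)"
      proof (rule sum.cong[OF refl])
        fix I assume "I \<in> ?D"
        from K'[OF this] obtain u v where "I = {u..v}" "u \<le> v" by blast
        then show "Sup I - Inf I = measure lebesgue I" by simp
      qed
      also have "\<dots> = measure lebesgue (\<Union>?D)" by (rule content_division[OF D])
      also have "\<dots> \<le> measure lebesgue G"
      proof (rule measure_mono_fmeasurable[OF _ _ G_meas(1)])
        show "\<Union>?D \<subseteq> G"
        proof (rule Union_least)
          fix I assume "I \<in> ?D"
          from K'[OF this] show "I \<subseteq> G" by blast
        qed
        show "\<Union>?D \<in> sets lebesgue" using lmeasurable_division[OF D] by blast
      qed
      finally have len: "total_length ?D < \<delta>" using G_meas(2) by simp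
      have "\<Union>?D \<subseteq> {a..b}"
      proof (rule Union_least)
        fix I assume "I \<in> ?D"
        from K'[OF this] show "I \<subseteq> {a..b}" by blast
      qed
      then have B: "variation y ?D < e / 2"
        by (rule AC'[OF D _ len])
      \<comment> \<open>The passage from tagged intervals to the set of intervals requires value 0
        on degenerate intervals; the empty one is treated apart because \<open>Sup\<close> and
        \<open>Inf\<close> carry no information there.\<close>
      define F where "F I = (if I = {} then 0 else norm (y (Sup I) - y (Inf I)))" for I
      have "norm (sum E q) \<le> (\<Sum>(x, K)\<in>q. F K)"
      proof (rule sum_norm_le, clarify)
        fix x I assume "(x, I) \<in> q"
        then show "norm (E (x, I)) \<le> F I"
          using K[of x I] by (auto simp: q_def E_def F_def \<psi>_def norm_minus_commute)
      qed
      also have "\<dots> = sum F ?D"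
      proof (rule sum.over_tagged_division_lemma[OF tagged_partial_division_of_Union_self[OF q_part]])
        fix u v :: real assume "box u v = {}"
        then have "v \<le> u" by simp
        then show "F (cbox u v) = 0" by (cases "u = v") (auto simp: F_def)
      qed
      also have "\<dots> = variation y ?D"
      proof (rule sum.cong[OF refl])
        fix I assume "I \<in> ?D"
        from K'[OF this] obtain u v where "I = {u..v}" "u \<le> v" by blast
        then show "F I = norm (y (Sup I) - y (Inf I))" by (simp add: F_def)
      qed
      finally have "norm (sum E q) < e / 2" using B by simp
      with A show ?thesis unfolding eq using norm_triangle_ineq[of "sum E (p - q)" "sum E q"] by simp
    qed
    show "\<exists>\<gamma>. gauge \<gamma> \<and> (\<forall>p. p tagged_division_of {a..b} \<and> \<gamma> fine p \<longrightarrow>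
        norm ((\<Sum>(x, K)\<in>p. measure lborel K *\<^sub>R \<psi> x) - (y b - y a)) < e)"
      by (intro exI[of _ \<gamma>] conjI gauge allI impI main) (erule conjunct1, erule conjunct2)
  qed
  then show ?thesis
    by (rule has_integral_spike[OF N, rotated]) (simp add: \<psi>_def)
qed

lemma abs_continuous_on_Icc_subset:
  assumes "abs_continuous_on_Icc a b y" "a \<le> a'" "b' \<le> b"
  shows "abs_continuous_on_Icc a' b' y"
  unfolding abs_continuous_on_Icc_def
proof (intro allI impI)
  fix e :: real assume "e > 0"
  obtain \<delta> where \<delta>: "\<delta> > 0" and AC: "\<And>d. d division_of (\<Union>d) \<Longrightarrow> \<Union>d \<subseteq> {a..b} \<Longrightarrow>
      total_length d < \<delta> \<Longrightarrow> variation y d < e"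
    by (rule abs_continuous_on_IccE[OF assms(1) \<open>e > 0\<close>]) (rule that; assumption)
  have "{a'..b'} \<subseteq> {a..b}" using assms by auto
  then show "\<exists>\<delta>>0. \<forall>d. d division_of \<Union> d \<and> \<Union> d \<subseteq> {a'..b'} \<and> total_length d < \<delta> \<longrightarrow>
      variation y d < e"
    by (intro exI[of _ \<delta>] conjI \<delta> allI impI AC) auto
qed

lemma abs_continuous_imp_continuous_on:
  assumes "abs_continuous_on_Icc a b y"
  shows "continuous_on {a..b} y"
  unfolding continuous_on_iff
proof (intro ballI allI impI)
  fix t e :: real assume t: "t \<in> {a..b}" and e: "e > 0"
  obtain \<delta> where \<delta>: "\<delta> > 0" and AC: "\<And>d. d division_of (\<Union>d) \<Longrightarrow> \<Union>d \<subseteq> {a..b} \<Longrightarrow>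
      total_length d < \<delta> \<Longrightarrow> variation y d < e"
    by (rule abs_continuous_on_IccE[OF assms e]) (rule that; assumption)
  have *: "norm (y v - y u) < e" if "u \<le> v" "u \<in> {a..b}" "v \<in> {a..b}" "v - u < \<delta>" for u v
    using AC[of "{cbox u v}"] division_of_self[of u v] that by simp
  show "\<exists>d>0. \<forall>s\<in>{a..b}. dist s t < d \<longrightarrow> dist (y s) (y t) < e"
  proof (intro exI conjI ballI impI)
    fix s assume s: "s \<in> {a..b}" "dist s t < \<delta>"
    show "dist (y s) (y t) < e"
      using *[of s t] *[of t s] s t by (cases "s \<le> t") (auto simp: dist_norm norm_minus_commute)
  qed fact
qed

lemma Lipschitz_imp_abs_continuous:
  assumes "L-lipschitz_on {a..b} y"
  shows "abs_continuous_on_Icc a b y"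
  unfolding abs_continuous_on_Icc_def
proof (intro allI impI)
  fix e :: real assume e: "e > 0"
  have L: "0 \<le> L" using assms lipschitz_on_nonneg by blast
  show "\<exists>\<delta>>0. \<forall>d. d division_of \<Union> d \<and> \<Union> d \<subseteq> {a..b} \<and> total_length d < \<delta> \<longrightarrow>
      variation y d < e"
  proof (intro exI[of _ "e / (L + 1)"] conjI allI impI)
    show "0 < e / (L + 1)" using e L by simp
    fix d assume d: "d division_of \<Union> d \<and> \<Union> d \<subseteq> {a..b} \<and> total_length d < e / (L + 1)"
    have I: "\<exists>u v. I = {u..v} \<and> u \<le> v \<and> {u..v} \<subseteq> {a..b}" if "I \<in> d" for I
    proof -
      have "I \<noteq> {}" "\<exists>u v. I = cbox u v" using division_ofD(3,4)[of d "\<Union>d"] d that by blast+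
      then show ?thesis using d that by fastforce
    qed
    have "variation y d \<le> (\<Sum>I\<in>d. L * (Sup I - Inf I))"
    proof (rule sum_mono)
      fix I assume "I \<in> d"
      then obtain u v where uv: "I = {u..v}" "u \<le> v" "{u..v} \<subseteq> {a..b}" using I by blast
      then show "norm (y (Sup I) - y (Inf I)) \<le> L * (Sup I - Inf I)"
        using lipschitz_onD[OF assms, of v u] by (simp add: dist_norm)
    qed
    also have "\<dots> = L * total_length d" by (simp add: sum_distrib_left)
    also have "\<dots> \<le> L * (e / (L + 1))" using d L by (intro mult_left_mono) auto
    also have "\<dots> < e" using e L by (simp add: field_simps)
    finally show "variation y d < e" .
  qed
qed

text \<open>With \<Phi> the integral of \<open>w\<close>, the product
  \<open>\<Phi> s * exp (- K * s)\<close> has nonpositive derivative and starts at 0. Hence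
  \<open>\<Phi> t \<le> 0\<close>, and the hypothesis at \<open>t\<close> forces
  \<open>w t \<le> 0\<close>.\<close>

lemma Gronwall_zero:
  fixes w :: "real \<Rightarrow> real"
  assumes t: "0 \<le> t" and w: "continuous_on {0..t} w" "\<And>s. s \<in> {0..t} \<Longrightarrow> 0 \<le> w s"
    and le: "\<And>s. s \<in> {0..t} \<Longrightarrow> w s \<le> K * integral {0..s} w" and K: "0 \<le> K"
  shows "w t = 0"
proof -
  define \<Phi> where "\<Phi> s = integral {0..s} w" for s
  have der: "((\<lambda>s. \<Phi> s * exp (- K * s)) has_real_derivative w s * exp (- K * s) + \<Phi> s * (exp (- K * s) * (- K)))
      (at s within {0..t})" if "s \<in> {0..t}" for s
    unfolding \<Phi>_def using integral_has_real_derivative[OF w(1) that]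
    by (auto intro!: derivative_eq_intros)
  obtain s where s: "s \<in> {0..t}" "\<Phi> t * exp (- K * t) - \<Phi> 0 * exp (- K * 0) =
      (w s * exp (- K * s) + \<Phi> s * (exp (- K * s) * (- K))) * (t - 0)"
    using mvt_very_simple[OF t, of "\<lambda>s. \<Phi> s * exp (- K * s)" "\<lambda>s. (*) (w s * exp (- K * s) + \<Phi> s * (exp (- K * s) * (- K)))"]
      der unfolding has_field_derivative_def by auto
  have "w s * exp (- K * s) + \<Phi> s * (exp (- K * s) * (- K)) = (w s - K * \<Phi> s) * exp (- K * s)"
    by (simp add: algebra_simps)
  also have "\<dots> \<le> 0" using le[OF s(1)] by (simp add: \<Phi>_def mult_nonpos_nonneg)
  finally have "\<Phi> t * exp (- K * t) \<le> 0"
    using s(2) t by (simp add: \<Phi>_def mult_nonpos_nonneg)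
  then have "\<Phi> t \<le> 0" by (simp add: mult_le_0_iff)
  then have "w t \<le> 0" using le[of t] t K by (simp add: \<Phi>_def) (metis mult_nonneg_nonpos order_trans)
  then show ?thesis using w(2)[of t] t by simp
qed

section \<open>Solutions of the control system\<close>

lemma continuous_on_cball_bound:
  fixes F :: "'a::euclidean_space \<Rightarrow> 'b::real_normed_vector"
  assumes "continuous_on (cball x r) F"
  obtains B where "0 \<le> B" "\<And>z. z \<in> cball x r \<Longrightarrow> norm (F z) \<le> B"
proof -
  have "bounded (F ` cball x r)"
    by (intro compact_imp_bounded compact_continuous_image assms compact_cball)
  then obtain B where B: "\<And>z. z \<in> cball x r \<Longrightarrow> norm (F z) \<le> B" unfolding bounded_iff by blast
  have "norm (F z) \<le> max B 0" if "z \<in> cball x r" for z using B[OF that] by simp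
  then show ?thesis using that[of "max B 0"] by simp
qed

lemma C1_imp_Lipschitz_on_cball:
  fixes F :: "'a::euclidean_space \<Rightarrow> 'b::real_normed_vector"
  assumes "C1_on UNIV F"
  obtains L where "L-lipschitz_on (cball x r) F"
proof -
  obtain F' where F': "\<And>x. (F has_derivative blinfun_apply (F' x)) (at x)" "continuous_on UNIV F'"
    using assms unfolding C1_on_def by blast
  have "continuous_on (cball x r) F'" using F'(2) by (rule continuous_on_subset) simp
  then obtain B where B: "0 \<le> B" "\<And>z. z \<in> cball x r \<Longrightarrow> norm (F' z) \<le> B"
    by (rule continuous_on_cball_bound) (rule that; assumption)
  have "B-lipschitz_on (cball x r) F"
  proof (rule lipschitz_onI)
    fix y z assume yz: "y \<in> cball x r" "z \<in> cball x r"
    have "norm (F y - F z) \<le> B * norm (y - z)"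
    proof (rule differentiable_bound[OF convex_cball _ _ yz])
      fix w assume w: "w \<in> cball x r"
      show "(F has_derivative blinfun_apply (F' w)) (at w within cball x r)"
        using F'(1) by (rule has_derivative_at_withinI)
      show "onorm (blinfun_apply (F' w)) \<le> B"
        using B(2)[OF w] by (simp add: norm_blinfun.rep_eq)
    qed
    then show "dist (F y) (F z) \<le> B * dist y z" by (simp add: dist_norm)
  qed (rule B(1))
  then show ?thesis by (rule that)
qed

lemma C1_imp_continuous_on: "C1_on S F \<Longrightarrow> continuous_on S F"
  unfolding C1_on_def by (meson continuous_at_imp_continuous_on has_derivative_continuous)

lemma norm_matrix_vector_le:
  fixes A :: "real^'m^'n"
  shows "norm (A *v u) \<le> norm A * norm u"
proof -
  have "norm (A *v u) = L2_set (\<lambda>i. \<bar>(A $ i) \<bullet> u\<bar>) UNIV"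
    by (simp add: norm_vec_def matrix_vector_mul_component)
  also have "\<dots> \<le> L2_set (\<lambda>i. norm u * norm (A $ i)) UNIV"
    using Cauchy_Schwarz_ineq2[of "A $ _" u] by (intro L2_set_mono) (simp_all add: mult.commute)
  also have "\<dots> = norm u * norm A" by (simp add: L2_set_right_distrib norm_vec_def)
  finally show ?thesis by (simp add: mult.commute)
qed

lemma bounded_bilinear_matrix_vector: "bounded_bilinear ((*v) :: real^'m^'n \<Rightarrow> _)"
proof
  show "\<exists>K. \<forall>a b. norm ((a :: real^'m^'n) *v b) \<le> norm a * norm b * K"
    by (intro exI[of _ 1]) (simp add: norm_matrix_vector_le)
qed (simp_all add: matrix_vector_mult_add_rdistrib matrix_vector_right_distrib
      scaleR_matrix_vector_assoc matrix_vector_mult_scaleR)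

lemmas continuous_on_matrix_vector [continuous_intros] =
  bounded_bilinear.continuous_on[OF bounded_bilinear_matrix_vector]

lemma Linf_controls_bound:
  assumes "u \<in> Linf_controls"
  obtains B N where "0 \<le> B" "negligible N" "\<And>t. 0 \<le> t \<Longrightarrow> t \<notin> N \<Longrightarrow> norm (u t) \<le> B"
proof -
  obtain B where "AE t in lebesgue_on {0..}. norm (u t) \<le> B"
    using assms by (auto simp: Linf_controls_def)
  then have "AE t in lebesgue. t \<in> {0..} \<longrightarrow> norm (u t) \<le> B"
    by (subst (asm) AE_restrict_space_iff) auto
  then obtain N where N: "negligible N" "{t. \<not> (t \<in> {0..} \<longrightarrow> norm (u t) \<le> B)} \<subseteq> N"
    unfolding eventually_ae_filter_negligible by blast
  have "norm (u t) \<le> max B 0" if "0 \<le> t" "t \<notin> N" for t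
    using N(2) that by (auto simp: subset_iff le_max_iff_disj)
  then show ?thesis using that[of "max B 0" N] N(1) by simp
qed

lemma Lipschitz_on_translate:
  fixes y :: "real \<Rightarrow> 'b::metric_space"
  assumes "L-lipschitz_on {a + c..b + c} y"
  shows "L-lipschitz_on {a..b} (\<lambda>s. y (s + c))"
proof (rule lipschitz_onI)
  fix r s assume "r \<in> {a..b}" "s \<in> {a..b}"
  then show "dist (y (r + c)) (y (s + c)) \<le> L * dist r s"
    using lipschitz_onD[OF assms, of "r + c" "s + c"] by (simp add: dist_norm)
qed (rule lipschitz_on_nonneg[OF assms])

lemma has_vector_derivative_translate:
  fixes y :: "real \<Rightarrow> 'b::real_normed_vector"
  assumes "(y has_vector_derivative D) (at (s + c))"
  shows "((\<lambda>s. y (s + c)) has_vector_derivative D) (at s)"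
proof -
  have "((\<lambda>s. s + c) has_derivative (\<lambda>h. h)) (at s)" by (auto intro!: derivative_eq_intros)
  from has_derivative_compose[OF this assms[unfolded has_vector_derivative_def]]
  show ?thesis by (simp add: has_vector_derivative_def)
qed

locale control_system =
  fixes f :: "real^'n \<Rightarrow> real^'n" and g :: "real^'n \<Rightarrow> real^'m^'n"
  assumes f_C1: "C1_on UNIV f" and g_C1: "C1_on UNIV g"
begin

abbreviation sol :: "(real \<Rightarrow> real^'m) \<Rightarrow> real^'n \<Rightarrow> ereal \<Rightarrow> (real \<Rightarrow> real^'n) \<Rightarrow> bool" where
  "sol \<equiv> caratheodory_solution f g"

abbreviation dyn :: "real^'n \<Rightarrow> real^'m \<Rightarrow> real^'n" where
  "dyn z v \<equiv> f z + g z *v v"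

abbreviation solves_at :: "(real \<Rightarrow> real^'n) \<Rightarrow> (real \<Rightarrow> real^'m) \<Rightarrow> real \<Rightarrow> bool" where
  "solves_at y u t \<equiv> (y has_vector_derivative dyn (y t) (u t)) (at t)"

lemma continuous_f [continuous_intros]: "continuous_on S y \<Longrightarrow> continuous_on S (\<lambda>t. f (y t))"
  using continuous_on_compose2[OF C1_imp_continuous_on[OF f_C1]] by blast

lemma continuous_g [continuous_intros]: "continuous_on S y \<Longrightarrow> continuous_on S (\<lambda>t. g (y t))"
  using continuous_on_compose2[OF C1_imp_continuous_on[OF g_C1]] by blast

lemma sol_derivative:
  assumes "sol u x T y"
  obtains N where "negligible N"
    "\<And>t. 0 < t \<Longrightarrow> ereal t < T \<Longrightarrow> t \<notin> N \<Longrightarrow> solves_at y u t"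
proof -
  have "AE t in lebesgue. 0 < t \<and> ereal t < T \<longrightarrow> solves_at y u t"
    using assms by (simp add: caratheodory_solution_def)
  then obtain N where "negligible N"
    "{t. \<not> (0 < t \<and> ereal t < T \<longrightarrow> solves_at y u t)} \<subseteq> N"
    unfolding eventually_ae_filter_negligible by blast
  then show ?thesis using that[of N] by blast
qed

lemma sol_initial: "sol u x T y \<Longrightarrow> y 0 = x" and sol_pos: "sol u x T y \<Longrightarrow> 0 < T"
  by (auto simp: caratheodory_solution_def)

lemma sol_abs_continuous: "sol u x T y \<Longrightarrow> 0 \<le> t \<Longrightarrow> ereal t < T \<Longrightarrow> abs_continuous_on_Icc 0 t y"
  by (simp add: caratheodory_solution_def)

lemma sol_continuous: "sol u x T y \<Longrightarrow> 0 \<le> t \<Longrightarrow> ereal t < T \<Longrightarrow> continuous_on {0..t} y"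
  using sol_abs_continuous abs_continuous_imp_continuous_on by blast

lemma sol_has_integral:
  assumes y: "sol u x T y" and rs: "0 \<le> r" "r \<le> s" "ereal s < T"
  shows "((\<lambda>\<tau>. dyn (y \<tau>) (u \<tau>)) has_integral (y s - y r)) {r..s}"
proof -
  obtain N where N: "negligible N"
    "\<And>t. 0 < t \<Longrightarrow> ereal t < T \<Longrightarrow> t \<notin> N \<Longrightarrow> solves_at y u t"
    by (rule sol_derivative[OF y]) (rule that; assumption)
  show ?thesis
  proof (rule fundamental_theorem_absolutely_continuous[OF rs(2)])
    have "abs_continuous_on_Icc 0 s y"
      by (rule sol_abs_continuous[OF y]) (use rs in auto)
    then show "abs_continuous_on_Icc r s y"
      by (rule abs_continuous_on_Icc_subset) (use rs in auto)
    show "negligible (insert r N)" using N(1) by simp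
    fix t assume t: "t \<in> {r..s} - insert r N"
    then have "ereal t \<le> ereal s" by simp
    then have "ereal t < T" using rs(3) by (rule le_less_trans)
    then show "(y has_vector_derivative dyn (y t) (u t)) (at t within {r..s})"
      by (intro has_vector_derivative_at_within[OF N(2)]) (use t rs in auto)
  qed
qed

lemma sol_dyn_bounded:
  assumes y: "continuous_on {0..t} y" and u: "u \<in> Linf_controls"
  obtains M N where "0 \<le> M" "negligible N" "\<And>s. s \<in> {0..t} \<Longrightarrow> s \<notin> N \<Longrightarrow> norm (dyn (y s) (u s)) \<le> M"
proof -
  obtain B N where B: "0 \<le> B" "negligible N" "\<And>t. 0 \<le> t \<Longrightarrow> t \<notin> N \<Longrightarrow> norm (u t) \<le> B"
    by (rule Linf_controls_bound[OF u]) (rule that; assumption)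
  have "bounded ((\<lambda>s. f (y s)) ` {0..t})" "bounded ((\<lambda>s. g (y s)) ` {0..t})"
    using y by (auto intro!: compact_imp_bounded compact_continuous_image continuous_intros)
  then obtain A C where A: "\<And>s. s \<in> {0..t} \<Longrightarrow> norm (f (y s)) \<le> A" and C: "\<And>s. s \<in> {0..t} \<Longrightarrow> norm (g (y s)) \<le> C"
    unfolding bounded_iff by (meson imageI)
  have "norm (dyn (y s) (u s)) \<le> \<bar>A\<bar> + \<bar>C\<bar> * B" if s: "s \<in> {0..t}" "s \<notin> N" for s
  proof -
    have "norm (g (y s) *v u s) \<le> norm (g (y s)) * norm (u s)" by (rule norm_matrix_vector_le)
    also have "\<dots> \<le> \<bar>C\<bar> * B" using C[OF s(1)] B(3)[of s] s B(1) by (intro mult_mono) auto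
    finally show ?thesis using norm_triangle_ineq[of "f (y s)" "g (y s) *v u s"] A[OF s(1)] by linarith
  qed
  then show ?thesis using that[of "\<bar>A\<bar> + \<bar>C\<bar> * B" N] B(1,2) by simp
qed

text \<open>On a compact time interval the solution is bounded and so is the control, hence also the
  velocity. Lipschitz continuity is easier to shift and to concatenate than absolute continuity,
  which is why \<open>solI\<close> is phrased with it.\<close>

lemma sol_Lipschitz:
  assumes y: "sol u x T y" and u: "u \<in> Linf_controls" and t: "0 \<le> t" "ereal t < T"
  obtains L where "L-lipschitz_on {0..t} y"
proof -
  obtain M N where M: "0 \<le> M" "negligible N" "\<And>s. s \<in> {0..t} \<Longrightarrow> s \<notin> N \<Longrightarrow> norm (dyn (y s) (u s)) \<le> M"
    by (rule sol_dyn_bounded[OF sol_continuous[OF y t] u]) (rule that; assumption)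
  have *: "norm (y s - y r) \<le> M * (s - r)" if "0 \<le> r" "r \<le> s" "s \<le> t" for r s
  proof -
    have "ereal s < T" using that t(2) by (meson ereal_less_eq(3) le_less_trans)
    from has_integral_spike[OF M(2) _ sol_has_integral[OF y that(1,2) this],
        of "\<lambda>\<tau>. if \<tau> \<in> N then 0 else dyn (y \<tau>) (u \<tau>)"]
    have "((\<lambda>\<tau>. if \<tau> \<in> N then 0 else dyn (y \<tau>) (u \<tau>)) has_integral (y s - y r)) (cbox r s)" by simp
    from has_integral_bound[OF M(1) this] M(1,3) that show ?thesis by auto
  qed
  have "M-lipschitz_on {0..t} y"
  proof (rule lipschitz_onI)
    fix r s assume "r \<in> {0..t}" "s \<in> {0..t}"
    then show "dist (y r) (y s) \<le> M * dist r s"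
      using *[of r s] *[of s r] by (cases "r \<le> s") (auto simp: dist_norm norm_minus_commute)
  qed (rule M(1))
  then show ?thesis by (rule that)
qed

lemma solI:
  assumes "0 < T" "y 0 = x" "\<And>t. 0 \<le> t \<Longrightarrow> ereal t < T \<Longrightarrow> \<exists>L. L-lipschitz_on {0..t} y" "negligible N"
    "\<And>t. 0 < t \<Longrightarrow> ereal t < T \<Longrightarrow> t \<notin> N \<Longrightarrow> solves_at y u t"
  shows "sol u x T y"
  unfolding caratheodory_solution_def
proof (intro conjI allI impI)
  show "abs_continuous_on_Icc 0 t y" if "0 \<le> t" "ereal t < T" for t
    using assms(3)[OF that] by (elim exE) (rule Lipschitz_imp_abs_continuous)
  show "AE t in lebesgue. 0 < t \<and> ereal t < T \<longrightarrow> solves_at y u t"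
    unfolding eventually_ae_filter_negligible
  proof (intro exI[of _ N] conjI assms(4) subsetI, rule ccontr)
    fix t assume "t \<in> {t. \<not> (0 < t \<and> ereal t < T \<longrightarrow> solves_at y u t)}" "t \<notin> N"
    then show False using assms(5)[of t] by simp
  qed
qed (use assms in auto)

lemma sol_unique:
  assumes y1: "sol u x T1 y1" and y2: "sol u x T2 y2" and u: "u \<in> Linf_controls"
    and t: "0 \<le> t" "ereal t < T1" "ereal t < T2"
  shows "y1 t = y2 t"
proof -
  have c1: "continuous_on {0..t} y1" and c2: "continuous_on {0..t} y2"
    using sol_continuous y1 y2 t by blast+
  then have "bounded (y1 ` {0..t} \<union> y2 ` {0..t})"
    by (intro bounded_Un[THEN iffD2] conjI compact_imp_bounded compact_continuous_image) auto
  then obtain \<rho> where "\<forall>z\<in>y1 ` {0..t} \<union> y2 ` {0..t}. norm z \<le> \<rho>" unfolding bounded_iff by blast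
  then have \<rho>: "y1 s \<in> cball 0 \<rho>" "y2 s \<in> cball 0 \<rho>" if "s \<in> {0..t}" for s
    using that by auto
  obtain Lf where Lf: "Lf-lipschitz_on (cball 0 \<rho>) f" by (rule C1_imp_Lipschitz_on_cball[OF f_C1])
  obtain Lg where Lg: "Lg-lipschitz_on (cball 0 \<rho>) g" by (rule C1_imp_Lipschitz_on_cball[OF g_C1])
  obtain B N where B: "0 \<le> B" "negligible N" "\<And>t. 0 \<le> t \<Longrightarrow> t \<notin> N \<Longrightarrow> norm (u t) \<le> B"
    by (rule Linf_controls_bound[OF u]) (rule that; assumption)
  \<comment> \<open>A Lipschitz constant, on a ball containing both solutions, of the vector field
    at almost every time, with \<open>B\<close> the essential bound of the control.\<close>
  define K where "K = Lf + Lg * B"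
  have K: "0 \<le> K" using lipschitz_on_nonneg[OF Lf] lipschitz_on_nonneg[OF Lg] B(1) by (simp add: K_def)
  define w where "w s = norm (y1 s - y2 s)" for s
  have w_cont: "continuous_on {0..t} w" unfolding w_def using c1 c2 by (intro continuous_intros)
  have "w s \<le> K * integral {0..s} w" if s: "s \<in> {0..t}" for s
  proof -
    have sT: "ereal s < T1" "ereal s < T2" using s t by (meson atLeastAtMost_iff ereal_less_eq(3) le_less_trans)+
    \<comment> \<open>Zeroing the integrand on \<open>N\<close> leaves the integral unchanged and
      makes the norm bound valid at every time.\<close>
    let ?\<phi> = "\<lambda>\<tau>. if \<tau> \<in> N then 0 else dyn (y1 \<tau>) (u \<tau>) - dyn (y2 \<tau>) (u \<tau>)"
    have diff: "((\<lambda>\<tau>. dyn (y1 \<tau>) (u \<tau>) - dyn (y2 \<tau>) (u \<tau>)) has_integral ((y1 s - y1 0) - (y2 s - y2 0))) {0..s}"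
      using s by (intro has_integral_diff sol_has_integral[OF y1] sol_has_integral[OF y2] sT) auto
    have "(?\<phi> has_integral ((y1 s - y1 0) - (y2 s - y2 0))) {0..s}"
      by (rule has_integral_spike[OF B(2) _ diff]) simp
    then have int: "(?\<phi> has_integral (y1 s - y2 s)) {0..s}"
      using sol_initial[OF y1] sol_initial[OF y2] by simp
    have "continuous_on {0..s} w" by (rule continuous_on_subset[OF w_cont]) (use s in auto)
    then have w_int: "(\<lambda>\<tau>. K * w \<tau>) integrable_on {0..s}"
      by (intro integrable_continuous_real continuous_intros)
    have "norm (integral {0..s} ?\<phi>) \<le> integral {0..s} (\<lambda>\<tau>. K * w \<tau>)"
    proof (rule integral_norm_bound_integral[OF has_integral_integrable[OF int] w_int])
      fix \<tau> assume \<tau>: "\<tau> \<in> {0..s}"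
      show "norm (?\<phi> \<tau>) \<le> K * w \<tau>"
      proof (cases "\<tau> \<in> N")
        case False
        have in_ball: "y1 \<tau> \<in> cball 0 \<rho>" "y2 \<tau> \<in> cball 0 \<rho>" using \<rho> \<tau> s by auto
        have eq: "?\<phi> \<tau> = (f (y1 \<tau>) - f (y2 \<tau>)) + (g (y1 \<tau>) - g (y2 \<tau>)) *v u \<tau>"
          using False by (simp add: matrix_vector_mult_diff_rdistrib)
        have "norm ((g (y1 \<tau>) - g (y2 \<tau>)) *v u \<tau>) \<le> norm (g (y1 \<tau>) - g (y2 \<tau>)) * norm (u \<tau>)"
          by (rule norm_matrix_vector_le)
        also have "\<dots> \<le> (Lg * w \<tau>) * B"
          using lipschitz_onD[OF Lg in_ball] B(3)[of \<tau>] False \<tau>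
            lipschitz_on_nonneg[OF Lg] by (intro mult_mono) (auto simp: dist_norm w_def)
        finally have "norm (?\<phi> \<tau>) \<le> Lf * w \<tau> + (Lg * w \<tau>) * B"
          unfolding eq using lipschitz_onD[OF Lf in_ball]
            norm_triangle_ineq[of "f (y1 \<tau>) - f (y2 \<tau>)" "(g (y1 \<tau>) - g (y2 \<tau>)) *v u \<tau>"]
          by (simp add: dist_norm w_def)
        then show ?thesis by (simp add: K_def algebra_simps)
      qed (use K in \<open>simp add: w_def\<close>)
    qed
    moreover have "w s = norm (integral {0..s} ?\<phi>)" by (simp add: integral_unique[OF int] w_def)
    ultimately show ?thesis by simp
  qed
  then have "w t = 0" using Gronwall_zero[OF t(1) w_cont _ _ K] by (simp add: w_def)
  then show ?thesis by (simp add: w_def)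
qed

lemma trajectory_eq:
  assumes "sol u x T y" "u \<in> Linf_controls" "0 \<le> t" "ereal t < T"
  shows "trajectory f g u x t = y t"
  unfolding trajectory_def
proof (rule the_equality)
  show "\<exists>T z. sol u x T z \<and> 0 \<le> t \<and> ereal t < T \<and> z t = y t" using assms by blast
  fix p assume "\<exists>T z. sol u x T z \<and> 0 \<le> t \<and> ereal t < T \<and> z t = p"
  then obtain T' z where "sol u x T' z" "ereal t < T'" "z t = p" by (elim exE conjE)
  then show "p = y t" using sol_unique[OF _ assms(1,2,3) _ assms(4), of T' z] by simp
qed

text \<open>An infinite supremum yields, for each time, some solution living beyond it, not at once
  a single global one; uniqueness makes \<open>trajectory\<close> the common extension of
  these.\<close>

lemma existence_time_infinite_iff:
  "existence_time f g u x = \<infinity> \<longleftrightarrow> (\<forall>r::real. \<exists>T y. sol u x T y \<and> ereal r < T)"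
proof
  assume "existence_time f g u x = \<infinity>"
  then have "ereal r < Sup {T. \<exists>y. sol u x T y}" for r by (simp add: existence_time_def)
  then show "\<forall>r::real. \<exists>T y. sol u x T y \<and> ereal r < T" unfolding less_Sup_iff by blast
next
  assume "\<forall>r::real. \<exists>T y. sol u x T y \<and> ereal r < T"
  then have "ereal r < Sup {T. \<exists>y. sol u x T y}" for r unfolding less_Sup_iff by blast
  then show "existence_time f g u x = \<infinity>"
    unfolding existence_time_def by (intro ereal_top) (simp add: less_imp_le)
qed

lemma sol_shift:
  assumes y: "sol u x T y" and u: "u \<in> Linf_controls" and t: "0 \<le> t" "ereal t < T"
  shows "sol (\<lambda>s. u (s + t)) (y t) (T - ereal t) (\<lambda>s. y (s + t))"
proof -
  obtain N where N: "negligible N"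
    "\<And>t. 0 < t \<Longrightarrow> ereal t < T \<Longrightarrow> t \<notin> N \<Longrightarrow> solves_at y u t"
    by (rule sol_derivative[OF y]) (rule that; assumption)
  have less: "ereal (s + t) < T \<longleftrightarrow> ereal s < T - ereal t" for s
    by (cases T) auto
  show ?thesis
  proof (rule solI)
    show "0 < T - ereal t" using t less[of 0] by (simp add: zero_ereal_def)
    show "negligible ((+) (-t) ` N)" by (rule negligible_translation[OF N(1)])
  next
    fix s assume s: "0 \<le> s" "ereal s < T - ereal t"
    then have "ereal (s + t) < T" using less by simp
    then obtain L where L: "L-lipschitz_on {0..s + t} y"
      using sol_Lipschitz[OF y u, of "s + t"] s t by (metis add_nonneg_nonneg)
    have "L-lipschitz_on {0..s} (\<lambda>s. y (s + t))"
      by (intro Lipschitz_on_translate lipschitz_on_subset[OF L]) (use t in auto)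
    then show "\<exists>L. L-lipschitz_on {0..s} (\<lambda>s. y (s + t))" by blast
  next
    fix s assume s: "0 < s" "ereal s < T - ereal t" "s \<notin> (+) (-t) ` N"
    then have "s + t \<notin> N" by (auto simp: image_iff)
    then have "(y has_vector_derivative dyn (y (s + t)) (u (s + t))) (at (s + t))"
      using N(2)[of "s + t"] s t less by simp
    then show "((\<lambda>s. y (s + t)) has_vector_derivative dyn (y (s + t)) (u (s + t))) (at s)"
      by (rule has_vector_derivative_translate)
  qed simp
qed

text \<open>\<open>y\<close> may be short-lived while \<open>z\<close> reaches far; by uniqueness
  both give the same restart point, so the tail of \<open>z\<close> can be attached to the segment
  \<open>y\<close>.\<close>

lemma sol_shift_from:
  assumes y: "sol u x T y" and z: "sol u x T' z" and u: "u \<in> Linf_controls"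
    and t: "0 \<le> t" "ereal t < T" "ereal t < T'"
  shows "sol (\<lambda>s. u (s + t)) (y t) (T' - ereal t) (\<lambda>s. z (s + t))"
  using sol_shift[OF z u t(1,3)] sol_unique[OF z y u t(1,3,2)] by simp

lemma sol_concat:
  assumes y1: "sol u1 x T1 y1" "u1 \<in> Linf_controls" and t: "0 < t" "ereal t < T1"
    and y2: "sol u2 (y1 t) T2 y2" "u2 \<in> Linf_controls"
  shows "sol (\<lambda>s. if s < t then u1 s else u2 (s - t)) x (ereal t + T2) (\<lambda>s. if s \<le> t then y1 s else y2 (s - t))"
    (is "sol ?u x _ ?y")
proof -
  obtain N1 where N1: "negligible N1"
    "\<And>t. 0 < t \<Longrightarrow> ereal t < T1 \<Longrightarrow> t \<notin> N1 \<Longrightarrow> solves_at y1 u1 t"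
    by (rule sol_derivative[OF y1(1)]) (rule that; assumption)
  obtain N2 where N2: "negligible N2"
    "\<And>t. 0 < t \<Longrightarrow> ereal t < T2 \<Longrightarrow> t \<notin> N2 \<Longrightarrow> solves_at y2 u2 t"
    by (rule sol_derivative[OF y2(1)]) (rule that; assumption)
  have less: "ereal s < ereal t + T2 \<longleftrightarrow> ereal (s - t) < T2" for s
    by (cases T2) auto
  have T2: "0 < T2" by (rule sol_pos[OF y2(1)])
  show ?thesis
  proof (rule solI)
    show "0 < ereal t + T2" using t T2 by (cases T2) auto
    show "?y 0 = x" using t sol_initial[OF y1(1)] by simp
    \<comment> \<open>The junction time is exceptional because the one-sided velocities may differ
      there. For the same reason it does not matter that the control switches under
      \<open>s < t\<close> and the curve under \<open>s \<le> t\<close>; the curves agree at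
      \<open>t\<close>.\<close>
    show "negligible (insert t (N1 \<union> (+) t ` N2))"
      using N1(1) negligible_translation[OF N2(1)] by simp
  next
    fix s assume s: "0 \<le> s" "ereal s < ereal t + T2"
    obtain L1 where L1: "L1-lipschitz_on {0..t} y1" using sol_Lipschitz[OF y1, of t] t by auto
    show "\<exists>L. L-lipschitz_on {0..s} ?y"
    proof (cases "s \<le> t")
      case True
      then have "L1-lipschitz_on {0..s} y1" using L1 by (rule_tac lipschitz_on_subset) auto
      then have "L1-lipschitz_on {0..s} ?y" by (rule lipschitz_on_transform) (use True in auto)
      then show ?thesis by blast
    next
      case False
      obtain L2 where L2: "L2-lipschitz_on {0..s - t} y2"
        using sol_Lipschitz[OF y2, of "s - t"] s less False by auto
      have "L2-lipschitz_on {t..s} (\<lambda>s. y2 (s - t))"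
        using Lipschitz_on_translate[of L2 t "- t" s y2] L2 by simp
      then have "(max L1 L2)-lipschitz_on {0..s} ?y"
        using L1 sol_initial[OF y2(1)] by (intro lipschitz_on_concat) (auto intro: lipschitz_on_le)
      then show ?thesis by blast
    qed
  next
    fix s assume s: "0 < s" "ereal s < ereal t + T2" "s \<notin> insert t (N1 \<union> (+) t ` N2)"
    show "(?y has_vector_derivative dyn (?y s) (?u s)) (at s)"
    proof (cases "s < t")
      case True
      then have "ereal s < T1" using t(2) by (meson ereal_less_eq(3) le_less_trans less_imp_le)
      then have "solves_at y1 u1 s"
        using N1(2) s by simp
      then have "(?y has_vector_derivative dyn (y1 s) (u1 s)) (at s)"
        by (rule has_vector_derivative_transform_within_open[of _ _ _ "{..<t}"]) (use True in auto)
      then show ?thesis using True by simp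
    next
      case False
      then have st: "t < s" using s(3) by simp
      have "s - t \<notin> N2" using s(3) by (auto simp: image_iff)
      then have "(y2 has_vector_derivative dyn (y2 (s - t)) (u2 (s - t))) (at (s - t))"
        using N2(2)[of "s - t"] st s(2) less by simp
      then have "((\<lambda>s. y2 (s - t)) has_vector_derivative dyn (y2 (s - t)) (u2 (s - t))) (at s)"
        using has_vector_derivative_translate[of y2 _ s "- t"] by simp
      then have "(?y has_vector_derivative dyn (y2 (s - t)) (u2 (s - t))) (at s)"
        by (rule has_vector_derivative_transform_within_open[of _ _ _ "{t<..}"]) (use st in auto)
      then show ?thesis using st by simp
    qed
  qed
qed

end

section \<open>The cost functional\<close>

lemma measurable_translate_lebesgue: "(\<lambda>s::real. t + s) \<in> lebesgue \<rightarrow>\<^sub>M lebesgue"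
  using lebesgue_affine_measurable[where c = "\<lambda>x::real. 1" and t = t] by simp

lemma Linf_controlsI:
  assumes "u \<in> borel_measurable (lebesgue_on {0..})" "negligible N" "\<And>t. 0 \<le> t \<Longrightarrow> t \<notin> N \<Longrightarrow> norm (u t) \<le> B"
  shows "u \<in> Linf_controls"
proof -
  have "AE t in lebesgue. t \<in> {0..} \<longrightarrow> norm (u t) \<le> B"
    unfolding eventually_ae_filter_negligible using assms(2,3) by (intro exI[of _ N]) auto
  then have "AE t in lebesgue_on {0..}. norm (u t) \<le> B"
    by (subst AE_restrict_space_iff) auto
  then show ?thesis using assms(1) by (auto simp: Linf_controls_def)
qed

lemma Linf_controls_measurable: "u \<in> Linf_controls \<Longrightarrow> u \<in> borel_measurable (lebesgue_on {0..})"
  by (simp add: Linf_controls_def)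

lemma measurable_on_Ici_translate:
  fixes q :: "real \<Rightarrow> 'b::euclidean_space"
  assumes "q \<in> borel_measurable (lebesgue_on {0..})"
  shows "(\<lambda>s. if 0 \<le> t + s then q (t + s) else 0) \<in> borel_measurable lebesgue"
proof -
  have "(\<lambda>s. if s \<in> {0..} then q s else 0) \<in> borel_measurable lebesgue"
    by (rule borel_measurable_if_I[OF assms]) simp
  from measurable_compose[OF measurable_translate_lebesgue this] show ?thesis by simp
qed

lemma Linf_controls_shift:
  assumes u: "u \<in> Linf_controls" and t: "0 \<le> t"
  shows "(\<lambda>s. u (s + t)) \<in> Linf_controls"
proof -
  obtain B N where B: "negligible N" "\<And>t. 0 \<le> t \<Longrightarrow> t \<notin> N \<Longrightarrow> norm (u t) \<le> B"
    by (rule Linf_controls_bound[OF u]) (rule that; assumption)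
  have "(\<lambda>s. if 0 \<le> t + s then u (t + s) else 0) \<in> borel_measurable (lebesgue_on {0..})"
    by (intro measurable_restrict_space1 measurable_on_Ici_translate Linf_controls_measurable u)
  then have meas: "(\<lambda>s. u (s + t)) \<in> borel_measurable (lebesgue_on {0..})"
    by (rule measurable_cong[THEN iffD1, rotated]) (use t in \<open>simp add: add.commute\<close>)
  show ?thesis
  proof (rule Linf_controlsI[OF meas negligible_translation[OF B(1)]])
    fix s assume "0 \<le> s" "s \<notin> (+) (- t) ` N"
    moreover from this have "s + t \<notin> N" by (auto simp: image_iff)
    ultimately show "norm (u (s + t)) \<le> B" using B(2)[of "s + t"] t by simp
  qed
qed

lemma Linf_controls_concat:
  assumes u: "u \<in> Linf_controls" and w: "w \<in> Linf_controls" and t: "0 \<le> t"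
  shows "(\<lambda>s. if s < t then u s else w (s - t)) \<in> Linf_controls"
proof -
  obtain B N where B: "0 \<le> B" "negligible N" "\<And>t. 0 \<le> t \<Longrightarrow> t \<notin> N \<Longrightarrow> norm (u t) \<le> B"
    by (rule Linf_controls_bound[OF u]) (rule that; assumption)
  obtain C N' where C: "0 \<le> C" "negligible N'" "\<And>t. 0 \<le> t \<Longrightarrow> t \<notin> N' \<Longrightarrow> norm (w t) \<le> C"
    by (rule Linf_controls_bound[OF w]) (rule that; assumption)
  have "(\<lambda>s. if 0 \<le> - t + s then w (- t + s) else 0) \<in> borel_measurable (lebesgue_on {0..})"
    by (intro measurable_restrict_space1 measurable_on_Ici_translate Linf_controls_measurable w)
  then have "(\<lambda>s. if s < t then u s else if 0 \<le> - t + s then w (- t + s) else 0) \<in> borel_measurable (lebesgue_on {0..})"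
  proof (rule measurable_If[OF Linf_controls_measurable[OF u]])
    have "{s \<in> space (lebesgue_on {0..}). s < t} = {0..<t}" by auto
    then show "{s \<in> space (lebesgue_on {0..}). s < t} \<in> sets (lebesgue_on {0..})"
      by (auto simp: sets_restrict_space_iff)
  qed
  moreover have "(\<lambda>s. if s < t then u s else if 0 \<le> - t + s then w (- t + s) else 0) = (\<lambda>s. if s < t then u s else w (s - t))"
    by auto
  ultimately have meas: "(\<lambda>s. if s < t then u s else w (s - t)) \<in> borel_measurable (lebesgue_on {0..})" by simp
  show ?thesis
  proof (rule Linf_controlsI[OF meas])
    show "negligible (N \<union> (+) t ` N')" by (intro negligible_Un B negligible_translation C)
    fix s assume s: "0 \<le> s" "s \<notin> N \<union> (+) t ` N'"
    then have "s - t \<notin> N'" by (auto simp: image_iff)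
    then show "norm (if s < t then u s else w (s - t)) \<le> max B C"
      using B(3)[of s] C(3)[of "s - t"] s by (auto simp: le_max_iff_disj)
  qed
qed

lemma nn_integral_Ici_split:
  fixes q :: "real \<Rightarrow> real"
  assumes q: "q \<in> borel_measurable (lebesgue_on {0..})" and t: "0 \<le> t"
  shows "(\<integral>\<^sup>+s. ennreal (q s) \<partial>lebesgue_on {0..}) =
    (\<integral>\<^sup>+s. ennreal (q s) \<partial>lebesgue_on {0..<t}) + (\<integral>\<^sup>+s. ennreal (q (s + t)) \<partial>lebesgue_on {0..})"
proof -
  \<comment> \<open>Extension by zero to the whole line makes the shift an instance of translation
    invariance of Lebesgue measure.\<close>
  define p where "p s = ennreal (if s \<in> {0..} then q s else 0)" for s
  have p: "p \<in> borel_measurable lebesgue"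
    using borel_measurable_if_I[OF q] by (simp add: p_def[abs_def])
  have p_ind: "(\<lambda>s. p s * indicator A s) \<in> borel_measurable lebesgue" if "A \<in> sets lebesgue" for A
    by (rule borel_measurable_times_ennreal[OF p borel_measurable_indicator[OF that]])
  have restr: "(\<integral>\<^sup>+s. F s \<partial>lebesgue_on S) = (\<integral>\<^sup>+s. F s * indicator S s \<partial>lebesgue)"
    if "S \<in> sets lebesgue" for F :: "real \<Rightarrow> ennreal" and S
    using that by (intro nn_integral_restrict_space) simp
  have "(\<integral>\<^sup>+s. ennreal (q s) \<partial>lebesgue_on {0..}) = (\<integral>\<^sup>+s. p s * indicator {..<t} s + p s * indicator {t..} s \<partial>lebesgue)"
    by (subst restr) (auto intro!: nn_integral_cong simp: p_def indicator_def)
  also have "\<dots> = (\<integral>\<^sup>+s. p s * indicator {..<t} s \<partial>lebesgue) + (\<integral>\<^sup>+s. p s * indicator {t..} s \<partial>lebesgue)"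
    by (intro nn_integral_add p_ind) auto
  also have "(\<integral>\<^sup>+s. p s * indicator {..<t} s \<partial>lebesgue) = (\<integral>\<^sup>+s. ennreal (q s) \<partial>lebesgue_on {0..<t})"
    by (subst restr) (auto intro!: nn_integral_cong simp: p_def indicator_def)
  also have "(\<integral>\<^sup>+s. p s * indicator {t..} s \<partial>lebesgue) = (\<integral>\<^sup>+s. p (t + s) * indicator {t..} (t + s) \<partial>lebesgue)"
    using nn_integral_real_affine_lebesgue[of "\<lambda>s. p s * indicator {t..} s" 1 t] p_ind[of "{t..}"] by simp
  also have "\<dots> = (\<integral>\<^sup>+s. ennreal (q (s + t)) \<partial>lebesgue_on {0..})"
    by (subst restr) (use t in \<open>auto intro!: nn_integral_cong simp: p_def indicator_def add.commute\<close>)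
  finally show ?thesis .
qed

locale control_problem = control_system f g
  for f :: "real^'n \<Rightarrow> real^'n" and g :: "real^'n \<Rightarrow> real^'m^'n" +
  fixes h :: "real^'n \<Rightarrow> real" and R :: "real^'m^'m"
  assumes h_C1: "C1_on UNIV h" and h_nonneg: "0 \<le> h z" and R: "sym_pos_def R"
begin

abbreviation running_cost :: "real^'n \<Rightarrow> real^'m \<Rightarrow> real" where
  "running_cost z v \<equiv> h z + v \<bullet> (R *v v)"

abbreviation J :: "real^'n \<Rightarrow> (real \<Rightarrow> real^'m) \<Rightarrow> ennreal" where
  "J \<equiv> cost f g h R"

abbreviation opt :: "real^'n \<Rightarrow> ennreal" where
  "opt \<equiv> opt_value f g h R"

lemma quadratic_nonneg: "0 \<le> v \<bullet> (R *v v)"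
proof (cases "v = 0")
  case False
  then have "0 < v \<bullet> (R *v v)" using R unfolding sym_pos_def_def by blast
  then show ?thesis by simp
qed simp

text \<open>The minimum of the form over the compact unit sphere is positive, and homogeneity
  extends it to all vectors. It converts a bound on the cost into a bound on the energy of the
  control.\<close>

lemma quadratic_coercive: "\<exists>c>0. \<forall>v. c * (norm v)\<^sup>2 \<le> v \<bullet> (R *v v)"
proof -
  have "\<exists>v\<in>sphere 0 1. \<forall>w\<in>sphere 0 1. v \<bullet> (R *v v) \<le> w \<bullet> (R *v w)"
    by (rule continuous_attains_inf) (auto intro!: continuous_intros)
  then obtain v :: "real^'m" where v: "norm v = 1" "\<And>w. norm w = 1 \<Longrightarrow> v \<bullet> (R *v v) \<le> w \<bullet> (R *v w)" by auto
  have "v \<noteq> 0" using v(1) by auto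
  then have "0 < v \<bullet> (R *v v)" using R by (simp add: sym_pos_def_def)
  moreover have "(v \<bullet> (R *v v)) * (norm w)\<^sup>2 \<le> w \<bullet> (R *v w)" for w
  proof (cases "w = 0")
    case False
    have "v \<bullet> (R *v v) \<le> (w /\<^sub>R norm w) \<bullet> (R *v (w /\<^sub>R norm w))" using False by (intro v(2)) simp
    also have "\<dots> = (w \<bullet> (R *v w)) / (norm w)\<^sup>2"
      by (simp add: matrix_vector_mult_scaleR power2_eq_square field_simps)
    finally show ?thesis using False by (simp add: field_simps)
  qed simp
  ultimately show ?thesis by blast
qed

text \<open>Near each time the trajectory coincides with one solution living past that time.
  Continuity is what makes the running cost measurable.\<close>

lemma trajectory_continuous:
  assumes u: "u \<in> Linf_controls" and ex: "existence_time f g u x = \<infinity>"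
  shows "continuous_on {0..} (trajectory f g u x)"
  unfolding continuous_on_eq_continuous_within
proof
  fix t :: real assume t: "t \<in> {0..}"
  obtain T y where y: "sol u x T y" "ereal (t + 1) < T"
    using ex unfolding existence_time_infinite_iff by blast
  have "continuous_on {0..t + 1} y" using sol_continuous[OF y(1) _ y(2)] t by simp
  moreover have "trajectory f g u x s = y s" if "s \<in> {0..t + 1}" for s
  proof -
    have "ereal s \<le> ereal (t + 1)" using that by simp
    then show ?thesis using trajectory_eq[OF y(1) u, of s] y(2) that by (meson atLeastAtMost_iff le_less_trans)
  qed
  ultimately have "continuous_on {0..t + 1} (trajectory f g u x)"
    using continuous_on_cong[of "{0..t + 1}" "{0..t + 1}" "trajectory f g u x" y] by simp
  then have "continuous (at t within {0..t + 1}) (trajectory f g u x)"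
    using t by (simp add: continuous_on_eq_continuous_within)
  moreover have "at t within {0..t + 1} = at t within {0..}"
    by (rule at_within_nhd[of t "{..<t + 1}"]) auto
  ultimately show "continuous (at t within {0..}) (trajectory f g u x)" by simp
qed

lemma running_cost_measurable:
  assumes u: "u \<in> borel_measurable (lebesgue_on S)" and S: "S \<in> sets lebesgue" and y: "continuous_on S y"
  shows "(\<lambda>s. running_cost (y s) (u s)) \<in> borel_measurable (lebesgue_on S)"
proof (rule borel_measurable_add)
  have "continuous_on S (\<lambda>s. h (y s))"
    using continuous_on_compose2[OF C1_imp_continuous_on[OF h_C1] y] by blast
  then show "(\<lambda>s. h (y s)) \<in> borel_measurable (lebesgue_on S)"
    by (rule continuous_imp_measurable_on_sets_lebesgue[OF _ S])
  have "(\<lambda>v. v \<bullet> (R *v v)) \<in> borel_measurable borel"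
    by (intro borel_measurable_continuous_onI continuous_intros)
  from measurable_compose[OF u this] show "(\<lambda>s. u s \<bullet> (R *v u s)) \<in> borel_measurable (lebesgue_on S)" .
qed

lemma existence_time_shift:
  assumes u: "u \<in> Linf_controls" and y: "sol u x T y" and t: "0 < t" "ereal t < T"
  shows "existence_time f g (\<lambda>s. u (s + t)) (y t) = \<infinity> \<longleftrightarrow> existence_time f g u x = \<infinity>"
proof
  assume *: "existence_time f g u x = \<infinity>"
  show "existence_time f g (\<lambda>s. u (s + t)) (y t) = \<infinity>"
    unfolding existence_time_infinite_iff
  proof
    fix r :: real
    obtain T' z where z: "sol u x T' z" "ereal (max r 0 + t) < T'"
      using * unfolding existence_time_infinite_iff by blast
    have tT: "ereal t < T'" using z(2) by (cases T') auto
    have "sol (\<lambda>s. u (s + t)) (y t) (T' - ereal t) (\<lambda>s. z (s + t))"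
      using sol_shift_from[OF y z(1) u _ t(2) tT] t(1) by simp
    moreover have "ereal r < T' - ereal t" using z(2) by (cases T') auto
    ultimately show "\<exists>T z. sol (\<lambda>s. u (s + t)) (y t) T z \<and> ereal r < T" by blast
  qed
next
  assume *: "existence_time f g (\<lambda>s. u (s + t)) (y t) = \<infinity>"
  \<comment> \<open>Concatenating a control with its own tail returns the control, so a global
    solution from \<open>y t\<close> can be prefixed by \<open>y\<close>.\<close>
  have eq: "(\<lambda>s. if s < t then u s else u (s - t + t)) = u" by auto
  show "existence_time f g u x = \<infinity>"
    unfolding existence_time_infinite_iff
  proof
    fix r :: real
    obtain S z where z: "sol (\<lambda>s. u (s + t)) (y t) S z" "ereal (r - t) < S"
      using * unfolding existence_time_infinite_iff by blast
    have "sol u x (ereal t + S) (\<lambda>s. if s \<le> t then y s else z (s - t))"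
      using sol_concat[OF y u t z(1) Linf_controls_shift[OF u]] t(1) by (simp add: eq)
    moreover have "ereal r < ereal t + S" using z(2) by (cases S) auto
    ultimately show "\<exists>T z. sol u x T z \<and> ereal r < T" by blast
  qed
qed

text \<open>Dynamic programming for a single control. Global existence from \<open>x\<close> and
  from \<open>y t\<close> are equivalent, so in case of blow-up both sides are infinite; otherwise
  the integral is cut at \<open>t\<close> and the tail is recognised as the trajectory of the
  shifted control.\<close>

lemma cost_split:
  assumes u: "u \<in> Linf_controls" and y: "sol u x T y" and t: "0 < t" "ereal t < T"
  shows "J x u = (\<integral>\<^sup>+s. ennreal (running_cost (y s) (u s)) \<partial>lebesgue_on {0..<t}) + J (y t) (\<lambda>s. u (s + t))"
proof (cases "existence_time f g u x = \<infinity>")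
  case False
  then show ?thesis using existence_time_shift[OF u y t] by (simp add: cost_def)
next
  case True
  let ?z = "trajectory f g u x"
  have "(\<lambda>s. running_cost (?z s) (u s)) \<in> borel_measurable (lebesgue_on {0..})"
    using trajectory_continuous[OF u True] Linf_controls_measurable[OF u] by (intro running_cost_measurable) auto
  from nn_integral_Ici_split[OF this less_imp_le[OF t(1)]]
  have eq: "J x u = (\<integral>\<^sup>+s. ennreal (running_cost (?z s) (u s)) \<partial>lebesgue_on {0..<t}) +
      (\<integral>\<^sup>+s. ennreal (running_cost (?z (s + t)) (u (s + t))) \<partial>lebesgue_on {0..})"
    using True by (simp add: cost_def)
  have "?z s = y s" if "s \<in> {0..<t}" for s
  proof -
    have "ereal s < ereal t" using that by simp
    then show ?thesis using trajectory_eq[OF y u, of s] t(2) that by (meson atLeastLessThan_iff less_trans)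
  qed
  then have first: "(\<integral>\<^sup>+s. ennreal (running_cost (?z s) (u s)) \<partial>lebesgue_on {0..<t}) =
      (\<integral>\<^sup>+s. ennreal (running_cost (y s) (u s)) \<partial>lebesgue_on {0..<t})"
    by (intro nn_integral_cong) simp
  have "?z (s + t) = trajectory f g (\<lambda>s. u (s + t)) (y t) s" if "0 \<le> s" for s
  proof -
    obtain T' z where z: "sol u x T' z" "ereal (s + t) < T'"
      using True unfolding existence_time_infinite_iff by blast
    have tT: "ereal t < T'" using z(2) that by (cases T') auto
    have sh: "sol (\<lambda>s. u (s + t)) (y t) (T' - ereal t) (\<lambda>s. z (s + t))"
      using sol_shift_from[OF y z(1) u _ t(2) tT] t(1) by simp
    have "ereal s < T' - ereal t" using z(2) by (cases T') auto
    then have "trajectory f g (\<lambda>s. u (s + t)) (y t) s = z (s + t)"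
      using trajectory_eq[OF sh Linf_controls_shift[OF u] that] t by simp
    then show ?thesis using trajectory_eq[OF z(1) u _ z(2)] that t by simp
  qed
  then have "(\<integral>\<^sup>+s. ennreal (running_cost (?z (s + t)) (u (s + t))) \<partial>lebesgue_on {0..}) =
      (\<integral>\<^sup>+s. ennreal (running_cost (trajectory f g (\<lambda>s. u (s + t)) (y t) s) (u (s + t))) \<partial>lebesgue_on {0..})"
    by (intro nn_integral_cong) simp
  then show ?thesis using eq first True existence_time_shift[OF u y t] by (simp add: cost_def)
qed

text \<open>Turns the extended nonnegative integral into a gauge integral over a closed interval,
  the form in which it can be added to the increments supplied by
  \<open>fundamental_theorem_absolutely_continuous\<close>.\<close>

lemma cost_split_real:
  assumes u: "u \<in> Linf_controls" and y: "sol u x T y" and t: "0 < t" "ereal t < T"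
    and fin: "J x u < \<infinity>"
  obtains c where "0 \<le> c" "((\<lambda>s. running_cost (y s) (u s)) has_integral c) {0..t}"
    "J x u = ennreal c + J (y t) (\<lambda>s. u (s + t))"
proof -
  let ?q = "\<lambda>s. running_cost (y s) (u s)"
  have q0: "0 \<le> ?q s" for s using h_nonneg quadratic_nonneg by (simp add: add_nonneg_nonneg)
  have "(\<integral>\<^sup>+s. ennreal (?q s) \<partial>lebesgue_on {0..<t}) < \<infinity>"
    using fin unfolding cost_split[OF u y t] by simp
  moreover have "?q \<in> borel_measurable (lebesgue_on {0..<t})"
  proof (rule running_cost_measurable)
    have "continuous_on {0..t} y" using sol_continuous[OF y _ t(2)] t by simp
    then show "continuous_on {0..<t} y" by (rule continuous_on_subset) auto
    show "u \<in> borel_measurable (lebesgue_on {0..<t})"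
      by (rule measurable_restrict_mono[OF Linf_controls_measurable[OF u]]) auto
  qed simp
  ultimately have int: "integrable (lebesgue_on {0..<t}) ?q"
    using q0 by (intro integrableI_bounded) auto
  define c where "c = integral\<^sup>L (lebesgue_on {0..<t}) ?q"
  have c0: "0 \<le> c" unfolding c_def using q0 by (intro Bochner_Integration.integral_nonneg)
  have int_Ico: "(?q has_integral c) {0..<t}"
    unfolding c_def by (rule has_integral_integral_lebesgue_on[OF int]) simp
  have negl: "negligible {s \<in> {0..<t} - {0..t}. ?q s \<noteq> 0}" "negligible {s \<in> {0..t} - {0..<t}. ?q s \<noteq> 0}"
    by (rule negligible_subset[of "{t}"], simp, auto)+
  have "(?q has_integral c) {0..t}"
    by (rule has_integral_spike_set_eq[THEN iffD1, OF negl int_Ico])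
  moreover have "(\<integral>\<^sup>+s. ennreal (?q s) \<partial>lebesgue_on {0..<t}) = ennreal c"
    unfolding c_def using q0 by (intro nn_integral_eq_integral[OF int]) auto
  ultimately show ?thesis using that[OF c0] cost_split[OF u y t] by simp
qed

end

section \<open>The Hamilton-Jacobi-Bellman equation\<close>

lemma sym_pos_def_matrix_inv:
  fixes R :: "real^'m^'m"
  assumes "sym_pos_def R"
  shows "R *v (matrix_inv R *v w) = w"
proof -
  have "\<forall>x. R *v x = 0 \<longrightarrow> x = 0"
  proof (intro allI impI)
    fix x assume "R *v x = 0"
    then have "\<not> 0 < x \<bullet> (R *v x)" by simp
    then show "x = 0" using assms unfolding sym_pos_def_def by blast
  qed
  then have "invertible R"
    unfolding invertible_left_inverse using matrix_left_invertible_ker by blast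
  then have "R ** matrix_inv R = mat 1 \<and> matrix_inv R ** R = mat 1"
    unfolding invertible_def matrix_inv_def by (rule someI_ex)
  then show ?thesis by (simp add: matrix_vector_mul_assoc)
qed

text \<open>In \<open>v\<close>, the expression is a nonnegative form centred at minus one half of
  the inverse of \<open>R\<close> applied to \<open>w p\<close>, minus a remainder free of
  \<open>v\<close>. That remainder is the quadratic gradient term of the Hamilton-Jacobi-Bellman
  equation, so this computes the minimum over controls.\<close>

lemma complete_square:
  fixes R :: "real^'m^'m" and G :: "real^'m^'n"
  assumes R: "sym_pos_def R"
  defines "w \<equiv> \<lambda>p. transpose G *v p"
  shows weighted_norm_inv: "(weighted_norm (matrix_inv R) y)\<^sup>2 = y \<bullet> (matrix_inv R *v y)"
    and square_le: "- (1/4) * (weighted_norm (matrix_inv R) (w p))\<^sup>2 \<le> p \<bullet> (G *v v) + v \<bullet> (R *v v)"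
    and square_eq: "p \<bullet> (G *v ((-1/2) *\<^sub>R (matrix_inv R *v w p))) +
       ((-1/2) *\<^sub>R (matrix_inv R *v w p)) \<bullet> (R *v ((-1/2) *\<^sub>R (matrix_inv R *v w p))) =
       - (1/4) * (weighted_norm (matrix_inv R) (w p))\<^sup>2"
proof -
  have nonneg: "0 \<le> z \<bullet> (R *v z)" for z
    using R unfolding sym_pos_def_def by (cases "z = 0") (auto simp: less_imp_le)
  have sym: "z \<bullet> (R *v z') = z' \<bullet> (R *v z)" for z z'
  proof -
    have "z \<bullet> (R *v z') = (transpose R *v z) \<bullet> z'" by (simp add: dot_lmul_matrix)
    also have "\<dots> = z' \<bullet> (R *v z)" using R unfolding sym_pos_def_def by (simp add: inner_commute)
    finally show ?thesis .
  qed
  note RR = sym_pos_def_matrix_inv[OF R]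
  show wn: "(weighted_norm (matrix_inv R) y)\<^sup>2 = y \<bullet> (matrix_inv R *v y)" for y
    using nonneg[of "matrix_inv R *v y"] by (simp add: weighted_norm_def RR inner_commute)
  have pG: "p \<bullet> (G *v v) = w p \<bullet> v" for p v by (simp add: w_def dot_lmul_matrix)
  have eq: "p \<bullet> (G *v v) + v \<bullet> (R *v v) =
      (v + (1/2) *\<^sub>R (matrix_inv R *v w p)) \<bullet> (R *v (v + (1/2) *\<^sub>R (matrix_inv R *v w p)))
      - (1/4) * (w p \<bullet> (matrix_inv R *v w p))" for v
    using sym[of "matrix_inv R *v w p" v]
    by (simp add: pG matrix_vector_right_distrib matrix_vector_mult_scaleR inner_add_left inner_add_right RR
        inner_commute[of v "w p"] inner_commute[of "matrix_inv R *v w p" "w p"] algebra_simps)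
  show "- (1/4) * (weighted_norm (matrix_inv R) (w p))\<^sup>2 \<le> p \<bullet> (G *v v) + v \<bullet> (R *v v)"
    unfolding eq wn using nonneg[of "v + (1/2) *\<^sub>R (matrix_inv R *v w p)"] by simp
  show "p \<bullet> (G *v ((-1/2) *\<^sub>R (matrix_inv R *v w p))) +
       ((-1/2) *\<^sub>R (matrix_inv R *v w p)) \<bullet> (R *v ((-1/2) *\<^sub>R (matrix_inv R *v w p))) =
       - (1/4) * (weighted_norm (matrix_inv R) (w p))\<^sup>2"
    unfolding eq wn by simp
qed

lemma GDERIV_along_curve:
  assumes "GDERIV W (y s) :> D" "(y has_vector_derivative y') (at s within S)"
  shows "((\<lambda>s. W (y s)) has_vector_derivative D \<bullet> y') (at s within S)"
  using has_derivative_compose[OF assms(2)[unfolded has_vector_derivative_def] assms(1)[unfolded gderiv_def]]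
  by (simp add: has_vector_derivative_def inner_commute)

text \<open>A bootstrap argument. At the first time the distance reaches \<open>r\<close>, the curve
  has stayed in the closed ball so far, and \<open>stay\<close> then says that the distance is still
  smaller than \<open>r\<close>.\<close>

lemma first_exit:
  fixes y :: "real \<Rightarrow> 'b::metric_space"
  assumes y: "continuous_on {0..t} y" "y 0 = x" "0 < r"
    and stay: "\<And>s. 0 < s \<Longrightarrow> s \<le> t \<Longrightarrow> (\<And>s'. s' \<in> {0..s} \<Longrightarrow> y s' \<in> cball x r) \<Longrightarrow> dist x (y s) < r"
    and s: "s \<in> {0..t}"
  shows "y s \<in> cball x r"
proof (rule ccontr)
  assume out: "y s \<notin> cball x r"
  define S where "S = {s \<in> {0..t}. r \<le> dist x (y s)}"
  have cont: "continuous_on {0..t} (\<lambda>s. dist x (y s))" by (intro continuous_intros y(1))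
  have "S = {0..t} \<inter> (\<lambda>s. dist x (y s)) -` {r..}" by (auto simp: S_def)
  then have "closed S" using continuous_closed_preimage[OF cont, of "{r..}"] by simp
  moreover have "bounded S" by (rule bounded_subset[of "{0..t}"]) (auto simp: S_def)
  ultimately have S: "compact S" by (simp add: compact_eq_bounded_closed)
  have "S \<noteq> {}" using out s by (auto simp: S_def)
  from compact_attains_inf[OF S this]
  obtain s0 where s0: "s0 \<in> S" "\<And>s'. s' \<in> S \<Longrightarrow> s0 \<le> s'" by blast
  have s0t: "0 \<le> s0" "s0 \<le> t" "r \<le> dist x (y s0)" using s0(1) by (auto simp: S_def)
  have "s0 \<noteq> 0" using s0t(3) y(2,3) by auto
  \<comment> \<open>At the least time \<open>s0\<close> the distance is only known to be at least
    \<open>r\<close>. The intermediate value theorem produces equality at a time not after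
    \<open>s0\<close>, hence at \<open>s0\<close>; this puts \<open>y s0\<close> into the closed
    ball as \<open>stay\<close> requires.\<close>
  have "continuous_on {0..s0} (\<lambda>s. dist x (y s))"
    by (rule continuous_on_subset[OF cont]) (use s0t in auto)
  then have "\<exists>s1. 0 \<le> s1 \<and> s1 \<le> s0 \<and> dist x (y s1) = r"
    using y(2,3) by (intro IVT'[of "\<lambda>s. dist x (y s)" 0 r s0, OF _ s0t(3,1)]) auto
  then obtain s1 where s1: "0 \<le> s1" "s1 \<le> s0" "dist x (y s1) = r" by blast
  then have "s1 \<in> S" using s0t by (auto simp: S_def)
  then have eq: "dist x (y s0) = r" using s0(2)[of s1] s1 by simp
  have "y s' \<in> cball x r" if "s' \<in> {0..s0}" for s'
  proof (cases "s' = s0")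
    case False
    then have "s' \<notin> S" using s0(2)[of s'] that by auto
    then show ?thesis using that s0t by (auto simp: S_def)
  qed (simp add: eq)
  then have "dist x (y s0) < r" using stay[of s0] s0t \<open>s0 \<noteq> 0\<close> by simp
  then show False using eq by simp
qed

lemma continuous_on_transpose:
  fixes A :: "'a::topological_space \<Rightarrow> real^'k^'l"
  assumes "continuous_on S A"
  shows "continuous_on S (\<lambda>z. transpose (A z))"
  unfolding transpose_def using assms by (intro continuous_on_vec_lambda continuous_intros)

text \<open>A Young-type trade: the linear dependence of the speed on the control is exchanged for a
  constant, large when \<kappa> is small but multiplied by a short time later, plus a small multiple
  of the energy.\<close>

lemma le_inverse_plus_square:
  fixes n \<kappa> :: real
  assumes "0 < \<kappa>" "0 \<le> n"
  shows "n \<le> 1 / \<kappa> + \<kappa> * n\<^sup>2"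
proof (cases "n \<le> 1 / \<kappa>")
  case False
  then have "1 \<le> \<kappa> * n" using assms by (simp add: field_simps)
  then have "n * 1 \<le> n * (\<kappa> * n)" using assms by (intro mult_left_mono) auto
  moreover have "n * (\<kappa> * n) = \<kappa> * n\<^sup>2" by (simp add: power2_eq_square)
  moreover have "0 \<le> 1 / \<kappa>" using assms by simp
  ultimately show ?thesis by linarith
qed (use assms in \<open>simp add: add_increasing2\<close>)

lemma gradient_bounded_imp_Lipschitz:
  fixes W :: "'a::euclidean_space \<Rightarrow> real"
  assumes S: "convex S" and D: "\<And>z. z \<in> S \<Longrightarrow> GDERIV W z :> G z" and B: "\<And>z. z \<in> S \<Longrightarrow> norm (G z) \<le> B" "0 \<le> B"
  shows "B-lipschitz_on S W"
proof (rule lipschitz_onI[OF _ B(2)])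
  fix a b assume ab: "a \<in> S" "b \<in> S"
  have "norm (W a - W b) \<le> B * norm (a - b)"
  proof (rule differentiable_bound[OF S _ _ ab])
    fix z assume z: "z \<in> S"
    show "(W has_derivative (\<lambda>h. h \<bullet> G z)) (at z within S)"
      using D[OF z] by (simp add: gderiv_def has_derivative_at_withinI)
    show "onorm (\<lambda>h. h \<bullet> G z) \<le> B"
    proof (rule onorm_le)
      fix h
      have "norm (h \<bullet> G z) \<le> norm h * norm (G z)" using Cauchy_Schwarz_ineq2[of h "G z"] by simp
      also have "\<dots> \<le> norm h * B" using B(1)[OF z] by (intro mult_left_mono) auto
      finally show "norm (h \<bullet> G z) \<le> B * norm h" by (simp add: mult.commute)
    qed
  qed
  then show "dist (W a) (W b) \<le> B * dist a b" by (simp add: dist_norm)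
qed

section \<open>Existence of trajectories for constant controls\<close>

context control_system
begin

lemma sol_cong:
  assumes "\<And>s. 0 < s \<Longrightarrow> u s = u' s"
  shows "sol u = sol u'"
proof (intro ext)
  fix x T y
  have "(0 < t \<and> ereal t < T \<longrightarrow> solves_at y u t) =
        (0 < t \<and> ereal t < T \<longrightarrow> solves_at y u' t)" for t
    using assms[of t] by auto
  then show "sol u x T y = sol u' x T y" by (simp add: caratheodory_solution_def)
qed

text \<open>Picard iteration: the Banach fixed point theorem for \<open>\<phi> \<mapsto> x + \<integral>\<^sub>0\<^sup>t F (\<phi> s) ds\<close>, where time is
  clamped to \<open>{0..\<tau>}\<close>.\<close>

lemma constant_control_curve:
  assumes r: "0 < r"
  obtains \<tau> M y where "0 < \<tau>" "y 0 = x" "\<And>s. s \<in> {0..\<tau>} \<Longrightarrow> y s \<in> cball x r"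
    "\<And>s. s \<in> {0..\<tau>} \<Longrightarrow> norm (dyn (y s) v) \<le> M"
    "\<And>s. s \<in> {0..\<tau>} \<Longrightarrow> (y has_vector_derivative dyn (y s) v) (at s within {0..\<tau>})"
proof -
  define F where "F z = dyn z v" for z
  obtain Lf where Lf: "Lf-lipschitz_on (cball x r) f" by (rule C1_imp_Lipschitz_on_cball[OF f_C1])
  obtain Lg where Lg: "Lg-lipschitz_on (cball x r) g" by (rule C1_imp_Lipschitz_on_cball[OF g_C1])
  define L where "L = Lf + Lg * norm v"
  have L: "0 \<le> L" using lipschitz_on_nonneg[OF Lf] lipschitz_on_nonneg[OF Lg] by (simp add: L_def)
  have F_lip: "norm (F z - F z') \<le> L * norm (z - z')" if "z \<in> cball x r" "z' \<in> cball x r" for z z'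
  proof -
    have eq: "F z - F z' = (f z - f z') + (g z - g z') *v v"
      by (simp add: F_def matrix_vector_mult_diff_rdistrib)
    have "norm ((g z - g z') *v v) \<le> norm (g z - g z') * norm v" by (rule norm_matrix_vector_le)
    also have "\<dots> \<le> (Lg * norm (z - z')) * norm v"
      using lipschitz_onD[OF Lg that] by (intro mult_right_mono) (auto simp: dist_norm)
    finally show ?thesis
      unfolding eq using lipschitz_onD[OF Lf that] norm_triangle_ineq[of "f z - f z'" "(g z - g z') *v v"]
      by (simp add: dist_norm L_def algebra_simps)
  qed
  define M where "M = norm (F x) + L * r"
  have M: "0 \<le> M" using L r by (simp add: M_def)
  have F_le: "norm (F z) \<le> M" if "z \<in> cball x r" for z
  proof -
    have "norm (F z - F x) \<le> L * norm (z - x)" using F_lip[OF that, of x] r by simp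
    also have "\<dots> \<le> L * r" using that L by (intro mult_left_mono) (auto simp: dist_norm norm_minus_commute)
    finally show ?thesis using norm_triangle_ineq2[of "F z" "F x"] by (simp add: M_def)
  qed
  \<comment> \<open>The first term keeps curves of speed at most \<open>M\<close> inside the ball of
    radius \<open>r\<close>; the second makes the Picard map a contraction with factor 1/2. The
    added ones avoid division by zero.\<close>
  define \<tau> where "\<tau> = min (r / (M + 1)) (1 / (2 * (L + 1)))"
  have \<tau>: "0 < \<tau>" using r M L by (simp add: \<tau>_def)
  have M\<tau>: "M * \<tau> \<le> r"
  proof -
    have "M * \<tau> \<le> M * (r / (M + 1))" using M by (intro mult_left_mono) (auto simp: \<tau>_def)
    also have "\<dots> \<le> r" using M r by (simp add: field_simps)
    finally show ?thesis .
  qed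
  have L\<tau>: "L * \<tau> \<le> 1/2"
  proof -
    have "L * \<tau> \<le> L * (1 / (2 * (L + 1)))" using L by (intro mult_left_mono) (auto simp: \<tau>_def)
    also have "\<dots> \<le> 1/2" using L by (simp add: field_simps)
    finally show ?thesis .
  qed
  define c where "c t = max 0 (min \<tau> t)" for t
  have c: "c t \<in> {0..\<tau>}" "0 \<le> c t" for t using \<tau> by (auto simp: c_def)
  define P where "P \<phi> t = x + integral {0..c t} (\<lambda>s. F (apply_bcontfun \<phi> s))" for \<phi> t
  \<comment> \<open>The distance is the supremum distance, so members of \<open>S\<close> take all
    their values in \<open>cball x r\<close>, where the constants \<open>L\<close> and
    \<open>M\<close> are valid; as a closed ball \<open>S\<close> is complete.\<close>
  define S where "S = cball (const_bcontfun x :: real \<Rightarrow>\<^sub>C (real^'n)) r"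
  have in_S: "apply_bcontfun \<phi> t \<in> cball x r" if "\<phi> \<in> S" for \<phi> t
    using dist_bounded[of "const_bcontfun x" t \<phi>] that
    by (simp add: S_def const_bcontfun.rep_eq)
  have F_cont: "continuous_on T (\<lambda>s. F (apply_bcontfun \<phi> s))" for \<phi> T
    unfolding F_def by (intro continuous_intros continuous_on_apply_bcontfun)
  have P_cont: "continuous_on UNIV (P \<phi>)" for \<phi>
  proof -
    have "continuous_on {0..\<tau>} (\<lambda>t. integral {0..t} (\<lambda>s. F (apply_bcontfun \<phi> s)))"
      by (intro indefinite_integral_continuous_1 integrable_continuous_real F_cont)
    moreover have "continuous_on UNIV c" unfolding c_def by (intro continuous_intros)
    ultimately have "continuous_on UNIV (\<lambda>t. integral {0..c t} (\<lambda>s. F (apply_bcontfun \<phi> s)))"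
      by (rule continuous_on_compose2) (use c in auto)
    then show ?thesis unfolding P_def[abs_def] by (intro continuous_intros)
  qed
  have P_in: "dist x (P \<phi> t) \<le> r" if "\<phi> \<in> S" for \<phi> t
  proof -
    have "norm (integral {0..c t} (\<lambda>s. F (apply_bcontfun \<phi> s))) \<le> M * (c t - 0)"
      by (intro integral_bound c F_cont F_le in_S that)
    also have "\<dots> \<le> M * \<tau>" using M c(1)[of t] by (intro mult_left_mono) auto
    finally show ?thesis using M\<tau> by (simp add: P_def dist_norm)
  qed
  define \<Psi> where "\<Psi> \<phi> = Bcontfun (P \<phi>)" for \<phi>
  have apply_\<Psi>: "apply_bcontfun (\<Psi> \<phi>) = P \<phi>" if "\<phi> \<in> S" for \<phi>
  proof -
    have "norm (P \<phi> t) \<le> norm x + r" for t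
      using P_in[OF that, of t] norm_triangle_sub[of "P \<phi> t" x] by (simp add: dist_norm norm_minus_commute)
    then have "P \<phi> \<in> bcontfun" using P_cont by (intro bcontfun_normI) auto
    then show ?thesis by (simp add: \<Psi>_def Bcontfun_inverse)
  qed
  have "\<exists>!\<phi>\<in>S. \<Psi> \<phi> = \<phi>"
  proof (rule Banach_fix[of S "1/2"])
    show "complete S" unfolding S_def by (simp add: complete_eq_closed)
    show "S \<noteq> {}" using r by (auto simp: S_def)
    show "\<Psi> ` S \<subseteq> S"
    proof clarify
      fix \<phi> assume "\<phi> \<in> S"
      then have "dist (const_bcontfun x) (\<Psi> \<phi>) \<le> r"
        using P_in by (intro dist_bound) (simp add: apply_\<Psi> const_bcontfun.rep_eq)
      then show "\<Psi> \<phi> \<in> S" by (simp add: S_def)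
    qed
    fix \<phi> \<phi>' assume \<phi>: "\<phi> \<in> S" "\<phi>' \<in> S"
    have "dist (P \<phi> t) (P \<phi>' t) \<le> 1/2 * dist \<phi> \<phi>'" for t
    proof -
      have "P \<phi> t - P \<phi>' t = integral {0..c t} (\<lambda>s. F (apply_bcontfun \<phi> s) - F (apply_bcontfun \<phi>' s))"
        unfolding P_def by (subst Henstock_Kurzweil_Integration.integral_diff) (auto intro!: integrable_continuous_real F_cont)
      also have "norm \<dots> \<le> (L * dist \<phi> \<phi>') * (c t - 0)"
      proof (intro integral_bound c)
        show "continuous_on {0..c t} (\<lambda>s. F (apply_bcontfun \<phi> s) - F (apply_bcontfun \<phi>' s))"
          by (intro continuous_on_diff F_cont)
        fix s
        have "norm (F (apply_bcontfun \<phi> s) - F (apply_bcontfun \<phi>' s)) \<le> L * dist (apply_bcontfun \<phi> s) (apply_bcontfun \<phi>' s)"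
          using F_lip[OF in_S[OF \<phi>(1)] in_S[OF \<phi>(2)]] by (simp add: dist_norm)
        also have "\<dots> \<le> L * dist \<phi> \<phi>'" using L dist_bounded by (intro mult_left_mono)
        finally show "norm (F (apply_bcontfun \<phi> s) - F (apply_bcontfun \<phi>' s)) \<le> L * dist \<phi> \<phi>'" .
      qed
      also have "\<dots> \<le> (L * dist \<phi> \<phi>') * \<tau>" using L c(1)[of t] by (intro mult_left_mono) auto
      also have "\<dots> = (L * \<tau>) * dist \<phi> \<phi>'" by simp
      also have "\<dots> \<le> 1/2 * dist \<phi> \<phi>'" using L\<tau> by (intro mult_right_mono) auto
      finally show ?thesis by (simp add: dist_norm)
    qed
    then show "dist (\<Psi> \<phi>) (\<Psi> \<phi>') \<le> 1/2 * dist \<phi> \<phi>'"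
      using \<phi> by (intro dist_bound) (simp add: apply_\<Psi>)
  qed auto
  then obtain \<phi> where \<phi>: "\<phi> \<in> S" "\<Psi> \<phi> = \<phi>" by blast
  define y where "y = apply_bcontfun \<phi>"
  have y_eq: "y t = x + integral {0..t} (\<lambda>s. F (y s))" if "t \<in> {0..\<tau>}" for t
  proof -
    have "y t = P \<phi> t" using apply_\<Psi>[OF \<phi>(1)] \<phi>(2) by (simp add: y_def)
    then show ?thesis using that by (simp add: P_def y_def c_def)
  qed
  have y_in: "y s \<in> cball x r" for s using in_S[OF \<phi>(1)] by (simp add: y_def)
  show ?thesis
  proof (rule that[OF \<tau>])
    show "y 0 = x" using y_eq[of 0] \<tau> by simp
    show "y s \<in> cball x r" for s by (rule y_in)
    show "norm (dyn (y s) v) \<le> M" for s using F_le[OF y_in] by (simp add: F_def)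
    fix s assume s: "s \<in> {0..\<tau>}"
    have "continuous_on {0..\<tau>} (\<lambda>s. F (y s))" unfolding y_def by (rule F_cont)
    then have "((\<lambda>t. integral {0..t} (\<lambda>s. F (y s))) has_vector_derivative F (y s)) (at s within {0..\<tau>})"
      by (rule integral_has_vector_derivative[OF _ s])
    then have "((\<lambda>t. x + integral {0..t} (\<lambda>s. F (y s))) has_vector_derivative F (y s)) (at s within {0..\<tau>})"
      by (auto intro!: derivative_eq_intros)
    then have "(y has_vector_derivative F (y s)) (at s within {0..\<tau>})"
      by (rule has_vector_derivative_transform[OF s y_eq, rotated])
    then show "(y has_vector_derivative dyn (y s) v) (at s within {0..\<tau>})" by (simp add: F_def)
  qed
qed

lemma constant_control_sol:
  assumes "0 < \<tau>" "y 0 = x" "\<And>s. s \<in> {0..\<tau>} \<Longrightarrow> norm (dyn (y s) v) \<le> M"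
    "\<And>s. s \<in> {0..\<tau>} \<Longrightarrow> (y has_vector_derivative dyn (y s) v) (at s within {0..\<tau>})"
  shows "sol (\<lambda>_. v) x (ereal \<tau>) y"
proof (rule solI)
  show "0 < ereal \<tau>" "y 0 = x" "negligible ({} :: real set)" using assms by auto
  fix t :: real
  show "\<exists>L. L-lipschitz_on {0..t} y" if t: "0 \<le> t" "ereal t < ereal \<tau>"
  proof (intro exI lipschitz_onI)
    show "0 \<le> M" using assms(1) assms(3)[of 0] norm_ge_zero[of "dyn (y 0) v"] by (simp del: norm_ge_zero)
    fix p q assume pq: "p \<in> {0..t}" "q \<in> {0..t}"
    have "norm (y p - y q) \<le> M * norm (p - q)"
    proof (rule differentiable_bound[OF _ _ _ pq])
      fix s assume s: "s \<in> {0..t}"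
      then have s\<tau>: "s \<in> {0..\<tau>}" using t by auto
      show "(y has_derivative (\<lambda>a. a *\<^sub>R dyn (y s) v)) (at s within {0..t})"
        by (rule has_derivative_subset[OF assms(4)[OF s\<tau>, unfolded has_vector_derivative_def]]) (use t in auto)
      show "onorm (\<lambda>a. a *\<^sub>R dyn (y s) v) \<le> M"
        by (rule onorm_le) (use mult_right_mono[OF assms(3)[OF s\<tau>] abs_ge_zero] in \<open>simp add: mult.commute\<close>)
    qed simp
    then show "dist (y p) (y q) \<le> M * dist p q" by (simp add: dist_norm)
  qed
  show "(y has_vector_derivative dyn (y t) v) (at t)" if "0 < t" "ereal t < ereal \<tau>"
    using assms(4)[of t] that at_within_Icc_at[of 0 t \<tau>] by simp
qed

end

section \<open>Dynamic programming inequalities, the Hamilton-Jacobi-Bellman equation and comparison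
  of solutions\<close>

context control_problem
begin

text \<open>Shifting a concatenated control back by the switching time recovers the second control
  only at nonnegative times; this makes the two costs equal nevertheless.\<close>

lemma cost_cong:
  assumes "\<And>s. 0 \<le> s \<Longrightarrow> u s = u' s"
  shows "J x u = J x u'"
proof -
  have sol: "sol u = sol u'" using assms by (intro sol_cong) simp
  then have "existence_time f g u x = existence_time f g u' x" "trajectory f g u x = trajectory f g u' x"
    by (auto simp: existence_time_def trajectory_def)
  moreover have "(\<integral>\<^sup>+t. ennreal (running_cost (trajectory f g u' x t) (u t)) \<partial>lebesgue_on {0..}) =
      (\<integral>\<^sup>+t. ennreal (running_cost (trajectory f g u' x t) (u' t)) \<partial>lebesgue_on {0..})"
    using assms by (intro nn_integral_cong) simp
  ultimately show ?thesis by (simp add: cost_def)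
qed

lemma opt_value_near_optimal:
  assumes "opt x = ennreal a" "a < b" "0 < b"
  obtains u where "u \<in> Linf_controls" "J x u < ennreal b"
proof -
  have "opt x < ennreal b" using assms by (simp add: ennreal_less_iff[of a] ennreal_lessI)
  then show ?thesis using that unfolding opt_value_def INF_less_iff by blast
qed

lemma opt_value_le: "u \<in> Linf_controls \<Longrightarrow> opt x \<le> J x u"
  unfolding opt_value_def by (rule INF_lower)

lemma running_cost_nonneg: "0 \<le> running_cost z v"
  using h_nonneg quadratic_nonneg by (simp add: add_nonneg_nonneg)

text \<open>The competitor applies \<open>v\<close> up to time \<open>t\<close> and \<open>w\<close>
  afterwards. If \<open>w\<close> leads to blow-up from \<open>y t\<close>, the right side is
  infinite.\<close>

lemma opt_value_constant_control_le:
  assumes y: "sol (\<lambda>_. v) x T y" and t: "0 < t" "ereal t < T"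
    and b: "\<And>s. s \<in> {0..<t} \<Longrightarrow> running_cost (y s) v \<le> b" and w: "w \<in> Linf_controls"
  shows "opt x \<le> ennreal (b * t) + J (y t) w"
proof (cases "existence_time f g w (y t) = \<infinity>")
  case False
  then show ?thesis by (simp add: cost_def)
next
  case True
  let ?u = "\<lambda>s. if s < t then v else w (s - t)"
  let ?S = "\<lambda>z s. if s \<le> t then y s else z (s - t)"
  have const: "(\<lambda>_::real. v) \<in> Linf_controls"
    by (rule Linf_controlsI[of _ "{}" "norm v"]) auto
  obtain T' z where z: "sol w (y t) T' z"
    using True unfolding existence_time_infinite_iff by blast
  have u: "?u \<in> Linf_controls" by (rule Linf_controls_concat[OF const w]) (use t in simp)
  have sol: "sol ?u x (ereal t + T') (?S z)" by (rule sol_concat[OF y const t z w])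
  have "ereal t < ereal t + T'" using sol_pos[OF z] by (cases T') auto
  from cost_split[OF u sol t(1) this]
  have "J x ?u = (\<integral>\<^sup>+s. ennreal (running_cost (?S z s) (?u s)) \<partial>lebesgue_on {0..<t}) +
      J (y t) (\<lambda>s. ?u (s + t))" by simp
  also have "J (y t) (\<lambda>s. ?u (s + t)) = J (y t) w"
    by (rule cost_cong) simp
  also have "(\<integral>\<^sup>+s. ennreal (running_cost (?S z s) (?u s)) \<partial>lebesgue_on {0..<t}) \<le> (\<integral>\<^sup>+s. ennreal b \<partial>lebesgue_on {0..<t})"
    by (intro nn_integral_mono ennreal_leI) (use b in simp)
  also have "\<dots> = ennreal b * ennreal t" using t by (simp add: emeasure_restrict_space)
  also have "\<dots> = ennreal (b * t)"
    using t b[of 0] running_cost_nonneg[of "y 0" v] by (intro ennreal_mult[symmetric]) auto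
  finally have "J x ?u \<le> ennreal (b * t) + J (y t) w" by (simp add: add_right_mono)
  then show ?thesis using opt_value_le[OF u, of x] by (rule order_trans[rotated])
qed

text \<open>Holding the control at \<open>v\<close> for a short time and continuing almost optimally
  cannot beat the optimal value at \<open>x\<close>. Dividing this inequality by the time and
  letting it tend to zero leaves the derivative of \<open>W\<close> along the curve.\<close>

lemma hjb_nonneg:
  assumes \<Omega>: "open \<Omega>" "x \<in> \<Omega>"
    and W: "\<And>z. z \<in> \<Omega> \<Longrightarrow> opt z = ennreal (W z)" "\<And>z. z \<in> \<Omega> \<Longrightarrow> 0 \<le> W z"
    and D: "GDERIV W x :> p"
  shows "0 \<le> p \<bullet> dyn x v + running_cost x v"
proof (rule field_le_epsilon)
  fix e :: real assume e: "0 < e"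
  \<comment> \<open>Half of \<open>e\<close> absorbs the variation of the running cost along the
    curve; the other half, multiplied by the time, is the optimality gap of the
    continuation.\<close>
  define b where "b = running_cost x v + e / 2"
  have b0: "0 < b" using running_cost_nonneg[of x v] e by (simp add: b_def)
  obtain r where r: "0 < r" "cball x r \<subseteq> \<Omega>" using \<Omega> open_contains_cball by blast
  obtain \<tau> M y where \<tau>: "0 < \<tau>" and y0: "y 0 = x" and y_in: "\<And>s. s \<in> {0..\<tau>} \<Longrightarrow> y s \<in> cball x r"
    and M: "\<And>s. s \<in> {0..\<tau>} \<Longrightarrow> norm (dyn (y s) v) \<le> M"
    and der: "\<And>s. s \<in> {0..\<tau>} \<Longrightarrow> (y has_vector_derivative dyn (y s) v) (at s within {0..\<tau>})"
    by (rule constant_control_curve[OF r(1), of x v]) (rule that; assumption)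
  have sol: "sol (\<lambda>_. v) x (ereal \<tau>) y"
    by (rule constant_control_sol[OF \<tau> y0 M der])
  have y_cont: "continuous_on {0..\<tau>} y"
    unfolding continuous_on_eq_continuous_within using has_vector_derivative_continuous[OF der] by blast
  have "continuous_on {0..\<tau>} (\<lambda>s. running_cost (y s) v)"
    using continuous_on_compose2[OF C1_imp_continuous_on[OF h_C1] y_cont] by (intro continuous_intros) auto
  from this[unfolded continuous_on_iff, rule_format, of 0 "e / 2"] \<tau> e
  obtain d where d: "0 < d" "\<And>s. s \<in> {0..\<tau>} \<Longrightarrow> dist s 0 < d \<Longrightarrow>
      dist (running_cost (y s) v) (running_cost (y 0) v) < e / 2" by auto
  have quot: "- e - running_cost x v \<le> (W (y t) - W (y 0)) / (t - 0)" if t: "0 < t" "t < \<tau>" "t < d" for t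
  proof -
    have le: "running_cost (y s) v \<le> b" if "s \<in> {0..<t}" for s
    proof -
      have "dist (running_cost (y s) v) (running_cost (y 0) v) < e / 2"
        by (rule d(2)) (use that t in auto)
      then show ?thesis unfolding b_def y0 dist_real_def by linarith
    qed
    have y\<Omega>: "y t \<in> \<Omega>" using y_in[of t] t r(2) by auto
    have "W x \<le> b * t + (W (y t) + e / 2 * t)"
    proof -
      have pos: "0 < W (y t) + e / 2 * t" using W(2)[OF y\<Omega>] e t by (simp add: add_nonneg_pos)
      obtain w where w: "w \<in> Linf_controls" "J (y t) w < ennreal (W (y t) + e / 2 * t)"
        by (rule opt_value_near_optimal[OF W(1)[OF y\<Omega>] _ pos]) (use e t that in simp_all)
      have "ennreal (W x) \<le> ennreal (b * t) + J (y t) w"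
        using opt_value_constant_control_le[OF sol t(1) _ le w(1)] t W(1)[OF \<Omega>(2)] by simp
      also have "\<dots> \<le> ennreal (b * t) + ennreal (W (y t) + e / 2 * t)"
        using w(2) by (intro add_left_mono) simp
      also have "\<dots> = ennreal (b * t + (W (y t) + e / 2 * t))"
        using b0 t pos by (intro ennreal_plus[symmetric]) auto
      finally have "ennreal (W x) \<le> ennreal (b * t + (W (y t) + e / 2 * t))" .
      moreover have "0 \<le> b * t + (W (y t) + e / 2 * t)"
        by (rule add_nonneg_nonneg) (use b0 t pos in auto)
      ultimately show ?thesis by (simp only: ennreal_le_iff)
    qed
    then have "(- e - running_cost x v) * t \<le> W (y t) - W x" by (simp add: b_def algebra_simps)
    then show ?thesis using t by (simp add: y0 pos_le_divide_eq)
  qed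
  have "((\<lambda>s. W (y s)) has_vector_derivative p \<bullet> dyn (y 0) v) (at 0 within {0..\<tau>})"
    using D der[of 0] \<tau> by (intro GDERIV_along_curve) (auto simp: y0)
  then have "((\<lambda>s. W (y s)) has_field_derivative p \<bullet> dyn x v) (at 0 within {0..\<tau>})"
    by (simp add: has_real_derivative_iff_has_vector_derivative y0)
  then have lim: "((\<lambda>t. (W (y t) - W (y 0)) / (t - 0)) \<longlongrightarrow> p \<bullet> dyn x v) (at_right 0)"
    unfolding has_field_derivative_iff at_within_Icc_at_right[OF \<tau>] .
  have "\<forall>\<^sub>F t in at_right 0. - e - running_cost x v \<le> (W (y t) - W (y 0)) / (t - 0)"
    unfolding eventually_at_right_field using quot \<tau> d(1) by (intro exI[of _ "min \<tau> d"]) auto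
  then have "- e - running_cost x v \<le> p \<bullet> dyn x v"
    using lim by (intro tendsto_lowerbound) auto
  then show "0 \<le> p \<bullet> dyn x v + running_cost x v + e" by simp
qed

text \<open>Near-optimal controls have uniformly bounded energy, so their trajectories stay near
  \<open>x\<close> for a uniform time; there the cost would exceed \<open>W x\<close> by a fixed amount.\<close>

lemma hjb_not_pos:
  assumes r: "0 < r" "cball x r \<subseteq> \<Omega>"
    and W: "\<And>z. z \<in> \<Omega> \<Longrightarrow> opt z = ennreal (W z)" "\<And>z. z \<in> \<Omega> \<Longrightarrow> 0 \<le> W z"
    and D: "\<And>z. z \<in> \<Omega> \<Longrightarrow> GDERIV W z :> G z" "continuous_on \<Omega> G"
    and \<eta>: "0 < \<eta>" "\<And>z v. z \<in> cball x r \<Longrightarrow> \<eta> \<le> G z \<bullet> dyn z v + running_cost z v"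
  shows False
proof -
  obtain A where A: "0 \<le> A" "\<And>z. z \<in> cball x r \<Longrightarrow> norm (f z) \<le> A"
    by (rule continuous_on_cball_bound[OF continuous_on_subset[OF C1_imp_continuous_on[OF f_C1] subset_UNIV]]) (rule that; assumption)
  obtain C where C: "0 \<le> C" "\<And>z. z \<in> cball x r \<Longrightarrow> norm (g z) \<le> C"
    by (rule continuous_on_cball_bound[OF continuous_on_subset[OF C1_imp_continuous_on[OF g_C1] subset_UNIV]]) (rule that; assumption)
  obtain B where B: "0 \<le> B" "\<And>z. z \<in> cball x r \<Longrightarrow> norm (G z) \<le> B"
    by (rule continuous_on_cball_bound[OF continuous_on_subset[OF D(2) r(2)]]) (rule that; assumption)
  obtain c where c: "0 < c" "\<And>v. c * (norm v)\<^sup>2 \<le> v \<bullet> (R *v v)" using quadratic_coercive by blast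
  have x\<Omega>: "x \<in> \<Omega>" using r by auto
  \<comment> \<open>A bound for the cost of every control used below, since their optimality gap is
    at most 1.\<close>
  define K where "K = W x + 1"
  have K: "0 < K" using W(2)[OF x\<Omega>] by (simp add: K_def)
  \<comment> \<open>Chosen so that \<open>b * K = (r / 4) * (C / (C + 1))\<close>: the part of the
    displacement paid for by the cost stays below \<open>r / 4\<close>.\<close>
  define \<kappa> where "\<kappa> = c * r / (4 * (C + 1) * K)"
  have \<kappa>: "0 < \<kappa>" using c(1) r(1) C(1) K by (simp add: \<kappa>_def)
  define a where "a = A + C / \<kappa>"
  define b where "b = C * \<kappa> / c"
  have a: "0 \<le> a" using A(1) C(1) \<kappa> by (simp add: a_def)
  have b: "0 \<le> b" using C(1) \<kappa> c(1) by (simp add: b_def)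
  have bK: "b * K \<le> r / 4"
  proof -
    have key: "C * (c * r / (4 * P * K)) / c * K = (r / 4) * (C / P)" if "0 < P" for P
      using that c(1) K by (simp add: field_simps)
    have "b * K = (r / 4) * (C / (C + 1))" unfolding b_def \<kappa>_def by (rule key) (use C(1) in simp)
    also have "\<dots> \<le> (r / 4) * 1" using r(1) C(1) by (intro mult_left_mono) auto
    finally show ?thesis by simp
  qed
  \<comment> \<open>The speed is affine in the running cost. Integrated, it bounds the displacement
    by elapsed time and accumulated cost, without any pointwise bound on the control.\<close>
  have speed: "norm (dyn z v) \<le> a + b * running_cost z v" if z: "z \<in> cball x r" for z v
  proof -
    have "norm (dyn z v) \<le> norm (f z) + norm (g z *v v)" by (rule norm_triangle_ineq)
    also have "\<dots> \<le> A + norm (g z) * norm v" by (intro add_mono A(2) z norm_matrix_vector_le)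
    also have "\<dots> \<le> A + C * norm v" using C(2)[OF z] by (intro add_left_mono mult_right_mono) auto
    also have "\<dots> \<le> A + C * (1 / \<kappa> + \<kappa> * (norm v)\<^sup>2)"
      by (intro add_left_mono mult_left_mono le_inverse_plus_square \<kappa> C(1)) simp
    also have "\<dots> = a + b * (c * (norm v)\<^sup>2)" using c(1) by (simp add: a_def b_def algebra_simps)
    also have "\<dots> \<le> a + b * running_cost z v"
      using c(2)[of v] h_nonneg[of z] by (intro add_left_mono mult_left_mono b) simp
    finally show ?thesis .
  qed
  \<comment> \<open>The time is fixed before the control is selected: the drift contributes at most
    \<open>r / 4\<close>, which with the cost part gives displacement below
    \<open>r\<close>.\<close>
  define t where "t = min 1 (r / (4 * (a + 1)))"
  have t: "0 < t" "t \<le> 1" using r(1) a by (auto simp: t_def)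
  have at: "a * t \<le> r / 4"
  proof -
    have "a * t \<le> a * (r / (4 * (a + 1)))" using a by (intro mult_left_mono) (auto simp: t_def)
    also have "\<dots> \<le> r / 4" using a r(1) by (simp add: field_simps)
    finally show ?thesis .
  qed
  \<comment> \<open>The control will be optimal up to \<open>m * t\<close>. This is at most half of
    the gain \<open>\<eta> * t\<close> that contradicts it, and at most 1 as the choice of
    \<open>K\<close> demands.\<close>
  define m where "m = min 1 (\<eta> / 2)"
  have m: "0 < m" "m \<le> 1" "m \<le> \<eta> / 2" using \<eta>(1) by (auto simp: m_def)
  have mt: "0 < m * t" "m * t \<le> 1" using m t by (auto intro: mult_le_one)
  obtain u where u: "u \<in> Linf_controls" "J x u < ennreal (W x + m * t)"
    by (rule opt_value_near_optimal[OF W(1)[OF x\<Omega>], of "W x + m * t"])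
      (use mt W(2)[OF x\<Omega>] that in \<open>auto intro: add_nonneg_pos\<close>)
  have fin: "J x u < \<infinity>" using u(2) by (rule less_trans) simp
  then have "existence_time f g u x = \<infinity>" by (simp add: cost_def split: if_splits)
  then obtain T y where y: "sol u x T y" "ereal t < T" unfolding existence_time_infinite_iff by blast
  have y0: "y 0 = x" by (rule sol_initial[OF y(1)])
  let ?q = "\<lambda>s. running_cost (y s) (u s)"
  have split: "\<exists>c\<ge>0. (?q has_integral c) {0..s} \<and> c < W x + m * t \<and>
      J x u = ennreal c + J (y s) (\<lambda>\<tau>. u (\<tau> + s))" if s: "0 < s" "s \<le> t" for s
  proof -
    have "ereal s \<le> ereal t" using s by simp
    then have "ereal s < T" using y(2) by (rule le_less_trans)
    from cost_split_real[OF u(1) y(1) s(1) this fin] obtain c where cs: "0 \<le> c" "(?q has_integral c) {0..s}"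
      "J x u = ennreal c + J (y s) (\<lambda>\<tau>. u (\<tau> + s))" by blast
    have "ennreal c \<le> J x u" unfolding cs(3) by simp
    then have "ennreal c < ennreal (W x + m * t)" using u(2) by (rule le_less_trans)
    then have "c < W x + m * t" using cs(1) by (simp add: ennreal_less_iff)
    then show ?thesis using cs by blast
  qed
  have y_cont: "continuous_on {0..t} y" using sol_continuous[OF y(1) _ y(2)] t(1) by simp
  have inball: "y s \<in> cball x r" if "s \<in> {0..t}" for s
  proof (rule first_exit[OF y_cont y0 r(1) _ that])
    fix s assume s: "0 < s" "s \<le> t" and inb: "\<And>s'. s' \<in> {0..s} \<Longrightarrow> y s' \<in> cball x r"
    have "ereal s \<le> ereal t" using s by simp
    then have sT: "ereal s < T" using y(2) by (rule le_less_trans)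
    obtain c' where c': "0 \<le> c'" "(?q has_integral c') {0..s}" "c' < W x + m * t" using split[OF s] by blast
    have "((\<lambda>\<tau>. dyn (y \<tau>) (u \<tau>)) has_integral (y s - y 0)) {0..s}"
      by (rule sol_has_integral[OF y(1) _ _ sT]) (use s in auto)
    moreover have "((\<lambda>\<tau>. a + b * ?q \<tau>) has_integral (a * s + b * c')) {0..s}"
      using has_integral_add[OF has_integral_const_real[of a 0 s] has_integral_mult_right[OF c'(2), of b]] s
      by (simp add: mult.commute)
    ultimately have "norm (y s - y 0) \<le> a * s + b * c'"
      using integral_norm_bound_integral[of "\<lambda>\<tau>. dyn (y \<tau>) (u \<tau>)" "{0..s}" "\<lambda>\<tau>. a + b * ?q \<tau>"] speed[OF inb]
      by (auto simp: has_integral_iff)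
    also have "\<dots> \<le> a * t + b * K"
      using s c'(3) mt a b by (intro add_mono mult_left_mono) (auto simp: K_def)
    also have "\<dots> < r" using at bK r(1) by simp
    finally show "dist x (y s) < r" by (simp add: y0 dist_norm norm_minus_commute)
  qed
  have in\<Omega>: "y s \<in> \<Omega>" if "s \<in> {0..t}" for s using inball[OF that] r(2) by blast
  obtain N where N: "negligible N"
    "\<And>t. 0 < t \<Longrightarrow> ereal t < T \<Longrightarrow> t \<notin> N \<Longrightarrow> solves_at y u t"
    by (rule sol_derivative[OF y(1)]) (rule that; assumption)
  have W_int: "((\<lambda>s. G (y s) \<bullet> dyn (y s) (u s)) has_integral (W (y t) - W (y 0))) {0..t}"
  proof (rule fundamental_theorem_absolutely_continuous)
    show "0 \<le> t" "negligible (insert 0 N)" using t(1) N(1) by auto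
    obtain L where L: "L-lipschitz_on {0..t} y" using sol_Lipschitz[OF y(1) u(1) _ y(2)] t(1) by auto
    have "B-lipschitz_on (cball x r) W"
      by (rule gradient_bounded_imp_Lipschitz[OF convex_cball D(1) B(2,1)]) (use r(2) in auto)
    then have "B-lipschitz_on (y ` {0..t}) W" by (rule lipschitz_on_subset) (use inball in blast)
    from lipschitz_on_compose2[OF L this] show "abs_continuous_on_Icc 0 t (\<lambda>s. W (y s))"
      by (rule Lipschitz_imp_abs_continuous)
    fix s assume s: "s \<in> {0..t} - insert 0 N"
    then have "ereal s \<le> ereal t" by simp
    then have "ereal s < T" using y(2) by (rule le_less_trans)
    then have "solves_at y u s" using N(2)[of s] s by simp
    from has_vector_derivative_at_within[OF GDERIV_along_curve[OF D(1)[OF in\<Omega>] this]]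
    show "((\<lambda>s. W (y s)) has_vector_derivative G (y s) \<bullet> dyn (y s) (u s)) (at s within {0..t})"
      using s by simp
  qed
  obtain c' where c': "0 \<le> c'" "(?q has_integral c') {0..t}"
    "J x u = ennreal c' + J (y t) (\<lambda>\<tau>. u (\<tau> + t))" using split[OF t(1)] by blast
  \<comment> \<open>Integrating the strict inequality along the trajectory says that cost so far
    plus remaining optimal value exceeds \<open>W x\<close> by at least \<open>\<eta> * t\<close>;
    near-optimality allows an excess below half of that.\<close>
  have "\<eta> * t \<le> W (y t) - W (y 0) + c'"
  proof (rule has_integral_le)
    show "((\<lambda>s. \<eta>) has_integral \<eta> * t) {0..t}"
      using has_integral_const_real[of \<eta> 0 t] t(1) by (simp add: mult.commute)
    show "((\<lambda>s. G (y s) \<bullet> dyn (y s) (u s) + ?q s) has_integral (W (y t) - W (y 0) + c')) {0..t}"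
      by (rule has_integral_add[OF W_int c'(2)])
    show "\<eta> \<le> G (y s) \<bullet> dyn (y s) (u s) + ?q s" if "s \<in> {0..t}" for s
      by (rule \<eta>(2)[OF inball[OF that]])
  qed
  moreover have "c' + W (y t) < W x + m * t"
  proof -
    have yt: "y t \<in> \<Omega>" using in\<Omega>[of t] t(1) by simp
    have "ennreal (c' + W (y t)) = ennreal c' + opt (y t)"
      using c'(1) W[OF yt] by simp
    also have "\<dots> \<le> J x u"
      unfolding c'(3) using t(1) by (intro add_left_mono opt_value_le Linf_controls_shift[OF u(1)]) simp
    also have "\<dots> < ennreal (W x + m * t)" by (rule u(2))
    finally have "ennreal (c' + W (y t)) < ennreal (W x + m * t)" .
    moreover have "0 \<le> c' + W (y t)" using c'(1) W(2)[OF yt] by simp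
    ultimately show ?thesis by (simp only: ennreal_less_iff)
  qed
  moreover have "m * t \<le> (\<eta> / 2) * t" using m(3) t(1) by (intro mult_right_mono) auto
  moreover have "0 < \<eta> * t" using \<eta>(1) t(1) by simp
  ultimately show False by (simp add: y0)
qed

text \<open>The residual takes a vector field instead of a function, so that it can be evaluated at
  pointwise limits of gradients before these are known to be a gradient.\<close>

definition hjb :: "(real^'n \<Rightarrow> real^'n) \<Rightarrow> real^'n \<Rightarrow> real" where
  "hjb G z = f z \<bullet> G z - 1/4 * (weighted_norm (matrix_inv R) (transpose (g z) *v G z))\<^sup>2 + h z"

text \<open>The minimiser over \<open>v\<close> of \<open>G z \<bullet> (g z *v v) + v \<bullet> (R *v v)\<close>, whose minimum enters \<open>hjb\<close>.\<close>

definition feedback :: "(real^'n \<Rightarrow> real^'n) \<Rightarrow> real^'n \<Rightarrow> real^'m" where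
  "feedback G z = (-1/2) *\<^sub>R (matrix_inv R *v (transpose (g z) *v G z))"

lemma hjb_le: "hjb G z \<le> G z \<bullet> dyn z v + running_cost z v"
  using square_le[OF R, of "g z" "G z" v] by (simp add: hjb_def inner_add_right inner_commute)

lemma hjb_feedback: "G z \<bullet> dyn z (feedback G z) + running_cost z (feedback G z) = hjb G z"
  using square_eq[OF R, of "G z" "g z"] by (simp add: hjb_def feedback_def inner_add_right inner_commute del: transpose_matrix_vector)

lemma continuous_on_hjb:
  assumes "continuous_on S G"
  shows "continuous_on S (hjb G)"
proof -
  have "continuous_on S h" using C1_imp_continuous_on[OF h_C1] continuous_on_subset by blast
  moreover have "continuous_on S f" "continuous_on S g"
    using C1_imp_continuous_on[OF f_C1] C1_imp_continuous_on[OF g_C1] continuous_on_subset by blast+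
  ultimately show ?thesis
    unfolding hjb_def weighted_norm_inv[OF R] using assms
    by (intro continuous_intros continuous_on_transpose)
qed

text \<open>The constant control equal to the feedback value at \<open>x\<close> gives
  nonnegativity. If the residual were positive, continuity would keep it above half its value on a
  ball, and there \<open>hjb_le\<close> bounds the expression below for all controls, which
  \<open>hjb_not_pos\<close> excludes.\<close>

lemma hjb_opt_value:
  assumes \<Omega>: "open \<Omega>" "x \<in> \<Omega>"
    and W: "\<And>z. z \<in> \<Omega> \<Longrightarrow> opt z = ennreal (W z)" "\<And>z. z \<in> \<Omega> \<Longrightarrow> 0 \<le> W z"
    and D: "\<And>z. z \<in> \<Omega> \<Longrightarrow> GDERIV W z :> G z" "continuous_on \<Omega> G"
  shows "hjb G x = 0"
proof (rule ccontr)
  assume ne: "hjb G x \<noteq> 0"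
  have "0 \<le> hjb G x"
    using hjb_nonneg[OF \<Omega> W D(1)[OF \<Omega>(2)], of "feedback G x"] hjb_feedback[of G x] by simp
  with ne have pos: "0 < hjb G x" by simp
  have "open ((hjb G -` {hjb G x / 2<..}) \<inter> \<Omega>)"
    using continuous_on_hjb[OF D(2)] \<Omega>(1) by (simp add: continuous_on_open_vimage)
  moreover have "x \<in> (hjb G -` {hjb G x / 2<..}) \<inter> \<Omega>" using pos \<Omega>(2) by simp
  ultimately obtain r where r: "0 < r" "cball x r \<subseteq> (hjb G -` {hjb G x / 2<..}) \<inter> \<Omega>"
    using open_contains_cball by blast
  have "hjb G x / 2 \<le> G z \<bullet> dyn z v + running_cost z v" if "z \<in> cball x r" for z v
  proof -
    have "hjb G x / 2 < hjb G z" using r(2) that by auto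
    then show ?thesis using hjb_le[of G z v] by simp
  qed
  then show False using hjb_not_pos[of r x \<Omega> W G "hjb G x / 2"] r W D pos by auto
qed

text \<open>Along the feedback direction of \<open>V\<close>, \<open>V\<close> strictly decreases while \<open>W - (1 + \<epsilon>) V\<close> strictly
  increases; hence a maximiser of the latter over a sublevel set of \<open>V\<close> can only be the origin.\<close>

lemma comparison:
  assumes h_pos: "\<And>z. z \<noteq> 0 \<Longrightarrow> 0 < h z"
    and r: "cball 0 r \<subseteq> \<Omega>" and \<alpha>: "0 < \<alpha>"
    and V: "\<And>z. z \<in> \<Omega> \<Longrightarrow> GDERIV V z :> GV z" "\<And>z. z \<in> \<Omega> \<Longrightarrow> hjb GV z = 0"
      "\<And>z. z \<in> \<Omega> \<Longrightarrow> \<alpha> * (norm z)\<^sup>2 \<le> V z" "V 0 = 0"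
    and W: "\<And>z. z \<in> \<Omega> \<Longrightarrow> GDERIV W z :> GW z" "\<And>z. z \<in> \<Omega> \<Longrightarrow> hjb GW z = 0" "W 0 = 0"
    and z0: "z0 \<in> cball 0 r" "V z0 < \<alpha> * r\<^sup>2"
  shows "W z0 \<le> V z0"
proof -
  have r0: "0 \<le> r" using z0(1) norm_ge_zero[of z0] by (simp del: norm_ge_zero)
  define K where "K = {z \<in> cball 0 r. V z \<le> V z0}"
  have cont: "continuous_on (cball 0 r) V" "continuous_on (cball 0 r) W"
    by (rule GDERIV_continuous_on; use V(1) W(1) r in blast)+
  have "K = cball 0 r \<inter> V -` {..V z0}" by (auto simp: K_def)
  then have "closed K" using continuous_closed_preimage[OF cont(1), of "{..V z0}"] by simp
  moreover have "bounded K" by (rule bounded_subset[of "cball 0 r"]) (auto simp: K_def)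
  ultimately have "compact K" by (simp add: compact_eq_bounded_closed)
  have "z0 \<in> K" using z0 by (simp add: K_def)
  have bound: "W z0 \<le> (1 + \<epsilon>) * V z0" if \<epsilon>: "0 < \<epsilon>" for \<epsilon>
  proof -
    define \<phi> where "\<phi> z = W z - (1 + \<epsilon>) * V z" for z
    have "continuous_on K \<phi>"
      unfolding \<phi>_def by (intro continuous_intros; rule continuous_on_subset[OF cont(1)] continuous_on_subset[OF cont(2)]) (auto simp: K_def)
    then obtain z1 where z1: "z1 \<in> K" "\<And>z. z \<in> K \<Longrightarrow> \<phi> z \<le> \<phi> z1"
      using continuous_attains_sup[OF \<open>compact K\<close>] \<open>z0 \<in> K\<close> by blast
    have z1': "z1 \<in> cball 0 r" "V z1 \<le> V z0" using z1(1) by (auto simp: K_def)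
    have z1\<Omega>: "z1 \<in> \<Omega>" using z1'(1) r by blast
    have "z1 = 0"
    proof (rule ccontr)
      assume "z1 \<noteq> 0"
      define v where "v = feedback GV z1"
      define d where "d = dyn z1 v"
      have rc: "0 < running_cost z1 v" using h_pos[OF \<open>z1 \<noteq> 0\<close>] quadratic_nonneg[of v] by simp
      have dV: "GV z1 \<bullet> d = - running_cost z1 v"
        using hjb_feedback[of GV z1] V(2)[OF z1\<Omega>] by (simp add: d_def v_def)
      have dW: "- running_cost z1 v \<le> GW z1 \<bullet> d"
        using hjb_le[of GW z1 v] W(2)[OF z1\<Omega>] by (simp add: d_def)
      have line: "((\<lambda>t. z1 + t *\<^sub>R d) has_vector_derivative d) (at 0)"
        by (auto intro!: derivative_eq_intros)
      have V': "DERIV (\<lambda>t. V (z1 + t *\<^sub>R d)) 0 :> GV z1 \<bullet> d"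
        using GDERIV_along_curve[of V "\<lambda>t. z1 + t *\<^sub>R d" 0 "GV z1", OF _ line] V(1)[OF z1\<Omega>]
        by (simp add: has_real_derivative_iff_has_vector_derivative)
      have W': "DERIV (\<lambda>t. W (z1 + t *\<^sub>R d)) 0 :> GW z1 \<bullet> d"
        using GDERIV_along_curve[of W "\<lambda>t. z1 + t *\<^sub>R d" 0 "GW z1", OF _ line] W(1)[OF z1\<Omega>]
        by (simp add: has_real_derivative_iff_has_vector_derivative)
      have d\<phi>: "DERIV (\<lambda>t. \<phi> (z1 + t *\<^sub>R d)) 0 :> GW z1 \<bullet> d - (1 + \<epsilon>) * (GV z1 \<bullet> d)"
        unfolding \<phi>_def using V' W' by (auto intro!: derivative_eq_intros)
      have "0 < GW z1 \<bullet> d - (1 + \<epsilon>) * (- \<rho>)" if "- \<rho> \<le> GW z1 \<bullet> d" "0 < \<rho>" for \<rho>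
        using that(1) mult_pos_pos[OF \<epsilon> that(2)] by (simp add: algebra_simps)
      from this[OF dW rc] have "0 < GW z1 \<bullet> d - (1 + \<epsilon>) * (GV z1 \<bullet> d)" unfolding dV .
      from DERIV_pos_inc_right[OF d\<phi> this]
      obtain e1 where e1: "0 < e1" "\<And>t. 0 < t \<Longrightarrow> t < e1 \<Longrightarrow> \<phi> z1 < \<phi> (z1 + t *\<^sub>R d)" by auto
      obtain e2 where e2: "0 < e2" "\<And>t. 0 < t \<Longrightarrow> t < e2 \<Longrightarrow> V (z1 + t *\<^sub>R d) < V z1"
        using DERIV_neg_dec_right[OF V'] dV rc by auto
      \<comment> \<open>The lower bound on \<open>V\<close> and the level
        \<open>V z0 < \<alpha> * r\<^sup>2\<close> keep the maximiser off the boundary sphere, so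
        there is room for a step along \<open>d\<close>.\<close>
      have "\<alpha> * (norm z1)\<^sup>2 < \<alpha> * r\<^sup>2" using V(3)[OF z1\<Omega>] z1'(2) z0(2) by simp
      then have "(norm z1)\<^sup>2 < r\<^sup>2" using \<alpha> by simp
      then have less_r: "norm z1 < r" using r0 by (rule power2_less_imp_less)
      \<comment> \<open>A step short enough to increase \<phi>, to decrease \<open>V\<close>, and to
        remain in the ball; the last two keep the new point in \<open>K\<close>.\<close>
      define t where "t = min (min (e1 / 2) (e2 / 2)) ((r - norm z1) / (norm d + 1))"
      have t: "0 < t" "t < e1" "t < e2" using e1(1) e2(1) less_r by (auto simp: t_def min_less_iff_disj add_nonneg_pos)
      have "t * norm d \<le> (r - norm z1) / (norm d + 1) * norm d"
        by (intro mult_right_mono) (auto simp: t_def)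
      also have "\<dots> = (r - norm z1) * (norm d / (norm d + 1))" by simp
      also have "\<dots> \<le> (r - norm z1) * 1"
        using less_r by (intro mult_left_mono) (simp_all add: divide_le_eq add_nonneg_pos)
      finally have "norm (z1 + t *\<^sub>R d) \<le> r" using norm_triangle_ineq[of z1 "t *\<^sub>R d"] t(1) by simp
      then have "z1 + t *\<^sub>R d \<in> K" using e2(2)[OF t(1,3)] z1'(2) by (simp add: K_def)
      then show False using z1(2) e1(2)[OF t(1,2)] by fastforce
    qed
    then show ?thesis using z1(2)[OF \<open>z0 \<in> K\<close>] V(4) W(3) by (simp add: \<phi>_def)
  qed
  show ?thesis
  proof (rule field_le_epsilon)
    fix e :: real assume e: "0 < e"
    have "z0 \<in> \<Omega>" using z0(1) r by blast
    then have V0: "0 \<le> V z0" using V(3)[of z0] \<alpha> by (meson mult_nonneg_nonneg less_imp_le order_trans zero_le_power2)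
    \<comment> \<open>With \<epsilon> scaled by \<open>V z0 + 1\<close> the excess
      \<open>\<epsilon> * V z0\<close> is at most \<open>e\<close>, also when
      \<open>V z0 = 0\<close>.\<close>
    have "W z0 \<le> (1 + e / (V z0 + 1)) * V z0" using e V0 by (intro bound) simp
    also have "\<dots> \<le> V z0 + e" using e V0 by (simp add: field_simps)
    finally show "W z0 \<le> V z0 + e" .
  qed
qed

end

section \<open>Convergence of the minimizers\<close>

lemma norm_midpoint_le:
  fixes a b c :: "'b::real_normed_vector"
  assumes "norm (a - c) \<le> e" "norm (b - c) \<le> e"
  shows "norm ((1/2) *\<^sub>R a + (1/2) *\<^sub>R b - c) \<le> e"
proof -
  have "(1/2) *\<^sub>R a + (1/2) *\<^sub>R b - c = (1/2) *\<^sub>R (a - c) + (1/2) *\<^sub>R (b - c)"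
    by (simp add: algebra_simps flip: scaleR_left.add)
  then have "norm ((1/2) *\<^sub>R a + (1/2) *\<^sub>R b - c) \<le> norm ((1/2) *\<^sub>R (a - c)) + norm ((1/2) *\<^sub>R (b - c))"
    by (metis norm_triangle_ineq)
  then show ?thesis using assms by simp
qed

context rkhs_C2
begin

lemma gradient_midpoint:
  assumes "v \<in> H" "w \<in> H" "x \<in> D"
  shows "gradient (\<lambda>x. (1/2) * v x + (1/2) * w x) x = (1/2) *\<^sub>R gradient v x + (1/2) *\<^sub>R gradient w x"
proof (rule gradient_eqI)
  have "GDERIV (\<lambda>x. (1/2) * v x) x :> (1/2) *\<^sub>R gradient v x" if "v \<in> H" for v
    using GDERIV_mult[OF GDERIV_const[of "1/2"] GDERIV_gradient[OF that assms(3)]] by simp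
  then show "GDERIV (\<lambda>x. (1/2) * v x + (1/2) * w x) x :> (1/2) *\<^sub>R gradient v x + (1/2) *\<^sub>R gradient w x"
    using assms by (intro GDERIV_add)
qed

text \<open>Weak compactness is replaced by the parallelogram law: \<open>C m\<close> is a midpoint-convex set containing the
  tail of \<open>w\<close>, and almost minimal elements \<open>z m\<close> of \<open>C m\<close> converge in norm to an element \<open>u\<close> with the
  prescribed values and gradients on \<open>E\<close>. Minimality of the \<open>w n\<close> against \<open>u\<close> then makes \<open>w n\<close> itself
  almost minimal in \<open>C n\<close>.\<close>

lemma minimizers_converge:
  assumes E: "E \<subseteq> D" and w: "\<And>n. w n \<in> H" "\<And>n. sqn (w n) \<le> B"
    and lim: "\<And>x. x \<in> E \<Longrightarrow> (\<lambda>n::nat. w n x) \<longlonglongrightarrow> l x" "\<And>x. x \<in> E \<Longrightarrow> (\<lambda>n. gradient (w n) x) \<longlonglongrightarrow> l' x"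
    and min: "\<And>u n. u \<in> H \<Longrightarrow> (\<And>x. x \<in> E \<Longrightarrow> u x = l x \<and> gradient u x = l' x) \<Longrightarrow> sqn (w n) \<le> sqn u"
  obtains u where "u \<in> H" "tends_to w u"
proof -
  \<comment> \<open>A member of \<open>C m\<close> deviates from the limit data, at each point of
    \<open>E\<close>, by no more than any common bound for the tail of \<open>w\<close> from
    \<open>m\<close> on. Such conditions survive midpoints, and they shrink to the exact data as
    \<open>m\<close> grows.\<close>
  define C where "C m = {u \<in> H. \<forall>x\<in>E. \<forall>e. (\<forall>n\<ge>m. norm (w n x - l x) \<le> e \<and> norm (gradient (w n) x - l' x) \<le> e) \<longrightarrow>
      norm (u x - l x) \<le> e \<and> norm (gradient u x - l' x) \<le> e}" for m
  have CH: "C m \<subseteq> H" for m by (auto simp: C_def)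
  have wC: "w n \<in> C m" if "m \<le> n" for m n using w(1) that by (auto simp: C_def)
  have dec: "decseq C"
    unfolding decseq_def
  proof (intro allI impI subsetI)
    fix m n u assume mn: "m \<le> n" and u: "u \<in> C n"
    show "u \<in> C m" unfolding C_def mem_Collect_eq
    proof (intro conjI ballI allI impI)
      show "u \<in> H" using u CH by blast
      fix x e assume "x \<in> E" and *: "\<forall>n\<ge>m. norm (w n x - l x) \<le> e \<and> norm (gradient (w n) x - l' x) \<le> e"
      moreover have "\<forall>i\<ge>n. norm (w i x - l x) \<le> e \<and> norm (gradient (w i) x - l' x) \<le> e"
        using * mn by simp
      ultimately show "norm (u x - l x) \<le> e" "norm (gradient u x - l' x) \<le> e"
        using u unfolding C_def by simp_all
    qed
  qed
  have mid: "(\<lambda>x. (1/2) * a x + (1/2) * b x) \<in> C m" if ab: "a \<in> C m" "b \<in> C m" for a b m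
  proof -
    have abH: "a \<in> H" "b \<in> H" using ab CH by blast+
    have "(\<lambda>x. (1/2) * a x + (1/2) * b x) \<in> H" using add_in[OF scale_in[OF abH(1)] scale_in[OF abH(2)]] .
    moreover have "norm ((1/2) * a x + (1/2) * b x - l x) \<le> e \<and>
        norm (gradient (\<lambda>x. (1/2) * a x + (1/2) * b x) x - l' x) \<le> e"
      if x: "x \<in> E" and e: "\<forall>n\<ge>m. norm (w n x - l x) \<le> e \<and> norm (gradient (w n) x - l' x) \<le> e" for x e
    proof
      have a: "norm (a x - l x) \<le> e" "norm (gradient a x - l' x) \<le> e"
        and b: "norm (b x - l x) \<le> e" "norm (gradient b x - l' x) \<le> e"
        using ab x e unfolding C_def by simp_all
      show "norm ((1/2) * a x + (1/2) * b x - l x) \<le> e"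
        using norm_midpoint_le[OF a(1) b(1)] by simp
      have "x \<in> D" using x E by blast
      show "norm (gradient (\<lambda>x. (1/2) * a x + (1/2) * b x) x - l' x) \<le> e"
        unfolding gradient_midpoint[OF abH \<open>x \<in> D\<close>] by (rule norm_midpoint_le[OF a(2) b(2)])
    qed
    ultimately show ?thesis unfolding C_def by simp
  qed
  define d where "d m = Inf (sqn ` C m)" for m
  have bdd: "bdd_below (sqn ` C m)" for m
    using CH sqn_nonneg by (intro bdd_belowI2[of _ 0]) blast
  have d_le: "d m \<le> sqn v" if "v \<in> C m" for m v
    unfolding d_def by (rule cInf_lower[OF imageI[OF that] bdd])
  have ne: "C m \<noteq> {}" for m using wC[of m m] by auto
  have "d m \<le> d n" if "m \<le> n" for m n
    unfolding d_def using dec that ne bdd by (intro cInf_superset_mono image_mono) (auto simp: decseq_def)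
  then have "incseq d" by (simp add: incseq_def)
  moreover have "d n \<le> B" for n using d_le[OF wC[of n n]] w(2)[of n] by simp
  ultimately obtain e where e: "d \<longlonglongrightarrow> e" "\<And>n. d n \<le> e"
    using incseq_convergent[of d B] by auto
  have "\<exists>v\<in>C m. sqn v < d m + 1 / real (Suc m)" for m
    using cInf_lessD[of "sqn ` C m" "d m + 1 / real (Suc m)"] ne by (auto simp: d_def)
  then obtain z where z: "\<And>m. z m \<in> C m" "\<And>m. sqn (z m) < d m + 1 / real (Suc m)" by metis
  have lim_z: "(\<lambda>m. sqn (z m)) \<longlonglongrightarrow> e"
  proof (rule tendsto_sandwich[OF _ _ e(1)])
    show "(\<lambda>m. d m + 1 / real (Suc m)) \<longlonglongrightarrow> e"
      using tendsto_add[OF e(1) LIMSEQ_inverse_real_of_nat] by (simp add: inverse_eq_divide)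
    show "\<forall>\<^sub>F n in sequentially. d n \<le> sqn (z n)" using d_le[OF z(1)] by simp
    show "\<forall>\<^sub>F n in sequentially. sqn (z n) \<le> d n + 1 / real (Suc n)"
      using less_imp_le[OF z(2)] by (intro always_eventually allI)
  qed
  obtain u where u: "u \<in> H" "tends_to z u" "sqn u = e"
    by (rule almost_minimal_convergent[OF CH dec mid d_le e(1) z(1) lim_z])
  have zH: "z m \<in> H" for m using z(1) CH by blast
  have dev: "\<forall>\<^sub>F m in sequentially. norm (z m x - l x) \<le> \<epsilon> \<and> norm (gradient (z m) x - l' x) \<le> \<epsilon>"
    if x: "x \<in> E" and \<epsilon>: "0 < \<epsilon>" for x \<epsilon>
  proof -
    have "\<forall>\<^sub>F n in sequentially. dist (w n x) (l x) < \<epsilon> \<and> dist (gradient (w n) x) (l' x) < \<epsilon>"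
      using tendstoD[OF lim(1)[OF x] \<epsilon>] tendstoD[OF lim(2)[OF x] \<epsilon>] by eventually_elim simp
    then obtain N where N: "\<And>n. n \<ge> N \<Longrightarrow> dist (w n x) (l x) < \<epsilon> \<and> dist (gradient (w n) x) (l' x) < \<epsilon>"
      by (auto simp: eventually_sequentially)
    have "norm (z m x - l x) \<le> \<epsilon> \<and> norm (gradient (z m) x - l' x) \<le> \<epsilon>" if "m \<ge> N" for m
    proof -
      have "\<forall>n\<ge>m. norm (w n x - l x) \<le> \<epsilon> \<and> norm (gradient (w n) x - l' x) \<le> \<epsilon>"
        using N that by (simp add: dist_norm less_imp_le)
      then show ?thesis using z(1)[of m] x unfolding C_def by simp
    qed
    then show ?thesis by (auto simp: eventually_sequentially)
  qed
  have u_lim: "u x = l x \<and> gradient u x = l' x" if x: "x \<in> E" for x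
  proof -
    have lim_v: "(\<lambda>m. z m x) \<longlonglongrightarrow> l x"
    proof (rule tendstoI)
      fix \<epsilon> :: real assume "0 < \<epsilon>"
      with dev[OF x, of "\<epsilon> / 2"] show "\<forall>\<^sub>F m in sequentially. dist (z m x) (l x) < \<epsilon>"
        by (auto simp: dist_norm elim!: eventually_mono)
    qed
    have lim_g: "(\<lambda>m. gradient (z m) x) \<longlonglongrightarrow> l' x"
    proof (rule tendstoI)
      fix \<epsilon> :: real assume "0 < \<epsilon>"
      with dev[OF x, of "\<epsilon> / 2"] show "\<forall>\<^sub>F m in sequentially. dist (gradient (z m) x) (l' x) < \<epsilon>"
        by (auto simp: dist_norm elim!: eventually_mono)
    qed
    have "x \<in> D" using x E by blast
    then show ?thesis
      using LIMSEQ_unique[OF tendsto_eval[OF zH u(1,2)] lim_v] LIMSEQ_unique[OF tendsto_gradient[OF zH u(1,2)] lim_g]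
      by simp
  qed
  \<comment> \<open>The lower bound is that of \<open>C n\<close>, which contains
    \<open>w n\<close>; the upper bound is minimality against \<open>u\<close>, whose squared norm
    is exactly \<open>e\<close>.\<close>
  have "(\<lambda>n. sqn (w n)) \<longlonglongrightarrow> e"
  proof (rule tendsto_sandwich[OF _ _ e(1) tendsto_const])
    show "\<forall>\<^sub>F n in sequentially. d n \<le> sqn (w n)" using d_le[OF wC[OF order_refl]] by simp
    show "\<forall>\<^sub>F n in sequentially. sqn (w n) \<le> e" using min[OF u(1) u_lim] u(3) by simp
  qed
  from almost_minimal_convergent[OF CH dec mid d_le e(1) wC[OF order_refl] this]
  show ?thesis using that by blast
qed

text \<open>A diagonal selection over the countable set \<open>E\<close>. The selection principle
  needs one bound for all points, whereas evaluation and gradient are bounded only point by point,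
  so the pair is divided by its bound \<open>b x\<close> before and multiplied back
  afterwards.\<close>

lemma convergent_data_subsequence:
  assumes E: "countable E" "E \<subseteq> D" and s: "\<And>n::nat. s n \<in> H" "\<And>n. sqn (s n) \<le> B"
  obtains \<kappa> l l' where "strict_mono (\<kappa> :: nat \<Rightarrow> nat)" "\<And>x. x \<in> E \<Longrightarrow> (\<lambda>n. s (\<kappa> n) x) \<longlonglongrightarrow> l x"
    "\<And>x. x \<in> E \<Longrightarrow> (\<lambda>n. gradient (s (\<kappa> n)) x) \<longlonglongrightarrow> l' x"
proof -
  have "\<exists>b>0. \<forall>n. norm (s n x, gradient (s n) x) \<le> b" if x: "x \<in> D" for x
  proof -
    obtain L where L: "0 \<le> L" "\<forall>v\<in>H. norm (gradient v x) \<le> sqrt (sqn v) * L"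
      using norm_gradient_bound[OF x] by blast
    have kxx: "0 \<le> k x x" using ip_sections[OF x x] ip_nonneg[OF section_in[OF x]] by simp
    have "norm (s n x, gradient (s n) x) \<le> sqrt B * sqrt (k x x) + sqrt B * L + 1" for n
    proof -
      have "sqrt (sqn (s n)) \<le> sqrt B" using s(2) by simp
      then have "sqrt (sqn (s n)) * sqrt (k x x) \<le> sqrt B * sqrt (k x x)" "sqrt (sqn (s n)) * L \<le> sqrt B * L"
        using L(1) kxx by (auto intro: mult_right_mono)
      moreover have "norm (s n x, gradient (s n) x) \<le> norm (s n x) + norm (gradient (s n) x)"
        by (rule norm_Pair_le)
      moreover have "norm (gradient (s n) x) \<le> sqrt (sqn (s n)) * L" using L(2) s(1) by blast
      ultimately show ?thesis using abs_eval_le[OF s(1) x, of n] unfolding real_norm_def by linarith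
    qed
    moreover have "0 \<le> B" using s(2)[of 0] sqn_nonneg[OF s(1)[of 0]] by simp
    ultimately show ?thesis using L(1) kxx
      by (intro exI[of _ "sqrt B * sqrt (k x x) + sqrt B * L + 1"]) (auto intro!: add_nonneg_pos add_nonneg_nonneg)
  qed
  then obtain b where b: "\<And>x. x \<in> D \<Longrightarrow> 0 < b x" "\<And>x n. x \<in> D \<Longrightarrow> norm (s n x, gradient (s n) x) \<le> b x" by metis
  define F where "F n x = (1 / b x) *\<^sub>R (s n x, gradient (s n) x)" for n x
  have "norm (F n x) \<le> 1" if "x \<in> E" for n x
  proof -
    have "x \<in> D" using that E by blast
    then show ?thesis using b[of x] unfolding F_def norm_scaleR by (simp add: field_simps)
  qed
  then obtain \<kappa> where \<kappa>: "strict_mono \<kappa>" "\<And>x. x \<in> E \<Longrightarrow> \<exists>l. (\<lambda>n. F (\<kappa> n) x) \<longlonglongrightarrow> l"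
    using function_convergent_subsequence[OF E(1), of F 1] by blast
  from \<kappa>(2) obtain L where L: "\<And>x. x \<in> E \<Longrightarrow> (\<lambda>n. F (\<kappa> n) x) \<longlonglongrightarrow> L x" by metis
  have "(\<lambda>n. (s (\<kappa> n) x, gradient (s (\<kappa> n)) x)) \<longlonglongrightarrow> b x *\<^sub>R L x" if "x \<in> E" for x
  proof -
    have "b x \<noteq> 0" using b(1)[of x] E that by force
    then show ?thesis using tendsto_scaleR[OF tendsto_const[of "b x"] L[OF that]] by (simp add: F_def)
  qed
  note lim = tendsto_fst[OF this] tendsto_snd[OF this]
  show ?thesis
    by (rule that[OF \<kappa>(1), of "\<lambda>x. fst (b x *\<^sub>R L x)" "\<lambda>x. snd (b x *\<^sub>R L x)"])
      (use lim in auto)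
qed

end

section \<open>Density and subsequence principles, and the assembly of the convergence proof\<close>

lemma closed_on_dense:
  assumes q: "continuous_on \<Omega> q" and \<Omega>: "open \<Omega>" "\<Omega> \<subseteq> closure E" and T: "closed T"
    and E: "\<And>x. x \<in> E \<Longrightarrow> x \<in> \<Omega> \<Longrightarrow> q x \<in> T" and x: "x \<in> \<Omega>"
  shows "q x \<in> T"
proof (rule ccontr)
  assume "q x \<notin> T"
  have op: "open (q -` (- T) \<inter> \<Omega>)"
    using q \<Omega>(1) T by (simp add: continuous_on_open_vimage open_Compl)
  have "x \<in> (q -` (- T) \<inter> \<Omega>) \<inter> closure E" using \<open>q x \<notin> T\<close> x \<Omega>(2) by auto
  then have "(q -` (- T) \<inter> \<Omega>) \<inter> E \<noteq> {}" using open_Int_closure_eq_empty[OF op, of E] by blast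
  then show False using E by auto
qed

lemma LIMSEQ_subseqI:
  fixes a :: "nat \<Rightarrow> real"
  assumes nonneg: "\<And>n. 0 \<le> a n"
    and sub: "\<And>\<sigma>::nat \<Rightarrow> nat. strict_mono \<sigma> \<Longrightarrow> \<exists>\<kappa>::nat \<Rightarrow> nat. (\<lambda>n. a (\<sigma> (\<kappa> n))) \<longlonglongrightarrow> 0"
  shows "a \<longlonglongrightarrow> 0"
proof (rule ccontr)
  assume "\<not> a \<longlonglongrightarrow> 0"
  then obtain e where e: "0 < e" "\<And>N. \<exists>n\<ge>N. e \<le> a n"
    using nonneg unfolding LIMSEQ_iff by (auto simp: not_less)
  then have "infinite {n. e \<le> a n}" unfolding infinite_nat_iff_unbounded_le by auto
  from infinite_enumerate[OF this] obtain \<sigma> :: "nat \<Rightarrow> nat" where \<sigma>: "strict_mono \<sigma>" "\<And>n. e \<le> a (\<sigma> n)" by auto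
  obtain \<kappa> :: "nat \<Rightarrow> nat" where "(\<lambda>n. a (\<sigma> (\<kappa> n))) \<longlonglongrightarrow> 0" using sub[OF \<sigma>(1)] by blast
  then have "e \<le> 0" using \<sigma>(2) by (intro LIMSEQ_le_const) auto
  then show False using e(1) by simp
qed

theorem theorem4p2:
  fixes f :: "real^'n \<Rightarrow> real^'n"
    and g :: "real^'n \<Rightarrow> real^'m^'n"
    and h :: "real^'n \<Rightarrow> real"
    and R :: "real^'m^'m"
    and \<Omega> :: "(real^'n) set"
    and k :: "real^'n \<Rightarrow> real^'n \<Rightarrow> real"
    and X :: "nat \<Rightarrow> (real^'n) set"
    and \<alpha> \<beta> \<alpha>' \<beta>' :: real
  assumes domain: "is_domain \<Omega>" "bounded \<Omega>" "0 \<in> \<Omega>"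
    and data: "standing_data f g h R"
    and quadratic_bounds: "0 < \<alpha>'" "0 < \<beta>'"
      "\<forall>x\<in>\<Omega>. ennreal (\<alpha>' * (norm x)\<^sup>2) \<le> opt_value f g h R x \<and>
             opt_value f g h R x \<le> ennreal (\<beta>' * (norm x)\<^sup>2)"
    and parameters: "0 < \<alpha>" "\<alpha> \<le> \<alpha>'" "\<beta>' \<le> \<beta>"
    and points: "\<forall>n. finite (X n)" "\<forall>n. X n \<subseteq> \<Omega> - {0}" "incseq X" "\<Omega> \<subseteq> closure (\<Union>n. X n)"
    and kernel: "pos_def_kernel \<Omega> k" "C2_on (\<Omega> \<times> \<Omega>) (\<lambda>(x, y). k x y)"
    and opt_value_in_rkhs: "\<forall>x\<in>\<Omega>. opt_value f g h R x < \<infinity>"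
      "restr \<Omega> (\<lambda>x. enn2real (opt_value f g h R x)) \<in> rkhs \<Omega> k"
  shows "\<exists>\<Omega>'. is_domain \<Omega>' \<and> \<Omega>' \<subseteq> \<Omega> \<and> 0 \<in> \<Omega>' \<and>
     (\<forall>v :: nat \<Rightarrow> real^'n \<Rightarrow> real.
        (\<forall>n. v n \<in> minimizers f g h R \<Omega> k (X n) \<alpha> \<beta>) \<longrightarrow>
        (\<forall>n. restr \<Omega>' (\<lambda>x. v n x - enn2real (opt_value f g h R x)) \<in> rkhs \<Omega>' k) \<and>
        (\<lambda>n. rkhs_norm \<Omega>' k (restr \<Omega>' (\<lambda>x. v n x - enn2real (opt_value f g h R x)))) \<longlonglongrightarrow> 0)"
proof -
  let ?V = "\<lambda>x. enn2real (opt_value f g h R x)"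
  define V where "V = restr \<Omega> ?V"
  have \<Omega>: "open \<Omega>" using domain(1) by (simp add: is_domain_def)
  have h0: "h 0 = 0" and h_pos: "\<And>z. z \<noteq> 0 \<Longrightarrow> 0 < h z" using data by (auto simp: standing_data_def)
  interpret control_problem f g h R
  proof
    show "0 \<le> h z" for z using h0 h_pos[of z] by (cases "z = 0") auto
  qed (use data in \<open>auto simp: standing_data_def\<close>)
  \<comment> \<open>Unfolding \<open>rkhs\<close> at \<open>V\<close> supplies a concrete Hilbert
    space; \<open>rkhs_eq\<close> and \<open>rkhs_norm_eq\<close> identify it with the carrier and
    norm of the statement.\<close>
  obtain H ip where H: "is_rkhs \<Omega> k H ip" "V \<in> H"
    using opt_value_in_rkhs(2) unfolding rkhs_def V_def by blast
  interpret rkhs_C2 \<Omega> k H ip by unfold_locales (fact H(1) \<Omega> kernel(2))+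
  have VH: "V \<in> H" by (rule H(2))
  have opt_V: "opt_value f g h R x = ennreal (V x)" if "x \<in> \<Omega>" for x
    using that opt_value_in_rkhs(1) by (simp add: V_def restr_def less_top)
  have V_nonneg: "0 \<le> V x" for x by (simp add: V_def restr_def)
  have V_bounds: "\<alpha> * (norm x)\<^sup>2 \<le> V x" "V x \<le> \<beta> * (norm x)\<^sup>2" if "x \<in> \<Omega>" for x
  proof -
    have "ennreal (\<alpha>' * (norm x)\<^sup>2) \<le> ennreal (V x)" "ennreal (V x) \<le> ennreal (\<beta>' * (norm x)\<^sup>2)"
      using quadratic_bounds(3) opt_V[OF that] that by auto
    then have "\<alpha>' * (norm x)\<^sup>2 \<le> V x" "V x \<le> \<beta>' * (norm x)\<^sup>2"
      using V_nonneg quadratic_bounds(2) by (auto simp: ennreal_le_iff)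
    moreover have "\<alpha> * (norm x)\<^sup>2 \<le> \<alpha>' * (norm x)\<^sup>2" "\<beta>' * (norm x)\<^sup>2 \<le> \<beta> * (norm x)\<^sup>2"
      using parameters by (auto intro: mult_right_mono)
    ultimately show "\<alpha> * (norm x)\<^sup>2 \<le> V x" "V x \<le> \<beta> * (norm x)\<^sup>2" by linarith+
  qed
  have V0: "V 0 = 0" using V_bounds[OF domain(3)] by simp
  have V_hjb: "hjb (gradient V) x = 0" if "x \<in> \<Omega>" for x
    by (rule hjb_opt_value[OF \<Omega> that opt_V V_nonneg GDERIV_gradient[OF VH] continuous_on_gradient[OF VH]])
  have feasible_iff: "v \<in> feasible f g h R \<Omega> k Y \<alpha> \<beta> \<longleftrightarrow> v \<in> H \<and> (\<forall>x\<in>Y. hjb (gradient v) x = 0) \<and>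
      (\<forall>x\<in>Y. \<beta> * (norm x)\<^sup>2 \<ge> v x \<and> v x \<ge> \<alpha> * (norm x)\<^sup>2) \<and> v 0 = 0" for v Y
    by (simp only: feasible_def hjb_def rkhs_eq mem_Collect_eq)
  have V_feasible: "V \<in> feasible f g h R \<Omega> k (X n) \<alpha> \<beta>" for n
    using VH V_hjb V_bounds V0 points(2) unfolding feasible_iff by blast
  have hjb_cong: "hjb G x = hjb G' x" if "G x = G' x" for G G' x using that by (simp add: hjb_def)
  have \<beta>: "0 < \<beta>" using quadratic_bounds(2) parameters(3) by simp
  obtain r where r: "0 < r" "cball 0 r \<subseteq> \<Omega>" using \<Omega> domain(3) open_contains_cball by blast
  \<comment> \<open>Because the minimum is at most 1, its square is at most
    \<open>\<alpha> / (2 * \<beta>)\<close>; this gives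
    \<open>\<beta> * \<rho>\<^sup>2 \<le> \<alpha> * r\<^sup>2 / 2\<close> without taking a
    root.\<close>
  define \<rho> where "\<rho> = r * min 1 (\<alpha> / (2 * \<beta>))"
  have \<rho>: "0 < \<rho>" "\<rho> \<le> r" using r(1) parameters(1) \<beta> by (auto simp: \<rho>_def mult_left_le)
  have \<beta>\<rho>: "\<beta> * \<rho>\<^sup>2 < \<alpha> * r\<^sup>2"
  proof -
    have "(min 1 (\<alpha> / (2 * \<beta>)))\<^sup>2 \<le> 1 * (\<alpha> / (2 * \<beta>))"
      unfolding power2_eq_square using parameters(1) \<beta> by (intro mult_mono) auto
    then have sq: "(min 1 (\<alpha> / (2 * \<beta>)))\<^sup>2 \<le> \<alpha> / (2 * \<beta>)" by simp
    have "\<beta> * \<rho>\<^sup>2 = \<beta> * (r\<^sup>2 * (min 1 (\<alpha> / (2 * \<beta>)))\<^sup>2)"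
      by (simp only: \<rho>_def power_mult_distrib)
    also have "\<dots> \<le> \<beta> * (r\<^sup>2 * (\<alpha> / (2 * \<beta>)))"
      using \<beta> by (intro mult_left_mono sq) auto
    also have "\<dots> = \<alpha> * r\<^sup>2 / 2" using \<beta> by simp
    also have "\<dots> < \<alpha> * r\<^sup>2" using parameters(1) r(1) by simp
    finally show ?thesis .
  qed
  let ?B = "ball (0 :: real^'n) \<rho>"
  have B\<Omega>: "?B \<subseteq> \<Omega>" using r(2) \<rho>(2) by (meson ball_subset_cball order_trans subset_ball)
  have dom_B: "is_domain ?B" "0 \<in> ?B" using \<rho>(1) by (auto simp: is_domain_def)
  have unique: "v x = V x" if v: "v \<in> H" "\<And>x. x \<in> \<Omega> \<Longrightarrow> hjb (gradient v) x = 0"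
      "\<And>x. x \<in> \<Omega> \<Longrightarrow> \<alpha> * (norm x)\<^sup>2 \<le> v x \<and> v x \<le> \<beta> * (norm x)\<^sup>2" "v 0 = 0" and x: "x \<in> ?B" for v x
  proof -
    have x\<Omega>: "x \<in> \<Omega>" and xr: "x \<in> cball 0 r" using x B\<Omega> \<rho>(2) by auto
    have "\<beta> * (norm x)\<^sup>2 \<le> \<beta> * \<rho>\<^sup>2" using x \<beta> by (intro mult_left_mono power_mono) auto
    then have small: "v x < \<alpha> * r\<^sup>2" "V x < \<alpha> * r\<^sup>2" using v(3)[OF x\<Omega>] V_bounds[OF x\<Omega>] \<beta>\<rho> by linarith+
    \<comment> \<open>The comparison is applied in both directions. This is possible because
      \<open>v\<close> and \<open>V\<close> satisfy the same lower bound and both lie below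
      \<open>\<alpha> * r\<^sup>2\<close> at \<open>x\<close>.\<close>
    have "V x \<le> v x"
      by (rule comparison[OF h_pos r(2) parameters(1) GDERIV_gradient[OF v(1)] v(2) _ v(4)
            GDERIV_gradient[OF VH] V_hjb V0 xr small(1)]) (use v(3) in auto)
    moreover have "v x \<le> V x"
      by (rule comparison[OF h_pos r(2) parameters(1) GDERIV_gradient[OF VH] V_hjb V_bounds(1) V0
            GDERIV_gradient[OF v(1)] v(2) v(4) xr small(2)])
    ultimately show ?thesis by simp
  qed
  have restr_eq: "restr ?B (\<lambda>x. v x - ?V x) = restr ?B (\<lambda>x. v x - V x)" for v
  proof
    fix x show "restr ?B (\<lambda>x. v x - ?V x) x = restr ?B (\<lambda>x. v x - V x) x"
      using subsetD[OF B\<Omega>, of x] by (simp add: restr_def V_def)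
  qed
  have "(\<lambda>n. rkhs_norm ?B k (restr ?B (\<lambda>x. v n x - V x))) \<longlonglongrightarrow> 0"
    if v: "\<forall>n. v n \<in> minimizers f g h R \<Omega> k (X n) \<alpha> \<beta>" for v
  proof (rule LIMSEQ_subseqI)
    have vf: "v n \<in> feasible f g h R \<Omega> k (X n) \<alpha> \<beta>" for n using v by (simp add: minimizers_def)
    then have vH: "v n \<in> H" for n by (simp add: feasible_iff)
    have v_min: "sqn (v n) \<le> sqn u" if u: "u \<in> feasible f g h R \<Omega> k (X n) \<alpha> \<beta>" for u n
    proof -
      have "u \<in> H" using u by (simp add: feasible_iff)
      moreover have "rkhs_norm \<Omega> k (v n) \<le> rkhs_norm \<Omega> k u" using v u by (simp add: minimizers_def)
      ultimately show ?thesis using vH by (simp add: rkhs_norm_eq)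
    qed
    show "0 \<le> rkhs_norm ?B k (restr ?B (\<lambda>x. v n x - V x))" for n
      by (rule restriction_contraction(2)[OF B\<Omega> diff_in[OF vH VH]])
    fix \<sigma> :: "nat \<Rightarrow> nat" assume \<sigma>: "strict_mono \<sigma>"
    define E where "E = (\<Union>n. X n)"
    have "countable (X n)" for n using points(1) by (simp add: countable_finite)
    then have E: "countable E" "E \<subseteq> \<Omega>" using points(2) by (auto simp: E_def)
    obtain \<kappa> l l' where \<kappa>: "strict_mono (\<kappa> :: nat \<Rightarrow> nat)"
      and lim: "\<And>x. x \<in> E \<Longrightarrow> (\<lambda>n. v (\<sigma> (\<kappa> n)) x) \<longlonglongrightarrow> l x"
        "\<And>x. x \<in> E \<Longrightarrow> (\<lambda>n. gradient (v (\<sigma> (\<kappa> n))) x) \<longlonglongrightarrow> l' x"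
    proof (rule convergent_data_subsequence[OF E, of "\<lambda>n. v (\<sigma> n)" "sqn V"])
      show "v (\<sigma> n) \<in> H" "sqn (v (\<sigma> n)) \<le> sqn V" for n using vH v_min[OF V_feasible] by blast+
    qed (rule that; assumption)
    define w where "w n = v (\<sigma> (\<kappa> n))" for n
    have wH: "w n \<in> H" for n using vH by (simp add: w_def)
    have ge: "n \<le> \<sigma> (\<kappa> n)" for n
      using strict_mono_imp_increasing[OF \<kappa>, of n] strict_mono_imp_increasing[OF \<sigma>, of "\<kappa> n"] by linarith
    have constraints: "hjb l' x = 0 \<and> \<alpha> * (norm x)\<^sup>2 \<le> l x \<and> l x \<le> \<beta> * (norm x)\<^sup>2" if x: "x \<in> E" for x
    proof -
      obtain N where N: "x \<in> X N" using x by (auto simp: E_def)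
      \<comment> \<open>Nestedness of the collocation sets makes the constraints at a given point
        hold from some index on, so they pass to the limit data.\<close>
      have xn: "x \<in> X (\<sigma> (\<kappa> n))" if "n \<ge> N" for n
        using points(3) N that ge[of n] unfolding incseq_def by (meson order_trans subsetD)
      have *: "hjb (gradient (w n)) x = 0" "\<alpha> * (norm x)\<^sup>2 \<le> w n x" "w n x \<le> \<beta> * (norm x)\<^sup>2" if "n \<ge> N" for n
        using vf[of "\<sigma> (\<kappa> n)"] xn[OF that] unfolding feasible_iff w_def by blast+
      have "continuous_on UNIV (\<lambda>p. hjb (\<lambda>_. p) x)"
        unfolding hjb_def weighted_norm_inv[OF R] by (intro continuous_intros)
      then have "isCont (\<lambda>p. hjb (\<lambda>_. p) x) (l' x)" by (simp add: continuous_on_eq_continuous_at)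
      then have "(\<lambda>n. hjb (\<lambda>_. gradient (w n) x) x) \<longlonglongrightarrow> hjb (\<lambda>_. l' x) x"
        using isCont_tendsto_compose lim(2)[OF x] unfolding w_def by blast
      moreover have "hjb (\<lambda>_. gradient (w n) x) x = hjb (gradient (w n)) x" for n by (rule hjb_cong) simp
      moreover have "hjb (\<lambda>_. l' x) x = hjb l' x" by (rule hjb_cong) simp
      ultimately have "(\<lambda>n. hjb (gradient (w n)) x) \<longlonglongrightarrow> hjb l' x" by simp
      moreover have "(\<lambda>n. hjb (gradient (w n)) x) \<longlonglongrightarrow> 0"
        by (rule tendsto_eventually) (use *(1) in \<open>auto simp: eventually_sequentially\<close>)
      ultimately have "hjb l' x = 0" by (rule LIMSEQ_unique)
      moreover have "\<alpha> * (norm x)\<^sup>2 \<le> l x"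
        by (rule LIMSEQ_le_const[OF lim(1)[OF x]]) (use *(2) in \<open>auto simp: w_def\<close>)
      moreover have "l x \<le> \<beta> * (norm x)\<^sup>2"
        by (rule LIMSEQ_le_const2[OF lim(1)[OF x]]) (use *(3) in \<open>auto simp: w_def\<close>)
      ultimately show ?thesis by simp
    qed
    \<comment> \<open>The origin is not a collocation point, so its value is not among the limit
      data. It is recovered by continuity, since on the dense set \<open>E\<close> the values are
      squeezed to zero by \<open>\<beta> * (norm x)\<^sup>2\<close>.\<close>
    have lim_zero: "u 0 = 0" if u: "u \<in> H" "\<And>x. x \<in> E \<Longrightarrow> u x = l x" for u
    proof -
      have cont: "continuous_on \<Omega> u"
        by (rule GDERIV_continuous_on[OF GDERIV_gradient[OF u(1)]])
      have "\<bar>u 0\<bar> - \<beta> * (norm (0 :: real^'n))\<^sup>2 \<in> {..0}"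
      proof (rule closed_on_dense[OF _ \<Omega> _ closed_atMost _ domain(3)])
        show "continuous_on \<Omega> (\<lambda>x. \<bar>u x\<bar> - \<beta> * (norm x)\<^sup>2)" by (intro continuous_intros cont)
        show "\<Omega> \<subseteq> closure E" using points(4) by (simp add: E_def)
        fix x assume x: "x \<in> E"
        have "0 \<le> \<alpha> * (norm x)\<^sup>2" using parameters(1) by simp
        then show "\<bar>u x\<bar> - \<beta> * (norm x)\<^sup>2 \<in> {..0}" using constraints[OF x] u(2)[OF x] by simp
      qed
      then show ?thesis by simp
    qed
    \<comment> \<open>The limit data satisfy all constraints, so every function carrying them
      competes in every problem; this yields the minimality hypothesis of
      \<open>minimizers_converge\<close>.\<close>
    have l_feasible: "u \<in> feasible f g h R \<Omega> k (X n) \<alpha> \<beta>"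
      if u: "u \<in> H" "\<And>x. x \<in> E \<Longrightarrow> u x = l x \<and> gradient u x = l' x" for u n
      unfolding feasible_iff
    proof (intro conjI ballI u(1))
      show "u 0 = 0" using lim_zero[OF u(1)] u(2) by blast
      fix x assume "x \<in> X n"
      then have x: "x \<in> E" by (auto simp: E_def)
      have "hjb (gradient u) x = hjb l' x" using u(2)[OF x] by (intro hjb_cong) simp
      then show "hjb (gradient u) x = 0" using constraints[OF x] by simp
      show "u x \<le> \<beta> * (norm x)\<^sup>2" "\<alpha> * (norm x)\<^sup>2 \<le> u x" using constraints[OF x] u(2)[OF x] by simp_all
    qed
    obtain u where u: "u \<in> H" "tends_to w u"
    proof (rule minimizers_converge[OF E(2) wH])
      show "sqn (w n) \<le> sqn V" for n unfolding w_def by (rule v_min[OF V_feasible])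
      show "x \<in> E \<Longrightarrow> (\<lambda>n. w n x) \<longlonglongrightarrow> l x" "x \<in> E \<Longrightarrow> (\<lambda>n. gradient (w n) x) \<longlonglongrightarrow> l' x" for x
        unfolding w_def by (fact lim)+
      show "sqn (w n) \<le> sqn u" if "u \<in> H" "\<And>x. x \<in> E \<Longrightarrow> u x = l x \<and> gradient u x = l' x" for u n
        unfolding w_def by (rule v_min[OF l_feasible[OF that]])
    qed (rule that)
    have u_E: "u x = l x" "gradient u x = l' x" if x: "x \<in> E" for x
    proof -
      show "u x = l x" using LIMSEQ_unique[OF tendsto_eval[OF wH u] lim(1)[OF x, folded w_def]] .
      have "x \<in> \<Omega>" using x E by blast
      then show "gradient u x = l' x"
        using LIMSEQ_unique[OF tendsto_gradient[OF wH u] lim(2)[OF x, folded w_def]] by blast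
    qed
    have u_cont: "continuous_on \<Omega> u"
      by (rule GDERIV_continuous_on[OF GDERIV_gradient[OF u(1)]])
    have dense: "\<Omega> \<subseteq> closure E" using points(4) by (simp add: E_def)
    have u_hjb: "hjb (gradient u) x = 0" if "x \<in> \<Omega>" for x
    proof -
      have "hjb (gradient u) x \<in> {0}"
      proof (rule closed_on_dense[OF continuous_on_hjb[OF continuous_on_gradient[OF u(1)]] \<Omega> dense _ _ that])
        fix y assume y: "y \<in> E"
        have "hjb (gradient u) y = hjb l' y" using u_E[OF y] by (intro hjb_cong) simp
        then show "hjb (gradient u) y \<in> {0}" using constraints[OF y] by simp
      qed simp
      then show ?thesis by simp
    qed
    have u_bounds: "\<alpha> * (norm x)\<^sup>2 \<le> u x \<and> u x \<le> \<beta> * (norm x)\<^sup>2" if x: "x \<in> \<Omega>" for x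
    proof -
      have "u x - \<alpha> * (norm x)\<^sup>2 \<in> {0..}"
        by (rule closed_on_dense[OF _ \<Omega> dense _ _ x])
          (use constraints u_E in \<open>auto intro!: continuous_intros u_cont\<close>)
      moreover have "u x - \<beta> * (norm x)\<^sup>2 \<in> {..0}"
        by (rule closed_on_dense[OF _ \<Omega> dense _ _ x])
          (use constraints u_E in \<open>auto intro!: continuous_intros u_cont\<close>)
      ultimately show ?thesis by simp
    qed
    have uV: "u x = V x" if "x \<in> ?B" for x
      by (rule unique[OF u(1) u_hjb u_bounds _ that]) (use u_bounds[OF domain(3)] in auto)
    \<comment> \<open>On the ball \<open>u\<close> may replace \<open>V\<close>, and the norm there
      is dominated by the distance of \<open>w n\<close> to \<open>u\<close> on all of
      \<Omega>.\<close>
    have "(\<lambda>n. rkhs_norm ?B k (restr ?B (\<lambda>x. w n x - V x))) \<longlonglongrightarrow> 0"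
    proof (rule tendsto_sandwich[OF _ _ tendsto_const])
      have "(\<lambda>n. sqrt (sqdist (w n) u)) \<longlonglongrightarrow> sqrt 0" using u(2) by (intro tendsto_intros)
      then show "(\<lambda>n. sqrt (sqdist (w n) u)) \<longlonglongrightarrow> 0" by simp
      have eq: "restr ?B (\<lambda>x. w n x - V x) = restr ?B (\<lambda>x. w n x - u x)" for n
        using uV by (auto simp: restr_def)
      show "\<forall>\<^sub>F n in sequentially. 0 \<le> rkhs_norm ?B k (restr ?B (\<lambda>x. w n x - V x))"
        using restriction_contraction(2)[OF B\<Omega> diff_in[OF wH VH]] by simp
      show "\<forall>\<^sub>F n in sequentially. rkhs_norm ?B k (restr ?B (\<lambda>x. w n x - V x)) \<le> sqrt (sqdist (w n) u)"
        using restriction_contraction(3)[OF B\<Omega> diff_in[OF wH u(1)]] unfolding eq sqdist_def by simp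
    qed
    then show "\<exists>\<kappa>::nat \<Rightarrow> nat. (\<lambda>n. rkhs_norm ?B k (restr ?B (\<lambda>x. v (\<sigma> (\<kappa> n)) x - V x))) \<longlonglongrightarrow> 0"
      unfolding w_def by blast
  qed
  moreover have "restr ?B (\<lambda>x. v n x - V x) \<in> rkhs ?B k"
    if "\<forall>n. v n \<in> minimizers f g h R \<Omega> k (X n) \<alpha> \<beta>" for v n
  proof -
    have "v n \<in> H" using that by (simp add: minimizers_def feasible_iff)
    then show ?thesis by (intro restriction_contraction(1)[OF B\<Omega>] diff_in VH)
  qed
  ultimately show ?thesis using dom_B B\<Omega> by (intro exI[of _ ?B]) (simp add: restr_eq)
qed

end
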